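(* Let $K$ be an algebraically closed field (of arbitrary characteristic) and let $f\in\mathfrak m\subset K[[x,y]]$ be reduced. Then $\delta(f)=\delta_N(f)$ if and only if $f$ is WHNND (weighted homogeneous Newton non-degenerate).
   Context: $\mathfrak m=\langle x,y\rangle$ is the maximal ideal of $K[[x,y]]$. For $f=\sum c_{ij}x^iy^j$ let $\mathrm{supp}(f)=\{(i,j):c_{ij}\neq0\}$. The Newton polyhedron $\Gamma_+(f)$ is the convex hull of $\bigcup_{\alpha\in\mathrm{supp}(f)}(\alpha+\mathbb R^2_{\ge0})$; the Newton diagram $\Gamma(f)$ is the union of its compact faces; $\Gamma_-(f)$ is the union of all line segments joining the origin to a point of $\Gamma(f)$; $f$ is convenient if $\Gamma(f)$ meets both coordinate axes. Delta invariant: $\delta(f)=\sum_{Q\to0}\frac{m_Q(m_Q-1)}{2}$, where the sum is over the infinitely near points $Q$ of the origin on $f$ (in a fixed minimal resolution computed by successively blowing up points) and $m_Q$ is the multiplicity at $Q$ of the corresponding strict transform of $f$. Equivalently, $\delta(f)=\dim_K(\bar R/R)$, where $R=K[[x,y]]/\langle f\rangle$ and $\bar R$ is the integral closure of $R$ in its total ring of fractions. Newton $\delta$-invariant: let $E_1,\dots,E_k$ be the edges of $\Gamma(f)$ and let $l(E_i)$ be the lattice length of $E_i$ (number of lattice points on $E_i$ minus one). If $f$ is convenient, $\delta_N(f)=V_2(\Gamma_-(f))-\frac{V_1(\Gamma_-(f))}{2}+\frac{\sum_{i=1}^k l(E_i)}{2}$, where $V_2$ is the area and $V_1$ is the sum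 of the lengths of the intersections with the two coordinate axes. Otherwise $\delta_N(f)=\sup\{\delta_N(f^{(m)}) : f^{(m)}:=f+x^m+y^m,\ m\in\mathbb N\}$. WHNND: for an edge $E$ of $\Gamma(f)$ put $f_E=\sum_{(i,j)\in E}c_{ij}x^iy^j$. It can be written as $f_E=\text{monomial}\times\prod_{i=1}^s(a_ix^{m_0}-b_iy^{n_0})^{r_i}$ with $a_i,b_i\in K^*$, $(a_i:b_i)$ pairwise distinct, $m_0,n_0,r_i\in\mathbb N_{>0}$, $\gcd(m_0,n_0)=1$. Let $f=f^{\mathrm w}_d+f^{\mathrm w}_{d+1}+\cdots$, $f^{\mathrm w}_d\ne0$, be the $(n_0,m_0)$-weighted homogeneous decomposition of $f$, i.e. $f^{\mathrm w}_l$ is the sum of the terms $c_{ij}x^iy^j$ with $n_0i+m_0j=l$. $f$ is weighted homogeneous non-degenerate (WHND) along $E$ if either $r_i=1$ for all $i=1,\dots,s$, or $a_ix^{m_0}-b_iy^{n_0}$ does not divide $f^{\mathrm w}_{d+1}$ for each $i$ with $r_i>1$. $f$ is WHNND if $\Gamma(f)$ has no edge or if $f$ is WHND along each edge of $\Gamma(f)$.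
   Formalization: For non-convenient f, the supremum defining δ_N(f) runs only over those m for which f+x^m+y^m is convenient and its Newton polyhedron contains that of f; over all m, accidental cancellation makes the claim false, e.g. f = xy²−x³+x⁵ with m = 3. *)

theory Defs
  imports
    "HOL-Analysis.Analysis"
    "HOL-Computational_Algebra.Formal_Power_Series"
    "HOL-Computational_Algebra.Squarefree"
begin

section \<open>Power series in two variables\<close>

text \<open>
  \<open>K[[x,y]]\<close> is represented as \<open>K[[x]][[y]]\<close>: the outer series variable is \<open>y\<close>,
  the inner one is \<open>x\<close>.
\<close>

type_synonym 'a fps2 = "'a fps fps"

definition varx :: "'a::field fps2" where "varx = fps_const fps_X"
definition vary :: "'a::field fps2" where "vary = fps_X"
definition const2 :: "'a::field \<Rightarrow> 'a fps2" where "const2 c = fps_const (fps_const c)"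

text \<open>\<open>coeff2 f i j\<close> is the coefficient of \<open>x\<^sup>i y\<^sup>j\<close>.\<close>

definition coeff2 :: "'a::field fps2 \<Rightarrow> nat \<Rightarrow> nat \<Rightarrow> 'a" where
  "coeff2 f i j = fps_nth (fps_nth f j) i"

definition Abs_fps2 :: "(nat \<Rightarrow> nat \<Rightarrow> 'a::field) \<Rightarrow> 'a fps2" where
  "Abs_fps2 c = Abs_fps (\<lambda>j. Abs_fps (\<lambda>i. c i j))"

lemma coeff2_Abs_fps2 [simp]: "coeff2 (Abs_fps2 c) i j = c i j"
  by (simp add: coeff2_def Abs_fps2_def)

lemma fps2_eqI: "(\<And>i j. coeff2 f i j = coeff2 g i j) \<Longrightarrow> f = g"
  by (simp add: coeff2_def fps_eq_iff)

definition supp :: "'a::field fps2 \<Rightarrow> (nat \<times> nat) set" where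
  "supp f = {(i, j). coeff2 f i j \<noteq> 0}"

definition maximal_ideal :: "'a::field fps2 set" where
  "maximal_ideal = {f. \<exists>g h. f = varx * g + vary * h}"

section \<open>The delta invariant\<close>

text \<open>The multiplicity of \<open>f\<close> at the origin (only meaningful for \<open>f \<noteq> 0\<close>).\<close>

definition point_mult :: "'a::field fps2 \<Rightarrow> nat" where
  "point_mult f = (LEAST n. \<exists>(i, j)\<in>supp f. i + j = n)"

text \<open>
  The points of the exceptional divisor \<open>P\<^sup>1(K)\<close> of the blowing up of the origin, i.e. the tangent
  directions there: \<open>Slope a\<close> is the line \<open>y = a x\<close> and \<open>Vertical\<close> is the line \<open>x = 0\<close>.
\<close>

datatype 'a direction = Slope 'a | Vertical

text \<open>
  The total transform in local coordinates of the blown-up plane centred at the given point of the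
  exceptional divisor: \<open>f(x, x(y + a))\<close> at \<open>Slope a\<close> (exceptional divisor \<open>x = 0\<close>) and
  \<open>f(x y, y)\<close> at \<open>Vertical\<close> (exceptional divisor \<open>y = 0\<close>). The coefficients are those obtained by
  expanding \<open>x\<^sup>i (x (y + a))\<^sup>j\<close> and \<open>(x y)\<^sup>i y\<^sup>j\<close>.
\<close>

fun total_transform :: "'a::field direction \<Rightarrow> 'a fps2 \<Rightarrow> 'a fps2" where
  "total_transform (Slope a) f =
     Abs_fps2 (\<lambda>n k. \<Sum>j\<le>n. coeff2 f (n - j) j * of_nat (j choose k) * a ^ (j - k))"
| "total_transform Vertical f =
     Abs_fps2 (\<lambda>i n. if i \<le> n then coeff2 f i (n - i) else 0)"

fun exceptional :: "'a::field direction \<Rightarrow> 'a fps2" where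
  "exceptional (Slope a) = varx"
| "exceptional Vertical = vary"

text \<open>
  The strict transform: the total transform divided by the equation of the exceptional divisor
  to the power \<open>point_mult f\<close>.
\<close>

fun strict_transform :: "'a::field direction \<Rightarrow> 'a fps2 \<Rightarrow> 'a fps2" where
  "strict_transform (Slope a) f =
     Abs_fps2 (\<lambda>n k. coeff2 (total_transform (Slope a) f) (n + point_mult f) k)"
| "strict_transform Vertical f =
     Abs_fps2 (\<lambda>i n. coeff2 (total_transform Vertical f) i (n + point_mult f))"

lemma coeff2_eq_0_below_mult: "i + j < point_mult f \<Longrightarrow> coeff2 f i j = 0"
  unfolding point_mult_def supp_def by (drule not_less_Least) auto

lemma coeff2_varx_power_mult:
  "coeff2 (varx ^ m * g) i j = (if i < m then 0 else coeff2 g (i - m) j)"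
  by (simp add: coeff2_def varx_def fps_const_power fps_mult_left_const_nth fps_X_power_mult_nth)

lemma coeff2_vary_power_mult:
  "coeff2 (vary ^ m * g) i j = (if j < m then 0 else coeff2 g i (j - m))"
  by (simp add: coeff2_def vary_def fps_X_power_mult_nth)

lemma total_transform_eq:
  "total_transform p f = exceptional p ^ point_mult f * strict_transform p f"
  by (cases p; intro fps2_eqI)
     (auto simp: coeff2_varx_power_mult coeff2_vary_power_mult coeff2_eq_0_below_mult
        intro!: sum.neutral)

text \<open>
  An infinitely near point of the origin is encoded by the list of points of the successive
  exceptional divisors that lead to it; the empty list is the origin itself. A point is on \<open>f\<close> if
  the strict transform of \<open>f\<close> vanishes there.
\<close>

fun strict_transform_at :: "'a::field direction list \<Rightarrow> 'a fps2 \<Rightarrow> 'a fps2" where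
  "strict_transform_at [] f = f"
| "strict_transform_at (p # ps) f = strict_transform_at ps (strict_transform p f)"

fun on_curve :: "'a::field direction list \<Rightarrow> 'a fps2 \<Rightarrow> bool" where
  "on_curve [] f \<longleftrightarrow> f \<in> maximal_ideal"
| "on_curve (p # ps) f \<longleftrightarrow> f \<in> maximal_ideal \<and> on_curve ps (strict_transform p f)"

definition infinitely_near_points :: "'a::field fps2 \<Rightarrow> 'a direction list set" where
  "infinitely_near_points f = {Q. on_curve Q f}"

text \<open>
  All infinitely near points are admitted. Those beyond a minimal resolution have multiplicity
  \<open>1\<close> and contribute \<open>0\<close>. A sum of nonnegative terms always exists in \<^typ>\<open>ereal\<close>.
\<close>

definition delta :: "'a::field fps2 \<Rightarrow> ereal" where
  "delta f = (\<Sum>\<^sub>\<infinity>Q\<in>infinitely_near_points f.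
     (let m = real (point_mult (strict_transform_at Q f)) in ereal (m * (m - 1) / 2)))"

section \<open>Newton polyhedron and Newton diagram\<close>

definition newton_polyhedron :: "'a::field fps2 \<Rightarrow> (real \<times> real) set" where
  "newton_polyhedron f =
     convex hull (\<Union>(i, j)\<in>supp f. {(real i + u, real j + v) | u v. u \<ge> 0 \<and> v \<ge> 0})"

definition newton_diagram :: "'a::field fps2 \<Rightarrow> (real \<times> real) set" where
  "newton_diagram f = \<Union>{F. F face_of newton_polyhedron f \<and> compact F}"

definition newton_edges :: "'a::field fps2 \<Rightarrow> (real \<times> real) set set" where
  "newton_edges f = {E. E edge_of newton_polyhedron f \<and> compact E}"

definition newton_minus :: "'a::field fps2 \<Rightarrow> (real \<times> real) set" where
  "newton_minus f = (\<Union>p\<in>newton_diagram f. closed_segment 0 p)"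

definition convenient :: "'a::field fps2 \<Rightarrow> bool" where
  "convenient f \<longleftrightarrow> (\<exists>t. (t, 0) \<in> newton_diagram f) \<and> (\<exists>t. (0, t) \<in> newton_diagram f)"

section \<open>The Newton delta invariant\<close>

definition lattice_length :: "(real \<times> real) set \<Rightarrow> real" where
  "lattice_length E = real (card {(u, v) \<in> E. u \<in> \<int> \<and> v \<in> \<int>}) - 1"

definition axis_length :: "(real \<times> real) set \<Rightarrow> real" where
  "axis_length S = measure lebesgue {t. (t, 0) \<in> S} + measure lebesgue {t. (0, t) \<in> S}"

definition delta_N_convenient :: "'a::field fps2 \<Rightarrow> real" where
  "delta_N_convenient f =
     measure lebesgue (newton_minus f) - axis_length (newton_minus f) / 2
       + (\<Sum>E\<in>newton_edges f. lattice_length E) / 2"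

definition completion :: "nat \<Rightarrow> 'a::field fps2 \<Rightarrow> 'a fps2" where
  "completion m f = f + varx ^ m + vary ^ m"

text \<open>
  For \<open>f\<close> that is not convenient, \<open>m\<close> ranges over the exponents for which the added monomials do
  not cancel a vertex of the Newton polyhedron of \<open>f\<close>; this only excludes finitely many \<open>m\<close>.
  Without the restriction the supremum would depend on accidental cancellation:
  for \<open>f = x y\<^sup>2 - x\<^sup>3 + x\<^sup>5\<close> and \<open>m = 3\<close> the term \<open>- x\<^sup>3\<close> disappears, and the value \<open>4\<close> of
  the resulting series exceeds the value \<open>3\<close> obtained for all other large \<open>m\<close>;
  for \<open>f = x y - x\<^sup>3\<close> and \<open>m = 3\<close> the series \<open>x y + y\<^sup>3\<close> is not even convenient.
\<close>

definition delta_N :: "'a::field fps2 \<Rightarrow> ereal" where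
  "delta_N f =
     (if convenient f then ereal (delta_N_convenient f)
      else (SUP m\<in>{m. newton_polyhedron f \<subseteq> newton_polyhedron (completion m f) \<and>
                      convenient (completion m f)}.
              ereal (delta_N_convenient (completion m f))))"

section \<open>Weighted homogeneous Newton non-degeneracy\<close>

definition edge_part :: "(real \<times> real) set \<Rightarrow> 'a::field fps2 \<Rightarrow> 'a fps2" where
  "edge_part E f = Abs_fps2 (\<lambda>i j. if (real i, real j) \<in> E then coeff2 f i j else 0)"

definition weighted_part :: "nat \<Rightarrow> nat \<Rightarrow> nat \<Rightarrow> 'a::field fps2 \<Rightarrow> 'a fps2" where
  "weighted_part w1 w2 l f = Abs_fps2 (\<lambda>i j. if w1 * i + w2 * j = l then coeff2 f i j else 0)"

definition weighted_order :: "nat \<Rightarrow> nat \<Rightarrow> 'a::field fps2 \<Rightarrow> nat" where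
  "weighted_order w1 w2 f = (LEAST l. weighted_part w1 w2 l f \<noteq> 0)"

definition binomial_factor :: "nat \<Rightarrow> nat \<Rightarrow> 'a::field \<Rightarrow> 'a \<Rightarrow> 'a fps2" where
  "binomial_factor m0 n0 a b = const2 a * varx ^ m0 - const2 b * vary ^ n0"

definition edge_factorization ::
  "(real \<times> real) set \<Rightarrow> 'a::field fps2 \<Rightarrow> nat \<Rightarrow> nat \<Rightarrow> nat \<Rightarrow> (nat \<Rightarrow> 'a) \<Rightarrow> (nat \<Rightarrow> 'a) \<Rightarrow> (nat \<Rightarrow> nat) \<Rightarrow> bool"
where
  "edge_factorization E f m0 n0 s a b r \<longleftrightarrow>
     m0 > 0 \<and> n0 > 0 \<and> coprime m0 n0 \<and>
     (\<forall>i\<in>{1..s}. a i \<noteq> 0 \<and> b i \<noteq> 0 \<and> r i > 0) \<and>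
     (\<forall>i\<in>{1..s}. \<forall>j\<in>{1..s}. i \<noteq> j \<longrightarrow> a i * b j \<noteq> a j * b i) \<and>
     (\<exists>p q. edge_part E f =
        varx ^ p * vary ^ q * (\<Prod>i=1..s. binomial_factor m0 n0 (a i) (b i) ^ r i))"

text \<open>
  The factorization of \<open>f\<^sub>E\<close> exists over an algebraically closed field and is unique up to order
  and scaling of the factors, so the condition does not depend on the one chosen.
\<close>

definition WHND_along :: "'a::field fps2 \<Rightarrow> (real \<times> real) set \<Rightarrow> bool" where
  "WHND_along f E \<longleftrightarrow>
     (\<exists>m0 n0 s a b r. edge_factorization E f m0 n0 s a b r \<and>
        ((\<forall>i\<in>{1..s}. r i = 1) \<or>
         (\<forall>i\<in>{1..s}. r i > 1 \<longrightarrow>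
            \<not> binomial_factor m0 n0 (a i) (b i) dvd
                weighted_part n0 m0 (weighted_order n0 m0 f + 1) f)))"

definition WHNND :: "'a::field fps2 \<Rightarrow> bool" where
  "WHNND f \<longleftrightarrow> newton_edges f = {} \<or> (\<forall>E\<in>newton_edges f. WHND_along f E)"

end

theory Submission
  imports Defs
begin

text \<open>
  For a primitive weight \<open>w = (w\<^sub>1, w\<^sub>2)\<close> let \<open>d\<^sub>w\<close> be the weighted order of \<open>f\<close> and \<open>l\<^sub>w\<close> the lattice length of
  the face of the Newton polyhedron on which \<open>w\<close> is minimal. Cutting \<open>\<Gamma>\<^sub>-\<close> into triangles with apex at
  the origin gives \<open>2 \<delta>\<^sub>N = \<Sum>\<^sub>w l\<^sub>w (d\<^sub>w + 1 - w\<^sub>1 - w\<^sub>2)\<close>, and this is twice the number \<open>N(f)\<close> of positive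
  lattice points on or below the Newton diagram. The number \<open>N\<close> is monotone in
  the polyhedron, which also settles the supremum for series that are not convenient.

  Let \<open>m\<close> be the multiplicity of \<open>f\<close>. At the two coordinate directions, blowing up acts on exponents by
  \<open>(i, j) \<mapsto> (i + j - m, j)\<close> and \<open>(i, j) \<mapsto> (i, i + j - m)\<close>. These maps carry the edges of weight
  \<open>(a, a + b)\<close>, respectively \<open>(a + b, b)\<close>, to edges of weight \<open>(a, b)\<close> and preserve non-degeneracy along
  them, and \<open>N(f) = m (m - 1) / 2 + N(f\<^sub>0) + N(f\<^sub>\<infinity>)\<close> for the two strict transforms. The recursion
  for \<open>\<delta>\<close> has additional nonnegative contributions of the strict transforms at the lines \<open>y = a x\<close> with
  \<open>a \<noteq> 0\<close>; they vanish if and only if all these transforms are smooth or empty, which is non-degeneracy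
  along the edge of weight \<open>(1, 1)\<close>. Induction on \<open>N(f)\<close> yields \<open>N \<le> \<delta>\<close>, with equality exactly for
  WHNND series.
\<close>

section \<open>Weights on lattice points\<close>

text \<open>The passage from (a, a + b) to (a, b) and its mirror image are the steps of the
  subtractive Euclidean algorithm, so every primitive weight arrives at (1, 1) in exactly one chart
  at a coordinate point. Degeneracy along any edge is thereby tested at a tangent direction y = a x
  with a \<noteq> 0.

  The strict transforms at these oblique directions have no controlled Newton diagram, and the
  induction does not enter them: only the vanishing of their contribution matters, and for nonzero
  series \<open>delta\<close> vanishes exactly when the multiplicity is at most one.

  The induction hypothesis has to survive blowing up. It is stated for \<open>thin\<close> exponent
  sets, a condition that makes N finite and passes to both coordinate transforms;
  \<open>delta\<close> may be infinite in this class, so the comparison takes place in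
  \<open>ereal\<close>.

  Non-degeneracy is recast as the absence of a nonzero common root z of the lowest part, its Euler
  derivative and the next part. This form needs no factorization, can be followed through the charts
  and works in every characteristic.\<close>

definition wt :: "nat \<times> nat \<Rightarrow> nat \<times> nat \<Rightarrow> nat" where
  "wt w p = fst w * fst p + snd w * snd p"

lemma wt_Pair [simp]: "wt (a, b) (i, j) = a * i + b * j"
  by (simp add: wt_def)

definition weights :: "(nat \<times> nat) set" where
  "weights = {w. fst w > 0 \<and> snd w > 0 \<and> coprime (fst w) (snd w)}"

definition worder :: "nat \<times> nat \<Rightarrow> (nat \<times> nat) set \<Rightarrow> nat" where
  "worder w S = Inf (wt w ` S)"

definition mface :: "nat \<times> nat \<Rightarrow> (nat \<times> nat) set \<Rightarrow> (nat \<times> nat) set" where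
  "mface w S = {p \<in> S. wt w p = worder w S}"

text \<open>The positive lattice points on or below the Newton diagram. As both entries of a weight are
  positive, points on the unbounded faces are not counted.\<close>

definition below :: "(nat \<times> nat) set \<Rightarrow> (nat \<times> nat) set" where
  "below S = {u. fst u > 0 \<and> snd u > 0 \<and> (\<exists>w\<in>weights. \<forall>p\<in>S. wt w u \<le> wt w p)}"

lemma one_one_weights [simp]: "(1, 1) \<in> weights" "(Suc 0, Suc 0) \<in> weights"
  by (auto simp: weights_def)

lemma worder_le: "p \<in> S \<Longrightarrow> worder w S \<le> wt w p"
  unfolding worder_def by (intro cInf_lower) auto

lemma worder_attained:
  assumes "S \<noteq> {}" obtains p where "p \<in> S" "wt w p = worder w S"
proof -
  have "worder w S \<in> wt w ` S"
    unfolding worder_def using assms by (intro Inf_nat_def1) auto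
  then show thesis using that by auto
qed

lemma worder_eqI:
  assumes "p \<in> S" "wt w p = d" "\<And>q. q \<in> S \<Longrightarrow> d \<le> wt w q"
  shows "worder w S = d"
proof (rule antisym)
  show "worder w S \<le> d" using worder_le[OF assms(1), of w] assms(2) by simp
  show "d \<le> worder w S" using worder_attained[of S w] assms(1,3) by (metis empty_iff)
qed

lemma mface_nonempty: "S \<noteq> {} \<Longrightarrow> mface w S \<noteq> {}"
  using worder_attained[of S w] by (auto simp: mface_def)

lemma mface_subset: "mface w S \<subseteq> S"
  by (auto simp: mface_def)

lemma finite_wt_eq:
  assumes "w \<in> weights" shows "finite {p. wt w p = d}"
proof (rule finite_subset)
  have "i \<le> fst w * i" "j \<le> snd w * j" for i j
    using assms by (auto simp: weights_def)
  then show "{p. wt w p = d} \<subseteq> {..d} \<times> {..d}"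
    by (auto simp: wt_def intro: trans_le_add1 trans_le_add2)
qed auto

lemma finite_mface: "w \<in> weights \<Longrightarrow> finite (mface w S)"
  by (rule finite_subset[OF _ finite_wt_eq[of w "worder w S"]]) (auto simp: mface_def)

lemma wt_eq_step:
  assumes "w \<in> weights" "wt w p = wt w q" "snd p \<le> snd q"
  obtains k where "snd q = snd p + k * fst w" "fst p = fst q + k * snd w"
proof -
  obtain a b where w: "w = (a, b)" by (cases w)
  obtain i j where p: "p = (i, j)" by (cases p)
  obtain i' j' where q: "q = (i', j')" by (cases q)
  have ab: "a > 0" "b > 0" "coprime a b" using assms(1) w by (auto simp: weights_def)
  have eq: "a * i + b * j = a * i' + b * j'" and le: "j \<le> j'" using assms w p q by auto
  have "b * j \<le> b * j'" using le by simp
  then have "a * i \<ge> a * i'" using eq by linarith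
  then have ii: "i' \<le> i" using ab by simp
  have eq2: "a * (i - i') = b * (j' - j)"
    using eq ii le by (simp add: diff_mult_distrib2)
  then have "a dvd b * (j' - j)" by (metis dvd_triv_left)
  then have "a dvd j' - j" using ab coprime_dvd_mult_right_iff by blast
  then obtain k where k: "j' - j = a * k" by blast
  then have "a * (i - i') = a * (b * k)" using eq2 by (simp only: mult.left_commute)
  then have "i - i' = b * k" using ab by (metis mult_cancel1 less_irrefl)
  then show thesis using that[of k] k le ii by (simp add: p q w mult.commute)
qed

text \<open>The points of \<open>mface w S\<close> differ by multiples of the primitive vector \<open>(- snd w, fst w)\<close>, so this is
  the lattice length of their convex hull.\<close>

definition len :: "nat \<times> nat \<Rightarrow> (nat \<times> nat) set \<Rightarrow> nat" where
  "len w S = (Max (snd ` mface w S) - Min (snd ` mface w S)) div fst w"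

text \<open>On a line of constant weight the ordinate grows as the abscissa falls, so the lowest
  point of the face is also the rightmost one, and \<open>wt_eq_step\<close> measures its distance
  to the highest. The face may skip lattice points in between, hence only a parametrization with k
  \<le> \<open>len w S\<close> for the other points.\<close>

lemma mface_ends:
  assumes "w \<in> weights" "S \<noteq> {}"
  obtains i j where "(i + len w S * snd w, j) \<in> mface w S"
    "(i, j + len w S * fst w) \<in> mface w S"
    "\<And>p. p \<in> mface w S \<Longrightarrow> \<exists>k\<le>len w S. p = (i + (len w S - k) * snd w, j + k * fst w)"
    "Min (snd ` mface w S) = j" "Max (snd ` mface w S) = j + len w S * fst w"
    "Min (fst ` mface w S) = i" "Max (fst ` mface w S) = i + len w S * snd w"
proof -
  let ?M = "mface w S"
  have fin: "finite ?M" and ne: "?M \<noteq> {}" using assms finite_mface mface_nonempty by auto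
  define j where "j = Min (snd ` ?M)"
  define j' where "j' = Max (snd ` ?M)"
  have "j \<in> snd ` ?M" "j' \<in> snd ` ?M" unfolding j_def j'_def using fin ne by auto
  then obtain a b where p: "(a, j) \<in> ?M" and q: "(b, j') \<in> ?M" by auto
  have bnd: "j \<le> snd r" "snd r \<le> j'" if "r \<in> ?M" for r
    unfolding j_def j'_def using fin that by auto
  have wteq: "wt w r = wt w s" if "r \<in> ?M" "s \<in> ?M" for r s using that by (simp add: mface_def)
  obtain k where k: "j' = j + k * fst w" "a = b + k * snd w"
    using wt_eq_step[OF assms(1) wteq[OF p q]] bnd[OF p] by auto
  have w0: "fst w > 0" "snd w > 0" using assms by (auto simp: weights_def)
  have L: "len w S = k" unfolding len_def j_def[symmetric] j'_def[symmetric] using k w0 by simp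
  have all: "\<exists>k'\<le>k. r = (b + (k - k') * snd w, j + k' * fst w)" if r: "r \<in> ?M" for r
  proof -
    obtain k1 where k1: "snd r = j + k1 * fst w" "a = fst r + k1 * snd w"
      using wt_eq_step[OF assms(1) wteq[OF p r]] bnd[OF r] by auto
    have "k1 * fst w \<le> k * fst w" using k1 bnd(2)[OF r] k by simp
    then have "k1 \<le> k" using w0 by simp
    moreover have "fst r = b + (k - k1) * snd w" using k1 k \<open>k1 \<le> k\<close>
      by (simp add: diff_mult_distrib)
    ultimately show ?thesis using k1(1) by (intro exI[of _ k1]) (auto simp: prod_eq_iff)
  qed
  show thesis
  proof (rule that[of b j])
    show "(b + len w S * snd w, j) \<in> ?M" using p k L by simp
    show "(b, j + len w S * fst w) \<in> ?M" using q k L by simp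
    show "Min (snd ` ?M) = j" by (simp add: j_def)
    show "Max (snd ` ?M) = j + len w S * fst w" using k L by (simp add: j'_def[symmetric])
    show "Min (fst ` ?M) = b"
      by (rule Min_eqI) (use fin all q in \<open>force+\<close>)
    have "r \<le> b + len w S * snd w" if rM: "r \<in> fst ` ?M" for r
    proof -
      obtain q where "q \<in> ?M" "r = fst q" using rM by auto
      then obtain k' where "k' \<le> k" "r = b + (k - k') * snd w" using all[of q] by auto
      then show ?thesis using L by simp
    qed
    then show "Max (fst ` ?M) = b + len w S * snd w"
      by (intro Max_eqI) (use fin p k L in \<open>force+\<close>)
  qed (use all L in auto)
qed

text \<open>The definition of \<open>len\<close> favours the second coordinate. The first one gives
  the same number, and this makes \<open>len\<close> invariant under
  \<open>prod.swap\<close>.\<close>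

lemma len_eq_fst:
  assumes "w \<in> weights" "S \<noteq> {}"
  shows "len w S = (Max (fst ` mface w S) - Min (fst ` mface w S)) div snd w"
proof -
  have "snd w > 0" using assms by (auto simp: weights_def)
  then show ?thesis by (rule_tac mface_ends[OF assms]) simp
qed

lemma len_pos_iff:
  assumes "w \<in> weights" "S \<noteq> {}"
  shows "len w S > 0 \<longleftrightarrow> (\<exists>p\<in>mface w S. \<exists>q\<in>mface w S. p \<noteq> q)"
proof -
  have w0: "fst w > 0" "snd w > 0" using assms by (auto simp: weights_def)
  obtain i j where *: "(i + len w S * snd w, j) \<in> mface w S"
    "(i, j + len w S * fst w) \<in> mface w S"
    "\<And>p. p \<in> mface w S \<Longrightarrow> \<exists>k\<le>len w S. p = (i + (len w S - k) * snd w, j + k * fst w)"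
    using mface_ends[OF assms] by metis
  show ?thesis
  proof
    assume "len w S > 0"
    then show "\<exists>p\<in>mface w S. \<exists>q\<in>mface w S. p \<noteq> q"
      using *(1,2) w0 by (intro bexI[OF _ *(1)] bexI[OF _ *(2)]) auto
  next
    assume "\<exists>p\<in>mface w S. \<exists>q\<in>mface w S. p \<noteq> q"
    then show "len w S > 0" using *(3) by (metis gr0I le_zero_eq)
  qed
qed

subsection \<open>Exchanging the coordinates\<close>

lemma wt_swap [simp]: "wt (prod.swap w) (prod.swap p) = wt w p"
  by (simp add: wt_def)

lemma swap_weights [simp]: "prod.swap w \<in> weights \<longleftrightarrow> w \<in> weights"
  by (auto simp: weights_def coprime_commute)

lemma worder_swap [simp]: "worder (prod.swap w) (prod.swap ` S) = worder w S"
  by (simp add: worder_def image_image)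

lemma mface_swap: "mface (prod.swap w) (prod.swap ` S) = prod.swap ` mface w S"
proof -
  have "wt (prod.swap w) p = worder w S \<longleftrightarrow> wt w (prod.swap p) = worder w S" for p
    by (metis wt_swap swap_swap)
  then show ?thesis by (force simp: mface_def)
qed

lemma len_swap:
  assumes "w \<in> weights" "S \<noteq> {}"
  shows "len (prod.swap w) (prod.swap ` S) = len w S"
  unfolding len_eq_fst[OF assms] by (simp add: len_def mface_swap image_image)

lemma below_swap: "below (prod.swap ` S) = prod.swap ` below S"
proof (intro set_eqI)
  fix u :: "nat \<times> nat"
  have "(\<exists>w\<in>weights. \<forall>p\<in>prod.swap ` S. wt w u \<le> wt w p) \<longleftrightarrow>
        (\<exists>w\<in>weights. \<forall>p\<in>S. wt w (prod.swap u) \<le> wt w p)" (is "?l \<longleftrightarrow> ?r")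
  proof
    assume ?l
    then obtain w where w: "w \<in> weights" "\<forall>p\<in>S. wt w u \<le> wt w (prod.swap p)" by auto
    then show ?r by (intro bexI[of _ "prod.swap w"]) (auto, metis wt_swap swap_swap)
  next
    assume ?r
    then obtain w where w: "w \<in> weights" "\<forall>p\<in>S. wt w (prod.swap u) \<le> wt w p" by auto
    then show ?l by (intro bexI[of _ "prod.swap w"]) (auto, metis wt_swap swap_swap)
  qed
  then have "u \<in> below (prod.swap ` S) \<longleftrightarrow> prod.swap u \<in> below S"
    by (auto simp: below_def)
  also have "\<dots> \<longleftrightarrow> u \<in> prod.swap ` below S"
    by (metis (no_types, lifting) imageE image_eqI swap_swap)
  finally show "u \<in> below (prod.swap ` S) \<longleftrightarrow> u \<in> prod.swap ` below S" .
qed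


section \<open>Blowing up a set of exponents\<close>

text \<open>The effect of the substitution \<open>y \<mapsto> x y\<close>, followed by division by \<open>x\<^sup>m\<close>, on exponents.\<close>

definition blow_pt :: "nat \<Rightarrow> nat \<times> nat \<Rightarrow> nat \<times> nat" where
  "blow_pt m p = (fst p + snd p - m, snd p)"

abbreviation mult :: "(nat \<times> nat) set \<Rightarrow> nat" where
  "mult S \<equiv> worder (1, 1) S"

definition blow :: "(nat \<times> nat) set \<Rightarrow> (nat \<times> nat) set" where
  "blow S = blow_pt (mult S) ` S"

lemma blow_eq_empty [simp]: "blow S = {} \<longleftrightarrow> S = {}"
  by (simp add: blow_def)

lemma mult_le: "p \<in> S \<Longrightarrow> mult S \<le> fst p + snd p"
  using worder_le[of p S "(1, 1)"] by (simp add: wt_def)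

lemma mult_swap [simp]:
  "mult (prod.swap ` S) = mult S"
  "worder (Suc 0, Suc 0) (prod.swap ` S) = worder (Suc 0, Suc 0) S"
  using worder_swap[of "(1, 1)" S] by simp_all

lemma mface_one_one_swap: "mface (1, 1) (prod.swap ` S) = prod.swap ` mface (1, 1) S"
  using mface_swap[of "(1, 1)" S] by simp

text \<open>The maps on exponents and on weights are dual: with i + j = m + k the weight is a (i +
  j) + b j = a k + b j + a m. The assumption keeps the truncated subtraction in
  \<open>blow_pt\<close> exact.\<close>

lemma wt_blow_pt:
  assumes "m \<le> fst p + snd p"
  shows "wt (a, a + b) p = wt (a, b) (blow_pt m p) + a * m"
proof -
  obtain k where k: "fst p + snd p = m + k" using assms le_Suc_ex by blast
  have "wt (a, a + b) p = a * (fst p + snd p) + b * snd p"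
    by (simp add: wt_def algebra_simps)
  also have "\<dots> = (a * k + b * snd p) + a * m"
    unfolding k by (simp add: algebra_simps)
  also have "blow_pt m p = (k, snd p)" using k by (simp add: blow_pt_def)
  then have "a * k + b * snd p = wt (a, b) (blow_pt m p)" by simp
  finally show ?thesis .
qed

lemma worder_blow:
  assumes "S \<noteq> {}"
  shows "worder (a, a + b) S = worder (a, b) (blow S) + a * mult S"
proof -
  obtain q where q: "q \<in> blow S" "wt (a, b) q = worder (a, b) (blow S)"
    using worder_attained[of "blow S" "(a, b)"] assms by auto
  then obtain p where p: "p \<in> S" "q = blow_pt (mult S) p" by (auto simp: blow_def)
  show ?thesis
  proof (rule worder_eqI[OF p(1)])
    show "wt (a, a + b) p = worder (a, b) (blow S) + a * mult S"
      using wt_blow_pt[OF mult_le[OF p(1)]] p q by simp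
    fix r assume r: "r \<in> S"
    then have "worder (a, b) (blow S) \<le> wt (a, b) (blow_pt (mult S) r)"
      by (intro worder_le) (auto simp: blow_def)
    then show "worder (a, b) (blow S) + a * mult S \<le> wt (a, a + b) r"
      using wt_blow_pt[OF mult_le[OF r]] by simp
  qed
qed

lemma mface_blow:
  assumes "S \<noteq> {}"
  shows "mface (a, b) (blow S) = blow_pt (mult S) ` mface (a, a + b) S"
proof -
  have "wt (a, b) (blow_pt (mult S) p) = worder (a, b) (blow S) \<longleftrightarrow>
        wt (a, a + b) p = worder (a, a + b) S" if "p \<in> S" for p
    using wt_blow_pt[OF mult_le[OF that]] worder_blow[OF assms] by simp
  then show ?thesis by (auto simp: mface_def blow_def)
qed

lemma len_blow: "S \<noteq> {} \<Longrightarrow> len (a, b) (blow S) = len (a, a + b) S"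
  unfolding len_def by (simp add: mface_blow image_image blow_pt_def)

lemma weights_add_iff: "b > 0 \<Longrightarrow> (a, a + b) \<in> weights \<longleftrightarrow> (a, b) \<in> weights"
  by (simp add: weights_def coprime_iff_gcd_eq_1)

lemma weights_less_obtain:
  assumes "w \<in> weights" "fst w < snd w"
  obtains a b where "w = (a, a + b)" "(a, b) \<in> weights"
proof -
  obtain a c where w: "w = (a, c)" by (cases w)
  then obtain b where b: "c = a + b" "b > 0" using assms(2) less_imp_add_positive[of a c] by auto
  then have "(a, b) \<in> weights" using assms(1) weights_add_iff[OF b(2), of a] w by simp
  with w b show thesis using that by simp
qed

lemma weights_cases:
  assumes "w \<in> weights"
  obtains "w = (1, 1)"
  | a b where "w = (a, a + b)" "(a, b) \<in> weights"
  | a b where "w = (a + b, b)" "(a, b) \<in> weights"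
proof (cases "fst w" "snd w" rule: linorder_cases)
  case equal
  then have "w = (1, 1)" using assms by (auto simp: weights_def prod_eq_iff)
  then show thesis by (rule that(1))
next
  case less
  then show thesis using that(2) by (rule weights_less_obtain[OF assms])
next
  case greater
  then have "prod.swap w \<in> weights" "fst (prod.swap w) < snd (prod.swap w)" using assms by auto
  then obtain a b where "prod.swap w = (a, a + b)" and ab: "(a, b) \<in> weights"
    by (rule weights_less_obtain)
  then have "w = (b + a, a)" by (cases w) auto
  moreover have "(b, a) \<in> weights" using ab by (auto simp: weights_def coprime_commute)
  ultimately show thesis by (rule that(3))
qed

subsection \<open>Counting the lattice points below the diagram\<close>

text \<open>Weights with \<open>fst w < snd w\<close> are those of the form (a, a + b), the ones
  visible in the chart at \<open>Slope 0\<close>. The triangle i + j \<le> m is cut off because it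
  is counted separately as m (m - 1) / 2.\<close>

definition low :: "(nat \<times> nat) set \<Rightarrow> (nat \<times> nat) set" where
  "low S = {u. fst u > 0 \<and> snd u > 0 \<and> fst u + snd u > mult S \<and>
     (\<exists>w\<in>weights. fst w < snd w \<and> (\<forall>p\<in>S. wt w u \<le> wt w p))}"

lemma lowI:
  assumes "fst u > 0" "snd u > 0" "fst u + snd u > mult S" "w \<in> weights" "fst w < snd w"
    "\<forall>p\<in>S. wt w u \<le> wt w p"
  shows "u \<in> low S"
  using assms unfolding low_def by blast

text \<open>With w = (a, a + b), the point u exceeds p in the share a (i + j) but not in total, so
  its share b j must be smaller. This keeps the halves belonging to the two charts apart.\<close>

lemma low_snd_less:
  assumes "u \<in> low S" "p \<in> mface (1, 1) S" shows "snd u < snd p"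
proof -
  obtain w where w: "w \<in> weights" "fst w < snd w" "wt w u \<le> wt w p"
    using assms by (auto simp: low_def mface_def)
  obtain a b where ab: "w = (a, a + b)" "(a, b) \<in> weights" using weights_less_obtain[OF w(1,2)] by blast
  then have ab0: "a > 0" "b > 0" by (auto simp: weights_def)
  have "fst p + snd p = mult S" using assms(2) by (simp add: mface_def wt_def)
  then have "a * (fst p + snd p) < a * (fst u + snd u)" using assms(1) ab0 by (simp add: low_def)
  moreover have "a * (fst u + snd u) + b * snd u \<le> a * (fst p + snd p) + b * snd p"
    using w(3) ab by (simp add: wt_def algebra_simps)
  ultimately have "b * snd u < b * snd p" by linarith
  then show ?thesis by simp
qed

text \<open>A point p of the tangent cone is sent to (0, \<open>snd p\<close>), while u spends some
  weight on its positive first coordinate. The bound ensures that u has a preimage with positive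
  first coordinate.\<close>

lemma below_blow_snd_less:
  assumes "u \<in> below (blow S)" "p \<in> mface (1, 1) S" shows "snd u < snd p"
proof -
  obtain w where w: "w \<in> weights" "wt w u \<le> wt w (blow_pt (mult S) p)"
    using assms by (auto simp: below_def mface_def blow_def)
  have "fst p + snd p = mult S" using assms(2) by (simp add: mface_def wt_def)
  then have "blow_pt (mult S) p = (0, snd p)" by (simp add: blow_pt_def)
  then have "fst w * fst u + snd w * snd u \<le> snd w * snd p" using w(2) by (simp add: wt_def)
  moreover have "fst w * fst u > 0" using w(1) assms(1) by (auto simp: weights_def below_def)
  ultimately have "snd w * snd u < snd w * snd p" by linarith
  then show ?thesis by simp
qed

lemma blow_pt_low:
  assumes "S \<noteq> {}"
  shows "blow_pt (mult S) ` low S = below (blow S)"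
proof (intro equalityI subsetI)
  fix v assume "v \<in> blow_pt (mult S) ` low S"
  then obtain u where u: "u \<in> low S" and v: "v = blow_pt (mult S) u" by auto
  obtain w where w: "w \<in> weights" "fst w < snd w" "\<forall>p\<in>S. wt w u \<le> wt w p"
    using u by (auto simp: low_def)
  obtain a b where ab: "w = (a, a + b)" "(a, b) \<in> weights" using weights_less_obtain[OF w(1,2)] by blast
  have mu: "mult S < fst u + snd u" using u by (simp add: low_def)
  have "wt (a, b) v \<le> wt (a, b) q" if "q \<in> blow S" for q
  proof -
    from that obtain p where p: "p \<in> S" "q = blow_pt (mult S) p" by (auto simp: blow_def)
    then show ?thesis
      using w(3) wt_blow_pt[OF less_imp_le[OF mu], of a b] wt_blow_pt[OF mult_le[OF p(1)], of a b]
      unfolding ab v by fastforce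
  qed
  moreover have "fst v > 0" "snd v > 0" using u mu by (auto simp: v blow_pt_def low_def)
  ultimately show "v \<in> below (blow S)" using ab(2) unfolding below_def by blast
next
  fix v assume v: "v \<in> below (blow S)"
  obtain p where p: "p \<in> mface (1, 1) S" using mface_nonempty[OF assms] by blast
  have "snd p \<le> mult S" using p by (simp add: mface_def wt_def)
  then have le: "snd v < mult S" using below_blow_snd_less[OF v p] by simp
  \<comment> \<open>The preimage under \<open>blow_pt\<close>; the bound \<open>le\<close> makes its
    first coordinate positive and the subtraction exact.\<close>
  define u where "u = (fst v + mult S - snd v, snd v)"
  have vu: "v = blow_pt (mult S) u" using le by (simp add: u_def blow_pt_def prod_eq_iff)
  have v0: "fst v > 0" "snd v > 0" using v by (auto simp: below_def)
  have mu: "mult S < fst u + snd u" using le v0 by (simp add: u_def)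
  obtain w where w: "w \<in> weights" "\<forall>p\<in>blow S. wt w v \<le> wt w p" using v by (auto simp: below_def)
  obtain a b where ab: "w = (a, b)" by (cases w)
  have ab0: "a > 0" "b > 0" using w ab by (auto simp: weights_def)
  have "wt (a, a + b) u \<le> wt (a, a + b) p" if "p \<in> S" for p
    using w(2) that ab
    unfolding wt_blow_pt[OF less_imp_le[OF mu], of a b] wt_blow_pt[OF mult_le[OF that], of a b]
    unfolding vu[symmetric] by (auto simp: blow_def)
  then have "u \<in> low S"
    using v0 mu le ab ab0 w by (auto simp: low_def u_def intro!: bexI[of _ "(a, a + b)"] simp: weights_add_iff)
  then show "v \<in> blow_pt (mult S) ` low S" using vu by auto
qed

lemma inj_blow_pt: "inj_on (blow_pt m) {p. m \<le> fst p + snd p}"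
  by (rule inj_onI) (auto simp: blow_pt_def)

lemma card_low: "S \<noteq> {} \<Longrightarrow> card (low S) = card (below (blow S))"
  using card_image[OF inj_on_subset[OF inj_blow_pt, of "low S" "mult S"]] blow_pt_low
  by (force simp: low_def)

text \<open>Points are sorted by the shape of a witnessing weight. The witness (1, 1) forces a point
  into the triangle, since \<open>mult S\<close> is attained on a nonempty set.\<close>

lemma below_decompose:
  "below S = {u. fst u > 0 \<and> snd u > 0 \<and> fst u + snd u \<le> mult S} \<union> low S
     \<union> prod.swap ` low (prod.swap ` S)" (is "_ = ?A \<union> _ \<union> ?C")
proof (intro equalityI subsetI)
  fix u assume u: "u \<in> below S"
  show "u \<in> ?A \<union> low S \<union> ?C"
  proof (cases "fst u + snd u \<le> mult S")
    case False
    obtain w where w: "w \<in> weights" "\<forall>p\<in>S. wt w u \<le> wt w p" using u by (auto simp: below_def)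
    consider "fst w < snd w" | "snd w < fst w" | "w = (1, 1)"
      using w(1) by (cases "fst w" "snd w" rule: linorder_cases) (auto simp: weights_def prod_eq_iff)
    then show ?thesis
    proof cases
      case 1
      then have "u \<in> low S" using u w False by (auto simp: below_def low_def)
      then show ?thesis by simp
    next
      case 2
      have "prod.swap u \<in> low (prod.swap ` S)"
      proof (rule lowI)
        show "prod.swap w \<in> weights" "fst (prod.swap w) < snd (prod.swap w)" using w(1) 2 by auto
        show "\<forall>p\<in>prod.swap ` S. wt (prod.swap w) (prod.swap u) \<le> wt (prod.swap w) p"
          using w(2) unfolding ball_simps wt_swap .
      qed (use u False in \<open>auto simp: below_def\<close>)
      then show ?thesis by (intro UnI2 image_eqI[of _ _ "prod.swap u"]) simp_all
    next
      case 3
      show ?thesis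
      proof (cases "S = {}")
        case True
        \<comment> \<open>Without exponents every weight is a witness, so (1, 2) can replace (1,
          1).\<close>
        then have "u \<in> low S" using u False
          by (auto simp: low_def below_def intro!: bexI[of _ "(1, 2)"]) (auto simp: weights_def)
        then show ?thesis by simp
      next
        case nonempty: False
        obtain p where "p \<in> S" "wt (1, 1) p = mult S" using worder_attained nonempty by metis
        then have "fst u + snd u \<le> mult S" using w(2) 3 by (auto simp: wt_def)
        then show ?thesis using False by simp
      qed
    qed
  qed (use u in \<open>auto simp: below_def\<close>)
next
  fix u assume "u \<in> ?A \<union> low S \<union> ?C"
  then consider "u \<in> ?A" | "u \<in> low S" | "u \<in> ?C" by blast
  then show "u \<in> below S"
  proof cases
    case 1
    then have "\<forall>p\<in>S. wt (1, 1) u \<le> wt (1, 1) p" using mult_le[of _ S] by (fastforce simp: wt_def)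
    then show ?thesis using 1 by (auto simp: below_def intro!: bexI[of _ "(1, 1)"])
  next
    case 2 then show ?thesis by (auto simp: below_def low_def)
  next
    case 3
    then obtain v where v: "v \<in> low (prod.swap ` S)" "u = prod.swap v" by auto
    then have "v \<in> below (prod.swap ` S)" by (auto simp: below_def low_def)
    then have "prod.swap v \<in> prod.swap ` prod.swap ` below S" unfolding below_swap by (rule imageI)
    then show ?thesis by (simp add: v image_image)
  qed
qed

lemma card_positive_triangle:
  "2 * card {u::nat \<times> nat. fst u > 0 \<and> snd u > 0 \<and> fst u + snd u \<le> m} = m * (m - 1)"
  and finite_positive_triangle:
  "finite {u::nat \<times> nat. fst u > 0 \<and> snd u > 0 \<and> fst u + snd u \<le> m}"
proof (induction m)
  case (Suc m)
  let ?A = "\<lambda>m. {u::nat \<times> nat. fst u > 0 \<and> snd u > 0 \<and> fst u + snd u \<le> m}"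
  let ?f = "\<lambda>i. (i, Suc m - i)"
  have eq: "?A (Suc m) = ?A m \<union> ?f ` {1..m}"
    by (force simp: le_Suc_eq)
  {
    case 2 show ?case unfolding eq using Suc by simp
  }
  {
    case 1
    have "card (?A (Suc m)) = card (?A m) + card (?f ` {1..m})"
      unfolding eq using Suc by (intro card_Un_disjoint) auto
    also have "card (?f ` {1..m}) = m" by (subst card_image) (auto intro: inj_onI)
    finally show ?case using Suc(1) by (cases m) (auto simp: algebra_simps)
  }
next
  case 0
  have *: "{u::nat \<times> nat. fst u > 0 \<and> snd u > 0 \<and> fst u + snd u \<le> 0} = {}" by auto
  { case 1 show ?case unfolding * by simp }
  { case 2 show ?case unfolding * by simp }
qed

text \<open>\<open>thin (supp f)\<close> says that neither \<open>x\<^sup>2\<close> nor \<open>y\<^sup>2\<close> divides \<open>f\<close>.\<close>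

definition thin :: "(nat \<times> nat) set \<Rightarrow> bool" where
  "thin S \<longleftrightarrow> (\<exists>p\<in>S. fst p \<le> 1) \<and> (\<exists>p\<in>S. snd p \<le> 1)"

lemma thin_swap [simp]: "thin (prod.swap ` S) = thin S"
  by (auto simp: thin_def)

lemma thin_nonempty: "thin S \<Longrightarrow> S \<noteq> {}"
  by (auto simp: thin_def)

text \<open>A point of the tangent cone lands on the axis \<open>fst = 0\<close>, whatever S was;
  the second coordinate is not changed by \<open>blow_pt\<close>, so a point with
  \<open>snd q \<le> 1\<close> keeps this property.\<close>

lemma thin_blow:
  assumes "thin S" shows "thin (blow S)"
proof -
  obtain p where p: "p \<in> mface (1, 1) S" using mface_nonempty[OF thin_nonempty[OF assms]] by blast
  then have "blow_pt (mult S) p \<in> blow S" "fst (blow_pt (mult S) p) = 0"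
    by (simp add: blow_def mface_def) (use p in \<open>simp add: mface_def blow_pt_def wt_def\<close>)
  moreover obtain q where "q \<in> S" "snd q \<le> 1" using assms by (auto simp: thin_def)
  then have "blow_pt (mult S) q \<in> blow S" "snd (blow_pt (mult S) q) \<le> 1"
    by (auto simp: blow_def blow_pt_def)
  ultimately show ?thesis by (metis thin_def zero_le)
qed

text \<open>A counted point has both coordinates at least 1, which outweighs the coordinate at most
  1 of p or q; what remains of the weight inequality bounds the other coordinate.\<close>

lemma finite_below:
  assumes "thin S" shows "finite (below S)"
proof -
  obtain p q where pq: "p \<in> S" "fst p \<le> 1" "q \<in> S" "snd q \<le> 1" using assms by (auto simp: thin_def)
  have "below S \<subseteq> {..fst q} \<times> {..snd p}"
  proof
    fix u assume "u \<in> below S"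
    then obtain w where u: "fst u > 0" "snd u > 0" and w: "w \<in> weights" "\<forall>p\<in>S. wt w u \<le> wt w p"
      by (auto simp: below_def)
    have w0: "fst w > 0" "snd w > 0" using w by (auto simp: weights_def)
    have "fst w * fst p \<le> fst w * fst u" "snd w * snd q \<le> snd w * snd u"
      using pq u by (auto intro: le_trans)
    moreover have "wt w u \<le> wt w p" "wt w u \<le> wt w q" using w pq by auto
    ultimately have "snd w * snd u \<le> snd w * snd p" "fst w * fst u \<le> fst w * fst q"
      unfolding wt_def by linarith+
    then show "u \<in> {..fst q} \<times> {..snd p}" using w0 by (auto simp: mem_Times_iff)
  qed
  then show ?thesis by (rule finite_subset) auto
qed

lemma card_below:
  assumes "thin S"
  shows "2 * card (below S) = mult S * (mult S - 1) + 2 * card (below (blow S))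
           + 2 * card (below (blow (prod.swap ` S)))"
proof -
  let ?A = "{u::nat \<times> nat. fst u > 0 \<and> snd u > 0 \<and> fst u + snd u \<le> mult S}"
  let ?C = "prod.swap ` low (prod.swap ` S)"
  have ne: "S \<noteq> {}" using assms thin_nonempty by blast
  have fin: "finite (low S)" "finite ?C"
    using finite_below[OF assms] unfolding below_decompose[of S] by auto
  obtain p where p: "p \<in> mface (1, 1) S" using mface_nonempty[OF ne] by blast
  \<comment> \<open>A common point u would have both coordinates smaller than those of p, hence
    coordinate sum below \<open>mult S\<close>, contrary to the definition of
    \<open>low\<close>.\<close>
  have "low S \<inter> ?C = {}"
  proof (rule ccontr)
    assume "low S \<inter> ?C \<noteq> {}"
    then obtain u where u: "u \<in> low S" "u \<in> ?C" by blast
    have "snd u < snd p" using low_snd_less[OF u(1) p] .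
    moreover have "prod.swap u \<in> low (prod.swap ` S)" using u(2) by auto
    then have "snd (prod.swap u) < snd (prod.swap p)"
      using p by (intro low_snd_less) (auto simp: mface_one_one_swap simp del: One_nat_def)
    ultimately have "fst u + snd u < fst p + snd p" by simp
    then show False using p u(1) by (simp add: mface_def low_def wt_def)
  qed
  moreover have "?A \<inter> low S = {}" "?A \<inter> ?C = {}" by (auto simp: low_def mult_swap simp del: One_nat_def)
  ultimately have "card (below S) = card ?A + card (low S) + card ?C"
    unfolding below_decompose[of S] using fin finite_positive_triangle
    by (subst card_Un_disjoint, auto)+
  moreover have "card ?C = card (low (prod.swap ` S))" by (rule card_image) (auto intro: inj_onI)
  ultimately show ?thesis
    using card_low[of S] card_low[of "prod.swap ` S"] ne card_positive_triangle[of "mult S"] by simp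
qed


subsection \<open>Sets of exponents that meet both axes\<close>

definition meets_axes :: "(nat \<times> nat) set \<Rightarrow> bool" where
  "meets_axes S \<longleftrightarrow> (\<exists>s. (s, 0) \<in> S) \<and> (\<exists>t. (0, t) \<in> S)"

definition x_end :: "(nat \<times> nat) set \<Rightarrow> nat" where "x_end S = (LEAST s. (s, 0) \<in> S)"
definition y_end :: "(nat \<times> nat) set \<Rightarrow> nat" where "y_end S = (LEAST t. (0, t) \<in> S)"

lemma meets_axes_swap [simp]: "meets_axes (prod.swap ` S) = meets_axes S"
  by (force simp: meets_axes_def)

lemma y_end_eq: "y_end S = x_end (prod.swap ` S)"
proof -
  have "(0, t) \<in> S \<longleftrightarrow> (t, 0) \<in> prod.swap ` S" for t by force
  then show ?thesis by (simp add: x_end_def y_end_def)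
qed

lemma meets_axes_nonempty: "meets_axes S \<Longrightarrow> S \<noteq> {}"
  by (auto simp: meets_axes_def)

lemma meets_axes_thin: "meets_axes S \<Longrightarrow> thin S"
  by (force simp: meets_axes_def thin_def)

lemma x_end_mem: "meets_axes S \<Longrightarrow> (x_end S, 0) \<in> S"
  unfolding meets_axes_def x_end_def by (metis (mono_tags, lifting) LeastI)

lemma x_end_le: "(s, 0) \<in> S \<Longrightarrow> x_end S \<le> s"
  unfolding x_end_def by (rule Least_le)

lemma y_end_mem: "meets_axes S \<Longrightarrow> (0, y_end S) \<in> S"
  unfolding meets_axes_def y_end_def by (metis (mono_tags, lifting) LeastI)

lemma y_end_le: "(0, t) \<in> S \<Longrightarrow> y_end S \<le> t"
  unfolding y_end_def by (rule Least_le)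

lemma mult_le_x_end: "meets_axes S \<Longrightarrow> mult S \<le> x_end S"
  using mult_le[OF x_end_mem] by fastforce

lemma x_end_blow:
  assumes "meets_axes S" shows "x_end (blow S) = x_end S - mult S"
  unfolding x_end_def[of "blow S"]
proof (rule Least_equality)
  have "(x_end S - mult S, 0) = blow_pt (mult S) (x_end S, 0)" by (simp add: blow_pt_def)
  then show "(x_end S - mult S, 0) \<in> blow S"
    unfolding blow_def using x_end_mem[OF assms] by (rule image_eqI)
next
  fix s assume "(s, 0) \<in> blow S"
  then obtain p where p: "p \<in> S" "(s, 0) = blow_pt (mult S) p" by (auto simp: blow_def)
  then have "p = (fst p, 0)" by (simp add: blow_pt_def prod_eq_iff)
  then have "x_end S \<le> fst p" using p(1) x_end_le by metis
  then show "x_end S - mult S \<le> s" using p(2) by (simp add: blow_pt_def)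
qed

text \<open>The exponents that \<open>blow_pt\<close> moves onto the axis \<open>fst = 0\<close> are
  exactly those of the tangent cone.\<close>

lemma y_end_blow:
  assumes "S \<noteq> {}" shows "y_end (blow S) = Min (snd ` mface (1, 1) S)"
  unfolding y_end_def
proof (rule Least_equality)
  let ?M = "mface (1, 1) S"
  have fin: "finite (snd ` ?M)" "snd ` ?M \<noteq> {}" using assms finite_mface mface_nonempty by auto
  then have "Min (snd ` ?M) \<in> snd ` ?M" by (rule Min_in)
  then obtain p where p: "p \<in> ?M" "Min (snd ` ?M) = snd p" by auto
  then have "(0, snd p) = blow_pt (mult S) p" by (simp add: mface_def blow_pt_def wt_def)
  then show "(0, Min (snd ` ?M)) \<in> blow S"
    using p(1) mface_subset[of "(1, 1)" S] unfolding p(2) blow_def by blast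
  fix t assume "(0, t) \<in> blow S"
  then obtain q where q: "q \<in> S" "(0, t) = blow_pt (mult S) q" by (auto simp: blow_def)
  then have "q \<in> ?M" "snd q = t" using mult_le[OF q(1)] by (auto simp: mface_def blow_pt_def wt_def)
  then show "Min (snd ` ?M) \<le> t" using fin by auto
qed

lemma meets_axes_blow:
  assumes "meets_axes S" shows "meets_axes (blow S)"
proof -
  obtain p where "p \<in> mface (1, 1) S" using mface_nonempty[OF meets_axes_nonempty[OF assms]] by blast
  then have "p \<in> S" "blow_pt (mult S) p = (0, snd p)" by (auto simp: mface_def blow_pt_def wt_def)
  then have "(0, snd p) \<in> blow S" by (metis blow_def imageI)
  moreover have "blow_pt (mult S) (x_end S, 0) = (x_end S - mult S, 0)" by (simp add: blow_pt_def)
  then have "(x_end S - mult S, 0) \<in> blow S" using x_end_mem[OF assms] by (metis blow_def imageI)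
  ultimately show ?thesis by (auto simp: meets_axes_def)
qed

text \<open>The weights of the compact edges of the Newton polyhedron.\<close>

definition active :: "(nat \<times> nat) set \<Rightarrow> (nat \<times> nat) set" where
  "active S = {w \<in> weights. len w S > 0}"

text \<open>A case split by \<open>weights_cases\<close>. The third family is written (a + b, a)
  because it is read off from the swapped set, whose weights have their entries exchanged.\<close>

lemma active_decompose:
  assumes "S \<noteq> {}"
  shows "active S = (\<lambda>(a, b). (a, a + b)) ` active (blow S)
    \<union> (if len (1, 1) S > 0 then {(1, 1)} else {})
    \<union> (\<lambda>(a, b). (a + b, a)) ` active (blow (prod.swap ` S))" (is "_ = ?f ` _ \<union> ?B \<union> ?g ` _")
proof (intro equalityI subsetI)
  have len2: "len (b, a) S = len (a, b) (prod.swap ` S)" if "(a, b) \<in> weights" for a b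
    using len_swap[OF that, of "prod.swap ` S"] assms by (simp add: image_image)
  have pos: "b > 0" if "(a, b) \<in> weights" for a b :: nat using that by (simp add: weights_def)
  {
    fix w assume w: "w \<in> active S"
    then have ww: "w \<in> weights" "len w S > 0" by (auto simp: active_def)
    show "w \<in> ?f ` active (blow S) \<union> ?B \<union> ?g ` active (blow (prod.swap ` S))"
    proof (cases rule: weights_cases[OF ww(1)])
      case 1 then show ?thesis using ww by simp
    next
      case (2 a b)
      then have "(a, b) \<in> active (blow S)" using ww len_blow[OF assms] by (simp add: active_def)
      then have "w \<in> ?f ` active (blow S)" using 2 by (auto intro: image_eqI[of _ _ "(a, b)"])
      then show ?thesis by simp
    next
      case (3 a b)
      then have "(b, a) \<in> weights" by (simp add: weights_def coprime_commute)
      moreover have "(b, b + a) \<in> weights"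
        using weights_add_iff[OF pos, of b a] calculation pos by (metis weights_add_iff)
      then have "len (b, a) (blow (prod.swap ` S)) = len w S"
        using len2[of b "b + a"] len_blow[of "prod.swap ` S" b a] assms 3 by (simp add: add.commute)
      ultimately have "(b, a) \<in> active (blow (prod.swap ` S))" using ww by (simp add: active_def)
      then have "w \<in> ?g ` active (blow (prod.swap ` S))"
        using 3 by (auto intro!: image_eqI[of _ _ "(b, a)"])
      then show ?thesis by simp
    qed
  }
  fix w assume "w \<in> ?f ` active (blow S) \<union> ?B \<union> ?g ` active (blow (prod.swap ` S))"
  then consider a b where "w = (a, a + b)" "(a, b) \<in> active (blow S)"
    | "w \<in> ?B" | a b where "w = (a + b, a)" "(a, b) \<in> active (blow (prod.swap ` S))" by auto
  then show "w \<in> active S"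
  proof cases
    case (1 a b)
    then show ?thesis using weights_add_iff[OF pos, of a b] len_blow[OF assms]
      by (simp add: active_def)
  next
    case 2 then show ?thesis by (auto simp: active_def split: if_splits)
  next
    case (3 a b)
    then have ab: "(a, b) \<in> weights" by (simp add: active_def)
    then have "(a, a + b) \<in> weights" using weights_add_iff[OF pos[OF ab]] by simp
    then have "w \<in> weights" "len w S = len (a, b) (blow (prod.swap ` S))"
      using 3 len2[of a "a + b"] len_blow[of "prod.swap ` S" a b] assms swap_weights[of "(a, a + b)"]
      by auto
    then show ?thesis using 3 by (simp add: active_def)
  qed
qed

lemma sum_active:
  fixes f :: "nat \<times> nat \<Rightarrow> nat"
  assumes "S \<noteq> {}" "finite (active (blow S))" "finite (active (blow (prod.swap ` S)))"
    and "len (1, 1) S = 0 \<Longrightarrow> f (1, 1) = 0"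
  shows "finite (active S)"
    and "sum f (active S) = (\<Sum>w\<in>active (blow S). f (fst w, fst w + snd w)) + f (1, 1)
      + (\<Sum>w\<in>active (blow (prod.swap ` S)). f (fst w + snd w, fst w))"
proof -
  let ?B = "if len (1, 1) S > 0 then {(1, 1)} else {}"
  let ?f = "\<lambda>(a, b). (a, a + b)" and ?g = "\<lambda>(a, b). (a + b, a)"
  let ?A = "?f ` active (blow S)" and ?C = "?g ` active (blow (prod.swap ` S))"
  show "finite (active S)" unfolding active_decompose[OF assms(1)] using assms(2,3) by auto
  have "?A \<inter> ?B = {}" "(?A \<union> ?B) \<inter> ?C = {}"
    by (auto simp: active_def weights_def)
  then have "sum f (active S) = sum f ?A + sum f ?B + sum f ?C"
    unfolding active_decompose[OF assms(1)] using assms(2,3)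
    by (subst sum.union_disjoint, auto)+
  also have "sum f ?A = (\<Sum>w\<in>active (blow S). f (fst w, fst w + snd w))"
    by (subst sum.reindex) (auto intro!: inj_onI sum.cong)
  also have "sum f ?C = (\<Sum>w\<in>active (blow (prod.swap ` S)). f (fst w + snd w, fst w))"
    by (subst sum.reindex) (auto intro!: inj_onI sum.cong)
  also have "sum f ?B = f (1, 1)" using assms(4) by auto
  finally show "sum f (active S) = (\<Sum>w\<in>active (blow S). f (fst w, fst w + snd w)) + f (1, 1)
      + (\<Sum>w\<in>active (blow (prod.swap ` S)). f (fst w + snd w, fst w))" .
qed

lemma origin_mem:
  assumes "(0, 0) \<in> S"
  shows "worder w S = 0" "w \<in> weights \<Longrightarrow> mface w S = {(0, 0)}" "active S = {}" "below S = {}"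
proof -
  show wo: "worder w S = 0" for w using assms by (rule worder_eqI) (auto simp: wt_def)
  show mf: "mface w S = {(0, 0)}" if "w \<in> weights" for w
    using that assms by (auto simp: mface_def wo wt_def weights_def)
  show "active S = {}" by (auto simp: active_def len_def mf)
  show "below S = {}"
  proof (rule ccontr)
    assume "below S \<noteq> {}"
    then obtain u w where "fst u > 0" "w \<in> weights" "wt w u \<le> wt w (0, 0)"
      using assms unfolding below_def by blast
    then show False by (simp add: wt_def weights_def)
  qed
qed

text \<open>The first two sums say that the edges lead from one axis to the other; the third is
  Pick's count. They are proved together because blowing up raises \<open>worder\<close> by
  \<open>fst w\<close> times the multiplicity m, so the third sum calls for the sum of
  \<open>len * fst\<close>. The measure drops since the ends of the first transform are
  \<open>x_end S - m\<close> and j \<le> m \<le> \<open>y_end S\<close>, with m > 0; likewise for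
  the second.\<close>

lemma active_sums:
  assumes "meets_axes S"
  shows "finite (active S) \<and> (\<Sum>w\<in>active S. len w S * snd w) = x_end S
    \<and> (\<Sum>w\<in>active S. len w S * fst w) = y_end S
    \<and> (\<Sum>w\<in>active S. len w S * (worder w S + 1)) = 2 * card (below S) + x_end S + y_end S"
  using assms
proof (induction "x_end S + y_end S" arbitrary: S rule: less_induct)
  case (less S)
  have ne: "S \<noteq> {}" using less.prems meets_axes_nonempty by blast
  show ?case
  proof (cases "(0, 0) \<in> S")
    case True
    then have "x_end S = 0" "y_end S = 0" using x_end_le y_end_le by fastforce+
    then show ?thesis using origin_mem[OF True] by simp
  next
    case False
    define S0 where "S0 = blow S"
    define S1 where "S1 = blow (prod.swap ` S)"
    define m where "m = mult S"
    have ax: "meets_axes S0" "meets_axes S1"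
      using less.prems meets_axes_blow by (auto simp: S0_def S1_def)
    obtain p where p: "p \<in> S" "wt (1, 1) p = m" unfolding m_def using worder_attained[OF ne] by metis
    have m0: "m > 0" using p False by (cases p) (auto simp: wt_def intro!: gr0I)
    have mx: "m \<le> x_end S" "m \<le> y_end S"
      using mult_le_x_end[OF less.prems] mult_le_x_end[of "prod.swap ` S"] less.prems
      by (simp_all add: m_def y_end_eq)
    obtain i j where ij: "(i, j + len (1, 1) S * fst (1::nat, 1::nat)) \<in> mface (1, 1) S"
      "Min (snd ` mface (1, 1) S) = j" "Min (fst ` mface (1, 1) S) = i"
      using mface_ends[OF one_one_weights(1) ne] by metis
    have x0: "x_end S0 = x_end S - m" "y_end S0 = j"
      using x_end_blow[OF less.prems] y_end_blow[OF ne] ij by (simp_all add: S0_def m_def)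
    have x1: "x_end S1 = y_end S - m" "y_end S1 = i"
      using x_end_blow[of "prod.swap ` S"] y_end_blow[of "prod.swap ` S"] less.prems ne ij(3)
      by (simp_all add: S1_def m_def y_end_eq mface_one_one_swap image_image del: One_nat_def)
    have ijm: "i + j + len (1, 1) S = m"
      using ij(1) by (simp add: mface_def m_def wt_def)
    have IH0: "finite (active S0)" "(\<Sum>w\<in>active S0. len w S0 * snd w) = x_end S0"
      "(\<Sum>w\<in>active S0. len w S0 * fst w) = y_end S0"
      "(\<Sum>w\<in>active S0. len w S0 * (worder w S0 + 1)) = 2 * card (below S0) + x_end S0 + y_end S0"
      using less.hyps[OF _ ax(1)] x0 mx m0 ijm by simp_all
    have IH1: "finite (active S1)" "(\<Sum>w\<in>active S1. len w S1 * snd w) = x_end S1"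
      "(\<Sum>w\<in>active S1. len w S1 * fst w) = y_end S1"
      "(\<Sum>w\<in>active S1. len w S1 * (worder w S1 + 1)) = 2 * card (below S1) + x_end S1 + y_end S1"
      using less.hyps[OF _ ax(2)] x1 mx m0 ijm by simp_all
    have l0: "len (fst w, fst w + snd w) S = len w S0" for w
      using len_blow[OF ne, of "fst w" "snd w"] by (simp add: S0_def)
    have o0: "worder (fst w, fst w + snd w) S = worder w S0 + fst w * m" for w
      using worder_blow[OF ne, of "fst w" "snd w"] by (simp add: S0_def m_def)
    have l1: "len (fst w + snd w, fst w) S = len w S1" if "w \<in> active S1" for w
    proof -
      have w: "w \<in> weights" "snd w > 0" using that by (auto simp: active_def weights_def)
      then have "(fst w, fst w + snd w) \<in> weights" using weights_add_iff[of "snd w" "fst w"] by simp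
      then have "(fst w + snd w, fst w) \<in> weights"
        using swap_weights[of "(fst w, fst w + snd w)"] by simp
      then show ?thesis
        using len_swap[OF _ ne, of "(fst w + snd w, fst w)"] len_blow[of "prod.swap ` S" "fst w" "snd w"] ne
        by (simp add: S1_def)
    qed
    have o1: "worder (fst w + snd w, fst w) S = worder w S1 + fst w * m" for w
      using worder_blow[of "prod.swap ` S" "fst w" "snd w"] ne
        worder_swap[of "(fst w + snd w, fst w)" S] by (simp add: S1_def m_def)
    note sa = sum_active[OF ne, folded S0_def S1_def, OF IH0(1) IH1(1)]
    have fin: "finite (active S)" by (rule sa(1)[of "\<lambda>_. 0"]) simp
    have "(\<Sum>w\<in>active S. len w S * snd w) = x_end S0 + y_end S0 + len (1, 1) S + y_end S1"
    proof -
      have "(\<Sum>w\<in>active S0. len (fst w, fst w + snd w) S * snd (fst w, fst w + snd w)) = y_end S0 + x_end S0"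
        unfolding l0 IH0(2,3)[symmetric] sum.distrib[symmetric] by (simp add: algebra_simps)
      moreover have "(\<Sum>w\<in>active S1. len (fst w + snd w, fst w) S * snd (fst w + snd w, fst w)) = y_end S1"
        unfolding IH1(3)[symmetric] by (rule sum.cong) (auto simp: l1)
      ultimately show ?thesis using sa(2)[of "\<lambda>w. len w S * snd w"] by simp
    qed
    then have c2: "(\<Sum>w\<in>active S. len w S * snd w) = x_end S" using x0 x1 ijm mx by simp
    have "(\<Sum>w\<in>active S. len w S * fst w) = y_end S0 + len (1, 1) S + (y_end S1 + x_end S1)"
    proof -
      have "(\<Sum>w\<in>active S0. len (fst w, fst w + snd w) S * fst (fst w, fst w + snd w)) = y_end S0"
        unfolding l0 IH0(3)[symmetric] by simp
      moreover have "(\<Sum>w\<in>active S1. len (fst w + snd w, fst w) S * fst (fst w + snd w, fst w))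
          = y_end S1 + x_end S1"
        unfolding IH1(2,3)[symmetric] sum.distrib[symmetric] by (rule sum.cong) (auto simp: l1 algebra_simps)
      ultimately show ?thesis using sa(2)[of "\<lambda>w. len w S * fst w"] by simp
    qed
    then have c3: "(\<Sum>w\<in>active S. len w S * fst w) = y_end S" using x0 x1 ijm mx by simp
    have "(\<Sum>w\<in>active S. len w S * (worder w S + 1))
      = (2 * card (below S0) + x_end S0 + y_end S0 + m * y_end S0) + len (1, 1) S * (m + 1)
        + (2 * card (below S1) + x_end S1 + y_end S1 + m * y_end S1)"
    proof -
      have "(\<Sum>w\<in>active S0. len (fst w, fst w + snd w) S * (worder (fst w, fst w + snd w) S + 1))
          = (2 * card (below S0) + x_end S0 + y_end S0) + m * y_end S0"
        unfolding l0 o0 IH0(4)[symmetric] unfolding IH0(3)[symmetric] sum_distrib_left sum.distrib[symmetric]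
        by (rule sum.cong) (auto simp: algebra_simps)
      moreover have "(\<Sum>w\<in>active S1. len (fst w + snd w, fst w) S * (worder (fst w + snd w, fst w) S + 1))
          = (2 * card (below S1) + x_end S1 + y_end S1) + m * y_end S1"
        unfolding o1 IH1(4)[symmetric] unfolding IH1(3)[symmetric] sum_distrib_left sum.distrib[symmetric]
        by (rule sum.cong) (auto simp: l1 algebra_simps)
      ultimately show ?thesis using sa(2)[of "\<lambda>w. len w S * (worder w S + 1)"] by (simp add: m_def)
    qed
    \<comment> \<open>By \<open>ijm\<close>, the terms with a factor m add up to m (i + j + len) = m
      * m, and the remaining i + j + len to m.\<close>
    also have "\<dots> = 2 * card (below S0) + 2 * card (below S1) + (x_end S - m) + (y_end S - m)
        + (m * m + m)"
      unfolding x0 x1 ijm[symmetric] by (simp add: algebra_simps)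
    also have "m * m + m = m * (m - 1) + 2 * m" using m0 by (cases m) (auto simp: algebra_simps)
    also have "2 * card (below S0) + 2 * card (below S1) + (x_end S - m) + (y_end S - m)
        + (m * (m - 1) + 2 * m) = 2 * card (below S) + x_end S + y_end S"
      using card_below[OF meets_axes_thin[OF less.prems]] mx by (simp add: S0_def S1_def m_def)
    finally show ?thesis using fin c2 c3 by simp
  qed
qed

section \<open>The Newton polyhedron\<close>

definition real_pt :: "nat \<times> nat \<Rightarrow> real \<times> real" where
  "real_pt p = (real (fst p), real (snd p))"

lemma real_pt_inner: "real_pt w \<bullet> x = real (fst w) * fst x + real (snd w) * snd x"
  by (cases x) (simp add: real_pt_def)

lemma real_pt_inner_real_pt [simp]: "real_pt w \<bullet> real_pt p = real (wt w p)"
  by (simp add: real_pt_inner) (simp add: real_pt_def wt_def)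

lemma real_pt_eq_iff [simp]: "real_pt p = real_pt q \<longleftrightarrow> p = q"
  by (auto simp: real_pt_def prod_eq_iff)

definition polyhedron_of :: "(nat \<times> nat) set \<Rightarrow> (real \<times> real) set" where
  "polyhedron_of S =
     convex hull (\<Union>(i, j)\<in>S. {(real i + u, real j + v) | u v. u \<ge> 0 \<and> v \<ge> 0})"

lemma newton_polyhedron_eq: "newton_polyhedron f = polyhedron_of (supp f)"
  by (simp add: newton_polyhedron_def polyhedron_of_def)

lemma convex_polyhedron_of: "convex (polyhedron_of S)"
  by (simp add: polyhedron_of_def)

lemma real_pt_in_polyhedron: "p \<in> S \<Longrightarrow> real_pt p \<in> polyhedron_of S"
  unfolding polyhedron_of_def real_pt_def
  by (intro hull_inc) (cases p, force)

lemma polyhedron_of_add: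
  assumes "x \<in> polyhedron_of S" "u \<ge> 0" "v \<ge> 0"
  shows "x + (u, v) \<in> polyhedron_of S"
proof -
  let ?G = "\<Union>(i, j)\<in>S. {(real i + u, real j + v) | u v. u \<ge> 0 \<and> v \<ge> 0}"
  have sub: "(\<lambda>x. (u, v) + x) ` ?G \<subseteq> ?G"
  proof
    fix y assume "y \<in> (\<lambda>x. (u, v) + x) ` ?G"
    then obtain i j u' v' where "(i, j) \<in> S" "u' \<ge> 0" "v' \<ge> 0"
      "y = (u, v) + (real i + u', real j + v')" by auto
    then show "y \<in> ?G" using assms(2,3)
      by (intro UN_I[of "(i, j)"]) (auto intro!: exI[of _ "u + u'"] exI[of _ "v + v'"])
  qed
  have "(u, v) + x \<in> (\<lambda>x. (u, v) + x) ` (convex hull ?G)"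
    using assms(1) by (auto simp: polyhedron_of_def)
  also have "\<dots> = convex hull ((\<lambda>x. (u, v) + x) ` ?G)" by (rule convex_hull_translation[symmetric])
  also have "\<dots> \<subseteq> polyhedron_of S" unfolding polyhedron_of_def by (rule hull_mono[OF sub])
  finally show ?thesis by (simp add: add.commute)
qed

lemma polyhedron_of_subset:
  assumes "convex T" "\<And>p u v. p \<in> S \<Longrightarrow> u \<ge> 0 \<Longrightarrow> v \<ge> 0 \<Longrightarrow> real_pt p + (u, v) \<in> T"
  shows "polyhedron_of S \<subseteq> T"
  unfolding polyhedron_of_def
proof (rule hull_minimal)
  show "(\<Union>(i, j)\<in>S. {(real i + u, real j + v) | u v. u \<ge> 0 \<and> v \<ge> 0}) \<subseteq> T"
    using assms(2) by (fastforce simp: real_pt_def)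
qed fact

lemma unbounded_polyhedron_of:
  assumes "S \<noteq> {}" shows "\<not> bounded (polyhedron_of S)"
proof
  assume "bounded (polyhedron_of S)"
  then obtain B where B: "\<And>x. x \<in> polyhedron_of S \<Longrightarrow> norm x \<le> B" by (auto simp: bounded_iff)
  obtain p where p: "p \<in> S" using assms by blast
  have "real_pt p + (\<bar>B\<bar> + 1, 0) \<in> polyhedron_of S"
    using polyhedron_of_add[OF real_pt_in_polyhedron[OF p]] by simp
  then have "norm (real_pt p + (\<bar>B\<bar> + 1, 0)) \<le> B" by (rule B)
  moreover have "norm (fst (real_pt p + (\<bar>B\<bar> + 1, 0))) \<le> norm (real_pt p + (\<bar>B\<bar> + 1, 0))"
    using norm_fst_le by (metis prod.collapse)
  ultimately show False by (simp add: real_pt_def)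
qed

text \<open>A combination with positive coefficients lies strictly inside as soon as one end point
  does. The case of interest is K = the hull of the minimal exponents on the boundary line.\<close>

lemma convex_halfspace_gt_Un:
  fixes a :: "'a::real_inner"
  assumes "convex K" "K \<subseteq> {x. a \<bullet> x = d}"
  shows "convex ({x. a \<bullet> x > d} \<union> K)"
proof (rule convexI)
  fix x y u v assume xy: "x \<in> {x. a \<bullet> x > d} \<union> K" "y \<in> {x. a \<bullet> x > d} \<union> K"
    and uv: "(0::real) \<le> u" "0 \<le> v" "u + v = 1"
  show "u *\<^sub>R x + v *\<^sub>R y \<in> {x. a \<bullet> x > d} \<union> K"
  proof (cases "x \<in> K \<and> y \<in> K")
    case True
    then show ?thesis using assms(1) uv by (simp add: convex_def)
  next
    case False
    show ?thesis
    proof (cases "u = 0 \<or> v = 0")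
      case True
      then show ?thesis using uv xy by auto
    next
      case nz: False
      have ge: "a \<bullet> x \<ge> d" "a \<bullet> y \<ge> d" using xy assms(2) by auto
      have "a \<bullet> x > d \<or> a \<bullet> y > d" using xy False by auto
      then have "u * (a \<bullet> x) + v * (a \<bullet> y) > u * d + v * d"
      proof
        assume "a \<bullet> x > d"
        then show ?thesis using ge nz uv by (intro add_less_le_mono mult_left_mono) auto
      next
        assume "a \<bullet> y > d"
        then show ?thesis using ge nz uv by (intro add_le_less_mono mult_left_mono) auto
      qed
      then have "a \<bullet> (u *\<^sub>R x + v *\<^sub>R y) > d"
        using uv(3) by (simp add: inner_add_right distrib_right[symmetric])
      then show ?thesis by simp
    qed
  qed
qed

text \<open>Both entries of a are positive, so every nonzero shift by (u, v) leaves the line on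
  which the inner product with a equals d; on that line only the hull of exponents remains. The open
  half-plane makes this sharp enough to identify the face itself.\<close>

lemma polyhedron_of_halfspace:
  fixes a :: "real \<times> real"
  assumes "fst a > 0" "snd a > 0" "\<And>p. p \<in> S \<Longrightarrow> a \<bullet> real_pt p \<ge> d"
  shows "polyhedron_of S \<subseteq> {x. a \<bullet> x > d} \<union> convex hull (real_pt ` {p \<in> S. a \<bullet> real_pt p = d})"
proof (rule polyhedron_of_subset)
  have "convex hull (real_pt ` {p \<in> S. a \<bullet> real_pt p = d}) \<subseteq> {x. a \<bullet> x = d}"
    by (rule hull_minimal) (auto simp: convex_hyperplane)
  then show "convex ({x. a \<bullet> x > d} \<union> convex hull (real_pt ` {p \<in> S. a \<bullet> real_pt p = d}))"
    by (intro convex_halfspace_gt_Un) auto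
  fix p u v assume p: "p \<in> S" and uv: "u \<ge> (0::real)" "v \<ge> (0::real)"
  have e: "a \<bullet> (real_pt p + (u, v)) = a \<bullet> real_pt p + (fst a * u + snd a * v)"
    by (cases a) (simp add: inner_add_right)
  show "real_pt p + (u, v) \<in> {x. a \<bullet> x > d} \<union> convex hull (real_pt ` {p \<in> S. a \<bullet> real_pt p = d})"
  proof (cases "u = 0 \<and> v = 0")
    case True
    show ?thesis
    proof (cases "a \<bullet> real_pt p = d")
      case eq: True
      then have "real_pt p \<in> convex hull (real_pt ` {p \<in> S. a \<bullet> real_pt p = d})"
        using p by (intro hull_inc) auto
      then show ?thesis using True by (simp add: zero_prod_def[symmetric])
    next
      case False
      then show ?thesis using True assms(3)[OF p] e by auto
    qed
  next
    case False
    then have "fst a * u + snd a * v > 0"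
      using assms(1,2) uv by (metis add_nonneg_pos add_pos_nonneg less_eq_real_def mult_nonneg_nonneg mult_pos_pos)
    then show ?thesis using e assms(3)[OF p] by auto
  qed
qed

section \<open>Compact faces and their weights\<close>

lemma real_pt_pos: "w \<in> weights \<Longrightarrow> fst (real_pt w) > 0" "w \<in> weights \<Longrightarrow> snd (real_pt w) > 0"
  by (auto simp: weights_def real_pt_def)

lemma polyhedron_of_weight:
  assumes "w \<in> weights"
  shows "polyhedron_of S \<subseteq> {x. real_pt w \<bullet> x > worder w S} \<union> convex hull (real_pt ` mface w S)"
  using polyhedron_of_halfspace[OF real_pt_pos[OF assms], of S "real (worder w S)"] worder_le
  by (simp add: mface_def)

definition face_at :: "nat \<times> nat \<Rightarrow> (nat \<times> nat) set \<Rightarrow> (real \<times> real) set" where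
  "face_at w S = polyhedron_of S \<inter> {x. real_pt w \<bullet> x = worder w S}"

lemma polyhedron_of_ge:
  assumes "w \<in> weights" "x \<in> polyhedron_of S"
  shows "real_pt w \<bullet> x \<ge> worder w S"
proof -
  have "convex hull (real_pt ` mface w S) \<subseteq> {x. real_pt w \<bullet> x = worder w S}"
    by (rule hull_minimal) (auto simp: convex_hyperplane mface_def)
  then show ?thesis using polyhedron_of_weight[OF assms(1)] assms(2) by fastforce
qed

lemma face_at_hull:
  assumes "w \<in> weights" shows "face_at w S = convex hull (real_pt ` mface w S)"
proof
  show "face_at w S \<subseteq> convex hull (real_pt ` mface w S)"
    using polyhedron_of_weight[OF assms] by (fastforce simp: face_at_def)
  show "convex hull (real_pt ` mface w S) \<subseteq> face_at w S"
    unfolding face_at_def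
    by (rule hull_minimal)
      (auto simp: convex_Int convex_polyhedron_of convex_hyperplane mface_def real_pt_in_polyhedron)
qed

lemma face_at_face_of: "w \<in> weights \<Longrightarrow> face_at w S face_of polyhedron_of S"
  unfolding face_at_def
  by (intro face_of_Int_supporting_hyperplane_ge convex_polyhedron_of polyhedron_of_ge)

lemma face_at_segment:
  assumes "w \<in> weights" "S \<noteq> {}"
  obtains i j where "(i + len w S * snd w, j) \<in> mface w S" "(i, j + len w S * fst w) \<in> mface w S"
    "face_at w S = closed_segment (real_pt (i + len w S * snd w, j)) (real_pt (i, j + len w S * fst w))"
proof -
  let ?L = "len w S"
  obtain i j where *: "(i + ?L * snd w, j) \<in> mface w S" "(i, j + ?L * fst w) \<in> mface w S"
    "\<And>p. p \<in> mface w S \<Longrightarrow> \<exists>k\<le>?L. p = (i + (?L - k) * snd w, j + k * fst w)"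
    using mface_ends[OF assms] by metis
  let ?A = "real_pt (i + ?L * snd w, j)" and ?B = "real_pt (i, j + ?L * fst w)"
  have "real_pt p \<in> closed_segment ?A ?B" if p: "p \<in> mface w S" for p
  proof -
    obtain k where k: "k \<le> ?L" "p = (i + (?L - k) * snd w, j + k * fst w)" using *(3)[OF p] by blast
    show ?thesis
    proof (cases "?L = 0")
      case True then show ?thesis using k by simp
    next
      case False
      have "real_pt p = (1 - real k / ?L) *\<^sub>R ?A + (real k / ?L) *\<^sub>R ?B"
        using False k by (simp add: real_pt_def of_nat_diff field_simps)
      then show ?thesis using k False unfolding closed_segment_def by (auto intro!: exI[of _ "real k / ?L"])
    qed
  qed
  then have "convex hull (real_pt ` mface w S) \<subseteq> closed_segment ?A ?B"
    by (intro hull_minimal) auto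
  moreover have "closed_segment ?A ?B \<subseteq> convex hull (real_pt ` mface w S)"
    unfolding segment_convex_hull using *(1,2) by (intro hull_mono) auto
  ultimately have "face_at w S = closed_segment ?A ?B" unfolding face_at_hull[OF assms(1)] by blast
  with * that show thesis by blast
qed

lemma compact_face_at:
  assumes "w \<in> weights" "S \<noteq> {}" shows "compact (face_at w S)"
proof -
  obtain A B where "face_at w S = closed_segment A B" using face_at_segment[OF assms] by metis
  then show ?thesis by simp
qed

lemma aff_dim_face_at:
  assumes "w \<in> active S" "S \<noteq> {}" shows "aff_dim (face_at w S) = 1"
proof -
  have w: "w \<in> weights" "len w S > 0" using assms by (auto simp: active_def)
  obtain i j where
    "face_at w S = closed_segment (real_pt (i + len w S * snd w, j)) (real_pt (i, j + len w S * fst w))"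
    using face_at_segment[OF w(1) assms(2)] by metis
  moreover have "(i + len w S * snd w, j) \<noteq> (i, j + len w S * fst w)"
    using w by (auto simp: weights_def)
  ultimately show ?thesis
    by (simp add: segment_convex_hull aff_dim_convex_hull aff_dim_2)
qed

lemma lattice_length_face_at:
  assumes "w \<in> weights" "S \<noteq> {}" shows "lattice_length (face_at w S) = len w S"
proof -
  let ?L = "len w S"
  obtain i j where ij: "(i + ?L * snd w, j) \<in> mface w S" "(i, j + ?L * fst w) \<in> mface w S"
    and F: "face_at w S = closed_segment (real_pt (i + ?L * snd w, j)) (real_pt (i, j + ?L * fst w))"
    using face_at_segment[OF assms] by metis
  have w0: "fst w > 0" "snd w > 0" using assms by (auto simp: weights_def)
  let ?g = "\<lambda>k. real_pt (i + (?L - k) * snd w, j + k * fst w)"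
  have "{(u, v) \<in> face_at w S. u \<in> \<int> \<and> v \<in> \<int>} = ?g ` {..?L}"
  proof (intro equalityI subsetI)
    fix x assume x: "x \<in> {(u, v) \<in> face_at w S. u \<in> \<int> \<and> v \<in> \<int>}"
    have xF: "x \<in> face_at w S" "fst x \<in> \<int>" "snd x \<in> \<int>" using x by auto
    obtain t where t: "0 \<le> t" "t \<le> 1"
      "x = (1 - t) *\<^sub>R real_pt (i + ?L * snd w, j) + t *\<^sub>R real_pt (i, j + ?L * fst w)"
      using xF(1) unfolding F closed_segment_def by auto
    have "fst x = real i + (1 - t) * (?L * snd w)" "snd x = real j + t * (?L * fst w)"
      using t(3) by (simp_all add: real_pt_def algebra_simps)
    \<comment> \<open>The bounds turn the integer coordinates into natural numbers, so that
      \<open>wt_eq_step\<close> applies; x need not be an exponent.\<close>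
    then have ge: "fst x \<ge> real i" "snd x \<ge> real j" using t by simp_all
    have "fst x \<in> \<nat>" "snd x \<in> \<nat>" using xF ge by (auto simp: Nats_altdef2 intro: order_trans[OF of_nat_0_le_iff])
    then obtain a b where ab: "fst x = real a" "snd x = real b" by (auto elim!: Nats_cases)
    then have xab: "x = real_pt (a, b)" by (simp add: real_pt_def prod_eq_iff)
    then have "real (wt w (a, b)) = worder w S" using xF by (simp add: face_at_def)
    then have "wt w (i + ?L * snd w, j) = wt w (a, b)" using ij(1) by (simp add: mface_def)
    moreover have "j \<le> b" using ge ab by simp
    ultimately obtain k where k: "b = j + k * fst w" "i + ?L * snd w = a + k * snd w"
      using wt_eq_step[OF assms(1), of "(i + ?L * snd w, j)" "(a, b)"] by auto
    have "a \<ge> i" using ge ab by simp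
    then have "k * snd w \<le> ?L * snd w" using k by linarith
    then have kL: "k \<le> ?L" using w0 by simp
    then have "a = i + (?L - k) * snd w" using k by (simp add: diff_mult_distrib)
    then show "x \<in> ?g ` {..?L}" using kL k xab by auto
  next
    fix x assume "x \<in> ?g ` {..?L}"
    then obtain k where k: "k \<le> ?L" "x = ?g k" by auto
    have "x \<in> face_at w S"
    proof (cases "?L = 0")
      case True then show ?thesis using k F by simp
    next
      case False
      have "x = (1 - real k / ?L) *\<^sub>R real_pt (i + ?L * snd w, j) + (real k / ?L) *\<^sub>R real_pt (i, j + ?L * fst w)"
        using False k by (simp add: real_pt_def of_nat_diff field_simps)
      then show ?thesis using k False unfolding F closed_segment_def by (auto intro!: exI[of _ "real k / ?L"])
    qed
    then show "x \<in> {(u, v) \<in> face_at w S. u \<in> \<int> \<and> v \<in> \<int>}" using k by (auto simp: real_pt_def)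
  qed
  moreover have "inj_on ?g {..?L}" using w0 by (intro inj_onI) simp
  ultimately have "card {(u, v) \<in> face_at w S. u \<in> \<int> \<and> v \<in> \<int>} = ?L + 1"
    by (simp add: card_image)
  then show ?thesis by (simp add: lattice_length_def)
qed

text \<open>Two distinct common points fix the direction of the line, and a direction has only one
  primitive normal with positive entries.\<close>

lemma face_at_inj:
  assumes "w \<in> active S" "w' \<in> active S" "S \<noteq> {}" "x \<in> face_at w S" "y \<in> face_at w S"
    "x \<in> face_at w' S" "y \<in> face_at w' S" "x \<noteq> y"
  shows "w = w'"
proof -
  have w: "fst w > 0" "snd w > 0" "coprime (fst w) (snd w)" "fst w' > 0" "snd w' > 0" "coprime (fst w') (snd w')"
    using assms by (auto simp: active_def weights_def)
  let ?u = "fst x - fst y" and ?v = "snd x - snd y"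
  have eq: "real (fst w) * ?u + real (snd w) * ?v = 0" "real (fst w') * ?u + real (snd w') * ?v = 0"
    using assms(4-7) by (simp_all add: face_at_def real_pt_inner algebra_simps)
  have u0: "?u \<noteq> 0"
  proof
    assume u: "?u = 0"
    then have "?v = 0" using eq(1) w by simp
    then show False using u assms(8) by (simp add: prod_eq_iff)
  qed
  have "real (fst w) * real (snd w') * ?u = real (fst w') * real (snd w) * ?u"
    using eq by algebra
  then have "real (fst w * snd w') = real (fst w' * snd w)" using u0 by simp
  then have c: "fst w * snd w' = fst w' * snd w" by linarith
  have "fst w dvd fst w' * snd w" "fst w' dvd fst w * snd w'" using c by (metis dvd_triv_left)+
  then have "fst w = fst w'" using w by (metis coprime_dvd_mult_left_iff dvd_antisym)
  then show ?thesis using c w by (simp add: prod_eq_iff)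
qed

lemma face_at_inj_on: "S \<noteq> {} \<Longrightarrow> inj_on (\<lambda>w. face_at w S) (active S)"
proof (rule inj_onI)
  fix w w' assume S: "S \<noteq> {}" and w: "w \<in> active S" "w' \<in> active S" "face_at w S = face_at w' S"
  have "\<not> (\<exists>a. face_at w S = {a})" using aff_dim_face_at[OF w(1) S] by auto
  moreover have "face_at w S \<noteq> {}" using aff_dim_face_at[OF w(1) S] by auto
  ultimately obtain x y where "x \<in> face_at w S" "y \<in> face_at w S" "x \<noteq> y" by blast
  then show "w = w'" using face_at_inj[OF w(1,2) S] w(3) by blast
qed

text \<open>The normal a is orthogonal to the lattice vector p - q; turning that vector by a right
  angle and dividing by the gcd of its entries gives w.\<close>

lemma rational_weight:
  fixes a :: "real \<times> real"
  assumes "fst a > 0" "snd a > 0" "a \<bullet> real_pt p = a \<bullet> real_pt q" "p \<noteq> q"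
  obtains w c where "w \<in> weights" "c > 0" "a = c *\<^sub>R real_pt w"
proof -
  have "\<exists>w c. w \<in> weights \<and> c > 0 \<and> a = c *\<^sub>R real_pt w"
    if eq: "a \<bullet> real_pt p = a \<bullet> real_pt q" and less: "fst p > fst q" for p q :: "nat \<times> nat"
  proof -
    have e: "fst a * (real (fst p) - real (fst q)) = snd a * (real (snd q) - real (snd p))"
      using eq by (cases a) (simp add: real_pt_def algebra_simps)
    have "fst a * (real (fst p) - real (fst q)) > 0" using assms less by simp
    then have "real (snd q) > real (snd p)" using e assms(2) by (simp add: zero_less_mult_iff)
    define m where "m = fst p - fst q"
    define n where "n = snd q - snd p"
    have mn: "m > 0" "n > 0" using less \<open>real (snd q) > real (snd p)\<close> by (auto simp: m_def n_def)
    have e2: "fst a * real m = snd a * real n"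
      using e less \<open>real (snd q) > real (snd p)\<close> by (simp add: m_def n_def of_nat_diff)
    define g where "g = gcd n m"
    define w where "w = (n div g, m div g)"
    have g: "g > 0" using mn by (simp add: g_def)
    have ng: "n = n div g * g" "m = m div g * g" by (simp_all add: g_def)
    then have pos: "n div g > 0" "m div g > 0" using mn by (metis gr0I mult_zero_left)+
    have "coprime (n div g) (m div g)" unfolding g_def using mn by (intro div_gcd_coprime) auto
    then have "w \<in> weights" using pos by (simp add: w_def weights_def)
    moreover have "fst a * real (m div g) * real g = snd a * real (n div g) * real g"
      using e2 ng by (metis mult.assoc of_nat_mult)
    then have "fst a * real (m div g) = snd a * real (n div g)" using g by simp
    then have "a = (fst a / real (n div g)) *\<^sub>R real_pt w"
      using pos by (simp add: w_def real_pt_def prod_eq_iff field_simps)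
    moreover have "fst a / real (n div g) > 0" using pos assms(1) by simp
    ultimately show ?thesis by blast
  qed
  moreover have "fst p \<noteq> fst q"
  proof
    assume "fst p = fst q"
    then have "snd p = snd q" using assms by (cases a) (simp add: real_pt_def)
    then show False using assms(4) \<open>fst p = fst q\<close> by (simp add: prod_eq_iff)
  qed
  ultimately show thesis using assms(3) that by (metis linorder_neqE_nat)
qed

text \<open>The whole polyhedron is unbounded, so a compact face has dimension 0 or 1. A face of
  dimension 1 is cut out by a supporting line through a relative interior point. Compactness
  excludes normals with a zero entry, and two exponents on the line make the normal a multiple of a
  primitive weight.\<close>

lemma compact_face_cases:
  assumes "S \<noteq> {}" "F face_of polyhedron_of S" "compact F" "F \<noteq> {}"
  shows "(\<exists>p\<in>S. F = {real_pt p}) \<or> (\<exists>w\<in>active S. F = face_at w S)"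
proof -
  let ?P = "polyhedron_of S"
  have neP: "F \<noteq> ?P" using assms unbounded_polyhedron_of compact_imp_bounded by blast
  have FP: "F \<subseteq> ?P" using assms(2) face_of_imp_subset by blast
  have "aff_dim F < aff_dim ?P" using face_of_aff_dim_lt[OF convex_polyhedron_of assms(2) neP] .
  also have "\<dots> \<le> 2" using aff_dim_le_DIM[of ?P] by simp
  finally have "aff_dim F < 2" .
  moreover have "aff_dim F \<ge> 0" using assms(4) aff_dim_negative_iff[of F] by linarith
  ultimately consider "aff_dim F = 0" | "aff_dim F = 1" by linarith
  then show ?thesis
  proof cases
    case 1
    then obtain a where a: "F = {a}" by (auto simp: aff_dim_eq_0)
    then have ext: "a extreme_point_of ?P" using assms(2) by (simp add: face_of_singleton)
    then have "a \<in> (\<Union>(i, j)\<in>S. {(real i + u, real j + v) | u v. u \<ge> 0 \<and> v \<ge> 0})"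
      unfolding polyhedron_of_def by (rule extreme_point_of_convex_hull)
    then obtain p u v where p: "p \<in> S" "a = real_pt p + (u, v)" "u \<ge> 0" "v \<ge> 0"
      by (force simp: real_pt_def)
    have "(u, v) = 0"
    proof (rule ccontr)
      assume nz: "(u, v) \<noteq> 0"
      \<comment> \<open>Doubling the shift makes a the midpoint of two points of the
        polyhedron.\<close>
      let ?b = "real_pt p + (2 * u, 2 * v)"
      have "a = midpoint (real_pt p) ?b"
        by (simp add: midpoint_def p prod_eq_iff real_pt_def algebra_simps)
      moreover have "real_pt p \<noteq> ?b" using nz by (auto simp: zero_prod_def real_pt_def)
      ultimately have "a \<in> open_segment (real_pt p) ?b" by simp
      moreover have "real_pt p \<in> ?P" "?b \<in> ?P"
        using real_pt_in_polyhedron[OF p(1)] polyhedron_of_add p by auto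
      ultimately show False using ext by (simp add: extreme_point_of_def)
    qed
    then show ?thesis using a p by auto
  next
    case 2
    have "rel_interior F \<noteq> {}"
      using assms(2,4) face_of_imp_convex rel_interior_eq_empty by blast
    then obtain x where x: "x \<in> rel_interior F" by blast
    have xF: "x \<in> F" using x rel_interior_subset by blast
    have "x \<notin> rel_interior ?P" using face_of_disjoint_rel_interior[OF assms(2) neP] xF by blast
    then obtain a where a: "a \<noteq> 0" "\<And>y. y \<in> ?P \<Longrightarrow> a \<bullet> x \<le> a \<bullet> y"
      using supporting_hyperplane_rel_boundary[OF convex_polyhedron_of] xF FP by (metis subsetD)
    define G where "G = ?P \<inter> {y. a \<bullet> y = a \<bullet> x}"
    have Gf: "G face_of ?P" unfolding G_def
      by (rule face_of_Int_supporting_hyperplane_ge[OF convex_polyhedron_of a(2)])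
    have FG: "F \<subseteq> G"
      using x xF FP by (intro subset_of_face_of[OF Gf FP]) (auto simp: G_def)
    have "F face_of G" using face_of_subset[OF assms(2) FG] face_of_imp_subset[OF Gf] by blast
    moreover have "aff_dim G \<le> 1"
      using aff_dim_subset[of G "{y. a \<bullet> y = a \<bullet> x}"] aff_dim_hyperplane[OF a(1), of "a \<bullet> x"]
      by (simp add: G_def)
    moreover have "convex G" using Gf face_of_imp_convex by blast
    ultimately have FG: "F = G" using face_of_aff_dim_lt[of G F] 2 by fastforce
    have xP: "x \<in> ?P" using xF FP by blast
    \<comment> \<open>A direction of the quadrant parallel to the supporting line would put a ray
      into F. The factor t makes the shift longer than the bound of F plus the norm of x.\<close>
    have unb: False if "u \<ge> 0" "v \<ge> 0" "(u, v) \<noteq> 0" "a \<bullet> (u, v) = 0" for u v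
    proof -
      obtain B where B: "\<And>y. y \<in> F \<Longrightarrow> norm y \<le> B" 
        using compact_imp_bounded[OF assms(3)] by (auto simp: bounded_iff)
      define N where "N = norm (u, v)"
      have N: "N > 0" unfolding N_def using that(3) by (rule zero_less_norm_iff[THEN iffD2])
      define t where "t = (\<bar>B\<bar> + norm x + 1) / N"
      have t: "t \<ge> 0" using N by (simp add: t_def)
      have "x + t *\<^sub>R (u, v) \<in> F" unfolding FG G_def
        using polyhedron_of_add[OF xP, of "t * u" "t * v"] that t
        by (simp add: inner_add_right inner_scaleR_right del: scaleR_Pair) (simp add: scaleR_Pair)
      then have "norm (x + t *\<^sub>R (u, v)) \<le> B" by (rule B)
      moreover have "norm (t *\<^sub>R (u, v)) = \<bar>B\<bar> + norm x + 1"
        using t N unfolding norm_scaleR N_def[symmetric] by (simp add: t_def)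
      moreover have "norm (t *\<^sub>R (u, v)) \<le> norm (x + t *\<^sub>R (u, v)) + norm x"
        by (metis add_diff_cancel_left' norm_triangle_ineq4)
      ultimately show False by simp
    qed
    have "a \<bullet> (1, 0) \<ge> 0" "a \<bullet> (0, 1) \<ge> 0"
      using a(2)[OF polyhedron_of_add[OF xP, of 1 0]] a(2)[OF polyhedron_of_add[OF xP, of 0 1]]
      by (simp_all add: inner_add_right)
    moreover have "a \<bullet> (1, 0) \<noteq> 0" "a \<bullet> (0, 1) \<noteq> 0" using unb[of 1 0] unb[of 0 1] by (auto simp: zero_prod_def)
    ultimately have pos: "fst a > 0" "snd a > 0" by (cases a, simp)+
    have ge: "a \<bullet> x \<le> a \<bullet> real_pt p" if "p \<in> S" for p using a(2) real_pt_in_polyhedron[OF that] by blast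
    define M where "M = {p \<in> S. a \<bullet> real_pt p = a \<bullet> x}"
    have Fsub: "F \<subseteq> convex hull (real_pt ` M)"
    proof
      fix y assume "y \<in> F"
      then have y: "y \<in> ?P" "a \<bullet> y = a \<bullet> x" by (simp_all add: FG G_def)
      have "y \<in> {y. a \<bullet> y > a \<bullet> x} \<union> convex hull (real_pt ` M)"
        using polyhedron_of_halfspace[OF pos, of S "a \<bullet> x"] ge y(1) unfolding M_def by blast
      then show "y \<in> convex hull (real_pt ` M)" using y(2) by simp
    qed
    have "\<exists>p\<in>M. \<exists>q\<in>M. p \<noteq> q"
    proof (rule ccontr)
      assume eq: "\<not> (\<exists>p\<in>M. \<exists>q\<in>M. p \<noteq> q)"
      have "M \<noteq> {}" using Fsub assms(4) by auto
      then obtain p where "M = {p}" using eq by blast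
      then have "F = {real_pt p}" using Fsub assms(4) by auto
      then show False using 2 by simp
    qed
    then obtain p q where "p \<in> M" "q \<in> M" and pq: "p \<noteq> q" by blast
    then have pS: "p \<in> S" "q \<in> S" "a \<bullet> real_pt p = a \<bullet> x" "a \<bullet> real_pt q = a \<bullet> x"
      by (auto simp: M_def)
    then obtain w c where w: "w \<in> weights" "c > 0" "a = c *\<^sub>R real_pt w"
      using rational_weight[OF pos, of p q] pS pq by metis
    have wo: "worder w S = wt w p"
    proof (rule worder_eqI)
      show "p \<in> S" by (rule pS(1))
      fix r assume "r \<in> S"
      then have "a \<bullet> real_pt p \<le> a \<bullet> real_pt r" using ge[of r] pS(3) by simp
      then have "c * real (wt w p) \<le> c * real (wt w r)" by (simp add: w(3))
      then show "wt w p \<le> wt w r" using w(2) by simp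
    qed simp
    have ax: "a \<bullet> x = c * real (wt w p)" unfolding pS(3)[symmetric] by (simp add: w(3))
    have "a \<bullet> y = c * (real_pt w \<bullet> y)" for y by (simp add: w(3))
    then have F: "F = face_at w S" unfolding FG G_def face_at_def wo ax using w(2) by simp
    have "p \<in> mface w S" "q \<in> mface w S" using pS w(2) by (auto simp: mface_def wo w(3))
    then have "w \<in> active S" using len_pos_iff[OF w(1) assms(1)] w(1) pq by (auto simp: active_def)
    then show ?thesis using F by blast
  qed
qed


section \<open>The Newton delta invariant as a number of lattice points\<close>

lemma newton_edges_eq:
  assumes "supp f \<noteq> {}"
  shows "newton_edges f = (\<lambda>w. face_at w (supp f)) ` active (supp f)"
proof (intro equalityI subsetI)
  fix E assume "E \<in> newton_edges f"
  then have E: "E face_of polyhedron_of (supp f)" "aff_dim E = 1" "compact E"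
    by (auto simp: newton_edges_def edge_of_def newton_polyhedron_eq)
  then have "E \<noteq> {}" "\<not> (\<exists>p. E = {p})" by auto
  then show "E \<in> (\<lambda>w. face_at w (supp f)) ` active (supp f)"
    using compact_face_cases[OF assms E(1,3)] by blast
next
  fix E assume "E \<in> (\<lambda>w. face_at w (supp f)) ` active (supp f)"
  then obtain w where w: "w \<in> active (supp f)" "E = face_at w (supp f)" by blast
  then show "E \<in> newton_edges f"
    using aff_dim_face_at[OF w(1) assms] face_at_face_of compact_face_at[OF _ assms]
    by (simp add: newton_edges_def edge_of_def newton_polyhedron_eq active_def)
qed

section \<open>Area of the region under the Newton diagram\<close>

definition cart_of_prod :: "real \<times> real \<Rightarrow> real ^ 2" where
  "cart_of_prod x = (\<chi> i. if i = 1 then fst x else snd x)"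

lemma cart_of_prod_nth [simp]: "cart_of_prod x $ 1 = fst x" "cart_of_prod x $ 2 = snd x"
  by (simp_all add: cart_of_prod_def)

lemma linear_cart_of_prod: "linear cart_of_prod"
  by (rule linearI) (simp_all add: vec_eq_iff forall_2)

lemma inj_cart_of_prod: "inj cart_of_prod"
  by (rule injI) (simp add: vec_eq_iff forall_2 prod_eq_iff)

text \<open>Boxes correspond to boxes of the same volume, so the two models of the plane carry the
  same measure; this lets \<open>content_triangle\<close> compute areas of triangles of
  pairs.\<close>

lemma distr_cart_of_prod: "distr lborel lborel cart_of_prod = lborel"
proof (rule lborel_eqI[symmetric])
  fix l u :: "real ^ 2" assume lu: "\<And>b. b \<in> Basis \<Longrightarrow> l \<bullet> b \<le> u \<bullet> b"
  have le: "l $ i \<le> u $ i" for i using lu[of "axis i 1"] by (simp add: cart_eq_inner_axis)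
  have meas: "cart_of_prod \<in> borel_measurable borel"
    by (intro borel_measurable_continuous_onI linear_continuous_on linear_cart_of_prod
        linear_conv_bounded_linear[THEN iffD1])
  have vimage: "cart_of_prod -` box l u = box (l $ 1, l $ 2) (u $ 1, u $ 2)"
    by (auto simp: mem_box_cart forall_2 mem_box Basis_prod_def)
  have "emeasure (distr lborel lborel cart_of_prod) (box l u) = emeasure lborel (cart_of_prod -` box l u)"
    using meas by (subst emeasure_distr) auto
  also have "\<dots> = ennreal (\<Prod>b\<in>Basis. ((u $ 1, u $ 2) - (l $ 1, l $ 2)) \<bullet> b)"
    unfolding vimage using le by (intro emeasure_lborel_box) (auto simp: Basis_prod_def)
  also have "(\<Prod>b\<in>Basis. ((u $ 1, u $ 2) - (l $ 1, l $ 2)) \<bullet> b) = (u $ 1 - l $ 1) * (u $ 2 - l $ 2)"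
    by (simp add: Basis_prod_def)
  also have "\<dots> = (\<Prod>b\<in>Basis. (u - l) \<bullet> b)"
    by (simp add: Basis_vec_def cart_eq_inner_axis axis_eq_axis prod.UNION_disjoint UNIV_2
        inner_diff_left mult.commute)
  finally show "emeasure (distr lborel lborel cart_of_prod) (box l u) = ennreal (\<Prod>b\<in>Basis. (u - l) \<bullet> b)" .
qed simp

lemma measure_triangle:
  fixes a b :: "real \<times> real"
  shows "measure lebesgue (convex hull {0, a, b}) = \<bar>fst a * snd b - fst b * snd a\<bar> / 2"
proof -
  let ?K = "convex hull {0, a, b}"
  have comp: "compact ?K" by (intro finite_imp_compact_convex_hull) auto
  have img: "cart_of_prod ` ?K = convex hull {cart_of_prod 0, cart_of_prod a, cart_of_prod b}"
    using convex_hull_linear_image[OF linear_cart_of_prod, of "{0, a, b}"] by simp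
  have meas: "cart_of_prod \<in> borel_measurable borel"
    by (intro borel_measurable_continuous_onI linear_continuous_on linear_cart_of_prod
        linear_conv_bounded_linear[THEN iffD1])
  have cimg: "compact (cart_of_prod ` ?K)" unfolding img by (intro finite_imp_compact_convex_hull) auto
  have "measure lebesgue ?K = measure lborel ?K"
    using comp by (intro measure_completion) (simp add: borel_compact)
  also have "\<dots> = measure lborel (cart_of_prod -` (cart_of_prod ` ?K))"
    using inj_cart_of_prod by (simp add: inj_vimage_image_eq)
  also have "\<dots> = measure (distr lborel lborel cart_of_prod) (cart_of_prod ` ?K)"
    using meas cimg by (subst measure_distr) (auto simp: borel_compact)
  also have "\<dots> = measure lborel (convex hull {cart_of_prod 0, cart_of_prod a, cart_of_prod b})"
    unfolding distr_cart_of_prod img ..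
  also have "\<dots> = \<bar>fst a * snd b - fst b * snd a\<bar> / 2"
    by (subst content_triangle) (simp add: abs_minus_commute mult.commute)
  finally show ?thesis .
qed

lemma negligible_closed_segment: "negligible (closed_segment 0 (p::real \<times> real))"
proof (cases "p = 0")
  case False
  have "closed_segment 0 p \<subseteq> {x. (- snd p, fst p) \<bullet> x = 0}"
    by (auto simp: in_segment) (cases p, simp)
  moreover have "(- snd p, fst p) \<noteq> 0" using False by (cases p) (auto simp: zero_prod_def)
  ultimately show ?thesis using negligible_hyperplane negligible_subset by metis
qed auto

definition cone_at :: "nat \<times> nat \<Rightarrow> (nat \<times> nat) set \<Rightarrow> (real \<times> real) set" where
  "cone_at w S = (\<Union>p\<in>face_at w S. closed_segment 0 p)"

lemma cone_at_triangle:
  assumes "w \<in> weights" "S \<noteq> {}"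
  shows "compact (cone_at w S)" "measure lebesgue (cone_at w S) = real (worder w S * len w S) / 2"
proof -
  define L where "L = len w S"
  obtain i j where ij: "(i + L * snd w, j) \<in> mface w S"
    and F: "face_at w S = closed_segment (real_pt (i + L * snd w, j)) (real_pt (i, j + L * fst w))"
    using face_at_segment[OF assms] unfolding L_def by metis
  define A B where AB: "A = real_pt (i + L * snd w, j)" "B = real_pt (i, j + L * fst w)"
  have "convex hull {0, A, B} = (\<Union>x\<in>convex hull {A, B}. closed_segment 0 x)"
    using convex_hull_insert_segments[of 0 "{A, B}"] by simp
  then have eq: "cone_at w S = convex hull {0, A, B}"
    by (simp only: cone_at_def F AB segment_convex_hull)
  show "compact (cone_at w S)" unfolding eq by (intro finite_imp_compact_convex_hull) auto
  have wo: "worder w S = fst w * (i + L * snd w) + snd w * j"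
    using ij unfolding mface_def wt_def by auto
  \<comment> \<open>For w = (a, b) this determinant is L (a (i + L b) + b j), and the bracket is the
    weight of the end point A.\<close>
  have "fst A * snd B - fst B * snd A = real (i + L * snd w) * real (j + L * fst w) - real i * real j"
    by (simp only: AB real_pt_def fst_conv snd_conv)
  also have "\<dots> = real (worder w S * L)"
    unfolding wo by (simp add: algebra_simps)
  finally show "measure lebesgue (cone_at w S) = real (worder w S * len w S) / 2"
    unfolding eq measure_triangle L_def[symmetric] by (simp only: abs_of_nat)
qed

lemma worder_pos:
  assumes "w \<in> weights" "S \<noteq> {}" "(0, 0) \<notin> S" shows "worder w S > 0"
proof -
  obtain p where "p \<in> S" "wt w p = worder w S" using worder_attained[OF assms(2)] by blast
  moreover from this have "p \<noteq> (0, 0)" using assms by auto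
  ultimately show ?thesis using assms(1) by (cases p) (auto simp: wt_def weights_def intro!: gr0I)
qed

text \<open>If z = l p = m q is nonzero with p and q on the two faces, evaluating either weight at z
  and using minimality on its face gives m \<le> l and l \<le> m. So p = q is a common point of the
  faces, and distinct edges share at most one.\<close>

lemma negligible_cone_Int:
  assumes "w \<in> active S" "w' \<in> active S" "w \<noteq> w'" "S \<noteq> {}" "(0, 0) \<notin> S"
  shows "negligible (cone_at w S \<inter> cone_at w' S)"
proof -
  have ww: "w \<in> weights" "w' \<in> weights" using assms by (auto simp: active_def)
  have pos: "worder w S > 0" "worder w' S > 0" using worder_pos assms(4,5) ww by auto
  have common: "z = 0 \<or> (\<exists>p. p \<in> face_at w S \<inter> face_at w' S \<and> z \<in> closed_segment 0 p)"
    if z: "z \<in> cone_at w S" "z \<in> cone_at w' S" for z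
  proof (cases "z = 0")
    case False
    obtain p l where p: "p \<in> face_at w S" "z = l *\<^sub>R p" "0 \<le> l" "l \<le> 1"
      using z(1) by (auto simp: cone_at_def in_segment)
    obtain q m where q: "q \<in> face_at w' S" "z = m *\<^sub>R q" "0 \<le> m" "m \<le> 1"
      using z(2) by (auto simp: cone_at_def in_segment)
    have "l > 0" "m > 0" using p q False by (auto simp: less_eq_real_def)
    have "p \<in> polyhedron_of S" "q \<in> polyhedron_of S" using p q by (auto simp: face_at_def)
    then have ge: "real_pt w \<bullet> q \<ge> worder w S" "real_pt w' \<bullet> p \<ge> worder w' S"
      using polyhedron_of_ge ww by blast+
    have "l * worder w S = real_pt w \<bullet> z" using p by (simp add: face_at_def)
    also have "\<dots> = m * (real_pt w \<bullet> q)" using q by simp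
    also have "\<dots> \<ge> m * worder w S" using ge q by (intro mult_left_mono) auto
    finally have 1: "m \<le> l" using pos by simp
    have "m * worder w' S = real_pt w' \<bullet> z" using q by (simp add: face_at_def)
    also have "\<dots> = l * (real_pt w' \<bullet> p)" using p by simp
    also have "\<dots> \<ge> l * worder w' S" using ge p by (intro mult_left_mono) auto
    finally have "l \<le> m" using pos by simp
    with 1 have "l = m" by simp
    then have "p = q" using p q \<open>l > 0\<close> by simp
    then have "p \<in> face_at w S \<inter> face_at w' S" "z \<in> closed_segment 0 p"
      using p q by (auto simp: in_segment)
    then show ?thesis by blast
  qed simp
  show ?thesis
  proof (cases "\<exists>r. r \<in> face_at w S \<inter> face_at w' S")
    case True
    then obtain r where r: "r \<in> face_at w S" "r \<in> face_at w' S" by blast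
    have "p = r" if "p \<in> face_at w S \<inter> face_at w' S" for p
      using face_at_inj[OF assms(1,2,4), of p r] that r assms(3) by blast
    then have "cone_at w S \<inter> cone_at w' S \<subseteq> closed_segment 0 r" using common by fastforce
    then show ?thesis using negligible_closed_segment negligible_subset by blast
  next
    case False
    then have "cone_at w S \<inter> cone_at w' S \<subseteq> {0}" using common by blast
    then show ?thesis using negligible_sing negligible_subset by blast
  qed
qed

text \<open>Besides the triangles over the edges, \<open>newton_minus\<close> contains segments over
  single vertices. There are only countably many, so they form a null set, whether or not a vertex
  lies on an edge.\<close>

lemma measure_newton_minus:
  assumes "supp f \<noteq> {}" "finite (active (supp f))"
  shows "measure lebesgue (newton_minus f)
    = (\<Sum>w\<in>active (supp f). real (worder w (supp f) * len w (supp f)) / 2)"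
proof -
  let ?S = "supp f"
  let ?U = "\<Union>w\<in>active ?S. cone_at w ?S"
  have ww: "w \<in> weights" if "w \<in> active ?S" for w using that by (simp add: active_def)
  have sub1: "?U \<subseteq> newton_minus f"
    using face_at_face_of compact_face_at[OF _ assms(1)] ww
    by (fastforce simp: newton_minus_def newton_diagram_def cone_at_def newton_polyhedron_eq)
  have sub2: "newton_minus f \<subseteq> ?U \<union> (\<Union>p\<in>?S. closed_segment 0 (real_pt p))"
  proof
    fix z assume "z \<in> newton_minus f"
    then obtain F p where F: "F face_of polyhedron_of ?S" "compact F" "p \<in> F" "z \<in> closed_segment 0 p"
      by (auto simp: newton_minus_def newton_diagram_def newton_polyhedron_eq)
    then have "(\<exists>p\<in>?S. F = {real_pt p}) \<or> (\<exists>w\<in>active ?S. F = face_at w ?S)"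
      using compact_face_cases[OF assms(1)] by blast
    then show "z \<in> ?U \<union> (\<Union>p\<in>?S. closed_segment 0 (real_pt p))"
      using F(3,4) by (auto simp: cone_at_def)
  qed
  have meas: "cone_at w ?S \<in> lmeasurable" if "w \<in> active ?S" for w
    using cone_at_triangle(1)[OF ww[OF that] assms(1)] by (rule lmeasurable_compact)
  have "negligible (\<Union>p\<in>?S. closed_segment 0 (real_pt p))"
    by (intro negligible_countable_Union) (auto simp: negligible_closed_segment)
  then have "negligible (newton_minus f - ?U)" by (rule negligible_subset) (use sub2 in blast)
  moreover have "?U - newton_minus f = {}" using sub1 by blast
  ultimately have "negligible ((?U - newton_minus f) \<union> (newton_minus f - ?U))" by simp
  moreover have "?U \<in> lmeasurable" using assms(2) meas by (intro fmeasurable.finite_UN) auto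
  ultimately have "measure lebesgue (newton_minus f) = measure lebesgue ?U"
    by (intro measure_negligible_symdiff)
  also have "\<dots> = (\<Sum>w\<in>active ?S. measure lebesgue (cone_at w ?S))"
  proof (cases "(0, 0) \<in> ?S")
    case True
    then show ?thesis using origin_mem(3)[OF True] by simp
  next
    case False
    then show ?thesis
      using assms meas negligible_cone_Int[OF _ _ _ assms(1) False]
      by (intro measure_negligible_finite_Union_image) (auto simp: pairwise_def)
  qed
  also have "\<dots> = (\<Sum>w\<in>active ?S. real (worder w ?S * len w ?S) / 2)"
    by (intro sum.cong) (auto simp: cone_at_triangle(2)[OF ww assms(1)])
  finally show ?thesis .
qed

section \<open>The Newton diagram on the coordinate axes\<close>

lemma polyhedron_of_inner_ge:
  assumes "x \<in> polyhedron_of S" "fst a \<ge> 0" "snd a \<ge> 0" "\<And>p. p \<in> S \<Longrightarrow> a \<bullet> real_pt p \<ge> c"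
  shows "a \<bullet> x \<ge> c"
proof -
  have "polyhedron_of S \<subseteq> {x. a \<bullet> x \<ge> c}"
  proof (rule polyhedron_of_subset[OF convex_halfspace_ge])
    fix p u v assume "p \<in> S" "u \<ge> (0::real)" "v \<ge> (0::real)"
    then have "a \<bullet> real_pt p \<ge> c" "a \<bullet> (u, v) \<ge> 0" using assms(2-4) by (cases a, simp)+
    then show "real_pt p + (u, v) \<in> {x. a \<bullet> x \<ge> c}" by (simp add: inner_add_right)
  qed
  then show ?thesis using assms(1) by blast
qed

lemma diagram_singleton:
  assumes "w \<in> weights" "p \<in> supp f" "\<And>q. q \<in> supp f \<Longrightarrow> q \<noteq> p \<Longrightarrow> wt w p < wt w q"
  shows "real_pt p \<in> newton_diagram f"
proof -
  define S where "S = supp f"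
  note pS = assms(2)[folded S_def] and less = assms(3)[folded S_def]
  have wo: "worder w S = wt w p"
  proof (rule worder_eqI[OF pS refl])
    fix q assume "q \<in> S" then show "wt w p \<le> wt w q" using less[of q] by (cases "q = p") simp_all
  qed
  have "mface w S = {p}"
  proof (intro equalityI subsetI)
    fix q assume "q \<in> mface w S" then show "q \<in> {p}" using less[of q] by (cases "q = p") (simp_all add: mface_def wo)
  qed (simp add: mface_def wo pS)
  then have "face_at w S = {real_pt p}" by (simp add: face_at_hull[OF assms(1)])
  with face_at_face_of[OF assms(1), of S] have "{real_pt p} face_of polyhedron_of S" by simp
  then have "{real_pt p} \<in> {F. F face_of polyhedron_of S \<and> compact F}" by simp
  then show ?thesis unfolding newton_diagram_def newton_polyhedron_eq S_def[symmetric] by (rule UnionI) simp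
qed

lemma diagram_x_end:
  assumes "meets_axes (supp f)" shows "(real (x_end (supp f)), 0) \<in> newton_diagram f"
proof -
  let ?s = "x_end (supp f)"
  have "real_pt (?s, 0) \<in> newton_diagram f"
  proof (rule diagram_singleton)
    \<comment> \<open>This weight makes every point of positive ordinate heavier than (s, 0); on the
      axis itself s is the least abscissa.\<close>
    show "(1, ?s + 1) \<in> weights" by (simp add: weights_def)
    show "(?s, 0) \<in> supp f" by (rule x_end_mem[OF assms])
    fix q assume q: "q \<in> supp f" "q \<noteq> (?s, 0)"
    obtain i j where ij: "q = (i, j)" by (cases q)
    show "wt (1, ?s + 1) (?s, 0) < wt (1, ?s + 1) q"
    proof (cases j)
      case 0
      then have "?s \<le> i" "i \<noteq> ?s" using x_end_le q ij by auto
      then show ?thesis using ij 0 by simp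
    qed (simp add: ij)
  qed
  then show ?thesis by (simp add: real_pt_def)
qed

lemma diagram_y_end:
  assumes "meets_axes (supp f)" shows "(0, real (y_end (supp f))) \<in> newton_diagram f"
proof -
  let ?t = "y_end (supp f)"
  have "real_pt (0, ?t) \<in> newton_diagram f"
  proof (rule diagram_singleton)
    show "(?t + 1, 1) \<in> weights" by (simp add: weights_def)
    show "(0, ?t) \<in> supp f" by (rule y_end_mem[OF assms])
    fix q assume q: "q \<in> supp f" "q \<noteq> (0, ?t)"
    obtain i j where ij: "q = (i, j)" by (cases q)
    show "wt (?t + 1, 1) (0, ?t) < wt (?t + 1, 1) q"
    proof (cases i)
      case 0
      then have "?t \<le> j" "j \<noteq> ?t" using y_end_le q ij by auto
      then show ?thesis using ij 0 by simp
    qed (simp add: ij)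
  qed
  then show ?thesis by (simp add: real_pt_def)
qed

lemma newton_diagram_subset: "newton_diagram f \<subseteq> polyhedron_of (supp f)"
  unfolding newton_diagram_def newton_polyhedron_eq using face_of_imp_subset by blast

lemma convenient_iff: "convenient f \<longleftrightarrow> meets_axes (supp f)"
proof
  assume "convenient f"
  then obtain s t where st: "(s, 0) \<in> polyhedron_of (supp f)" "(0, t) \<in> polyhedron_of (supp f)"
    using newton_diagram_subset unfolding convenient_def by blast
  have "\<exists>t. (0, t) \<in> supp f"
  proof (rule ccontr)
    assume no: "\<not> ?thesis"
    \<comment> \<open>The bound passes from the exponents to the whole polyhedron, which then misses
      the axis.\<close>
    have "fst p \<ge> 1" if "p \<in> supp f" for p using no that by (cases p; cases "fst p") auto
    then have "(1, 0) \<bullet> (0::real, t) \<ge> 1"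
      by (intro polyhedron_of_inner_ge[OF st(2)]) (fastforce simp: real_pt_def)+
    then show False by simp
  qed
  moreover have "\<exists>s. (s, 0) \<in> supp f"
  proof (rule ccontr)
    assume no: "\<not> ?thesis"
    have "snd p \<ge> 1" if "p \<in> supp f" for p using no that by (cases p; cases "snd p") auto
    then have "(0, 1) \<bullet> (s, 0::real) \<ge> 1"
      by (intro polyhedron_of_inner_ge[OF st(1)]) (fastforce simp: real_pt_def)+
    then show False by simp
  qed
  ultimately show "meets_axes (supp f)" by (simp add: meets_axes_def)
next
  assume "meets_axes (supp f)"
  then show "convenient f" using diagram_x_end diagram_y_end unfolding convenient_def by blast
qed

text \<open>Beyond T the point x e is interior to segments of the polyhedron that reach arbitrarily
  far along the ray. A face containing it would contain their far ends and could not be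
  compact.\<close>

lemma diagram_ray:
  assumes "T *\<^sub>R e \<in> newton_diagram f" "x *\<^sub>R e \<in> newton_diagram f" "fst e \<ge> 0" "snd e \<ge> 0" "e \<noteq> 0"
  shows "x \<le> T"
proof (rule ccontr)
  assume "\<not> x \<le> T"
  then have Tx: "T < x" by simp
  obtain F where F: "F face_of polyhedron_of (supp f)" "compact F" "x *\<^sub>R e \<in> F"
    using assms(2) by (auto simp: newton_diagram_def newton_polyhedron_eq)
  have T: "T *\<^sub>R e \<in> polyhedron_of (supp f)" and X: "x *\<^sub>R e \<in> polyhedron_of (supp f)"
    using assms(1,2) newton_diagram_subset by blast+
  have inF: "(x + 1 + real n) *\<^sub>R e \<in> F" for n :: nat
  proof -
    let ?y = "x + 1 + real n"
    have "x *\<^sub>R e + ((1 + real n) * fst e, (1 + real n) * snd e) \<in> polyhedron_of (supp f)"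
      using assms(3,4) by (intro polyhedron_of_add[OF X]) simp_all
    also have "x *\<^sub>R e + ((1 + real n) * fst e, (1 + real n) * snd e) = ?y *\<^sub>R e"
      by (simp add: prod_eq_iff algebra_simps)
    finally have P: "?y *\<^sub>R e \<in> polyhedron_of (supp f)" .
    define u where "u = (x - T) / (?y - T)"
    have u: "0 < u" "u < 1" "u * (?y - T) = x - T" using Tx by (auto simp: u_def)
    then have "x = (1 - u) * T + u * ?y" by (simp add: algebra_simps)
    then have "x *\<^sub>R e = (1 - u) *\<^sub>R (T *\<^sub>R e) + u *\<^sub>R (?y *\<^sub>R e)"
      by (metis scaleR_scaleR scaleR_left_distrib)
    then have "x *\<^sub>R e \<in> open_segment (T *\<^sub>R e) (?y *\<^sub>R e)"
      using u Tx assms(5) unfolding in_segment by auto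
    then show ?thesis using F(1,3) T P unfolding face_of_def by blast
  qed
  obtain B where B: "\<And>y. y \<in> F \<Longrightarrow> norm y \<le> B"
    using compact_imp_bounded[OF F(2)] by (auto simp: bounded_iff)
  obtain n :: nat where "real n > B / norm e + \<bar>x\<bar>" using reals_Archimedean2 by blast
  then have "\<bar>x + 1 + real n\<bar> > B / norm e" by linarith
  then have "\<bar>x + 1 + real n\<bar> * norm e > B" using assms(5) by (simp add: divide_less_eq)
  then show False using B[OF inF[of n]] by simp
qed

lemma newton_minus_ray:
  assumes "T *\<^sub>R e \<in> newton_diagram f" "T \<ge> 0" "fst e \<ge> 0" "snd e \<ge> 0" "e \<noteq> 0"
  shows "{t. t *\<^sub>R e \<in> newton_minus f} = {0..T}"
proof (intro equalityI subsetI)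
  fix t assume "t \<in> {t. t *\<^sub>R e \<in> newton_minus f}"
  then obtain p l where p: "p \<in> newton_diagram f" "t *\<^sub>R e = l *\<^sub>R p" "0 \<le> l" "l \<le> 1"
    by (auto simp: newton_minus_def in_segment)
  show "t \<in> {0..T}"
  proof (cases "l = 0")
    case True
    then show ?thesis using p(2) assms(2,5) by simp
  next
    case False
    have "(t / l) *\<^sub>R e = (1 / l) *\<^sub>R (t *\<^sub>R e)" by simp
    then have pe: "p = (t / l) *\<^sub>R e" unfolding p(2) using False by simp
    then have le: "t / l \<le> T" using diagram_ray[OF assms(1) _ assms(3-5)] p(1) by blast
    have "p \<in> polyhedron_of (supp f)" using p(1) newton_diagram_subset by blast
    then have "e \<bullet> p \<ge> 0"
      using assms(3,4) by (rule polyhedron_of_inner_ge) (simp add: inner_prod_def real_pt_def assms(3,4))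
    then have "(t / l) * (e \<bullet> e) \<ge> 0" unfolding pe inner_scaleR_right .
    moreover have "e \<bullet> e > 0" using assms(5) by simp
    ultimately have tl: "t / l \<ge> 0" using zero_le_mult_iff[of "t / l" "e \<bullet> e"] by linarith
    have "l * (t / l) \<le> 1 * T" using p(3,4) le tl by (intro mult_mono) auto
    then show ?thesis using False p(3) tl by (simp add: zero_le_divide_iff)
  qed
next
  fix t assume t: "t \<in> {0..T}"
  have "t *\<^sub>R e \<in> closed_segment 0 (T *\<^sub>R e)"
    using t by (auto simp: in_segment divide_le_eq_1 intro!: exI[of _ "t / T"])
  then show "t \<in> {t. t *\<^sub>R e \<in> newton_minus f}" using assms(1) by (auto simp: newton_minus_def)
qed

lemma axis_length_newton_minus:
  assumes "meets_axes (supp f)"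
  shows "axis_length (newton_minus f) = x_end (supp f) + y_end (supp f)"
proof -
  have "{t. (t, 0) \<in> newton_minus f} = {0..real (x_end (supp f))}"
    using newton_minus_ray[of "real (x_end (supp f))" "(1, 0)" f] diagram_x_end[OF assms]
    by (simp add: zero_prod_def)
  moreover have "{t. (0, t) \<in> newton_minus f} = {0..real (y_end (supp f))}"
    using newton_minus_ray[of "real (y_end (supp f))" "(0, 1)" f] diagram_y_end[OF assms]
    by (simp add: zero_prod_def)
  ultimately show ?thesis by (simp add: axis_length_def)
qed

text \<open>The triangles contribute \<open>worder * len / 2\<close> and the lattice lengths
  \<open>len / 2\<close>. Together they are half of the third sum in \<open>active_sums\<close>,
  whose surplus \<open>x_end + y_end\<close> is removed by the axis term.\<close>

lemma delta_N_convenient_eq: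
  assumes "meets_axes (supp f)"
  shows "delta_N_convenient f = card (below (supp f))"
proof -
  let ?S = "supp f"
  have ne: "?S \<noteq> {}" using assms meets_axes_nonempty by blast
  note sums = active_sums[OF assms]
  have "(\<Sum>E\<in>newton_edges f. lattice_length E) = (\<Sum>w\<in>active ?S. lattice_length (face_at w ?S))"
    unfolding newton_edges_eq[OF ne] by (simp add: sum.reindex[OF face_at_inj_on[OF ne]])
  also have "\<dots> = (\<Sum>w\<in>active ?S. real (len w ?S))"
    by (intro sum.cong) (auto simp: lattice_length_face_at[OF _ ne] active_def)
  finally have "delta_N_convenient f
      = (\<Sum>w\<in>active ?S. real (worder w ?S * len w ?S) / 2) - real (x_end ?S + y_end ?S) / 2
        + (\<Sum>w\<in>active ?S. real (len w ?S)) / 2"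
    unfolding delta_N_convenient_def
    using measure_newton_minus[OF ne] axis_length_newton_minus[OF assms] sums by simp
  also have "\<dots> = (real (\<Sum>w\<in>active ?S. len w ?S * (worder w ?S + 1)) - real (x_end ?S + y_end ?S)) / 2"
    by (simp add: sum_divide_distrib[symmetric] sum.distrib algebra_simps add_divide_distrib diff_divide_distrib)
  also have "\<dots> = card (below ?S)" using sums by simp
  finally show ?thesis .
qed

section \<open>Monotonicity and the supremum over completions\<close>

lemma below_antimono:
  assumes "polyhedron_of S \<subseteq> polyhedron_of T"
  shows "below T \<subseteq> below S"
proof
  fix u assume "u \<in> below T"
  then obtain w where u: "fst u > 0" "snd u > 0" "w \<in> weights" "\<forall>p\<in>T. wt w u \<le> wt w p"
    by (auto simp: below_def)
  have "wt w u \<le> wt w p" if "p \<in> S" for p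
  proof (cases "T = {}")
    case True
    then show ?thesis using real_pt_in_polyhedron[OF that] assms by (auto simp: polyhedron_of_def)
  next
    case False
    have "wt w u \<le> worder w T" using worder_attained[OF False] u(4) by metis
    moreover have "real_pt p \<in> polyhedron_of T" using real_pt_in_polyhedron[OF that] assms by blast
    then have "real (worder w T) \<le> real_pt w \<bullet> real_pt p" by (rule polyhedron_of_ge[OF u(3)])
    ultimately show ?thesis by simp
  qed
  then show "u \<in> below S" using u unfolding below_def by blast
qed

lemma belowI:
  assumes "fst u > 0" "snd u > 0" "w \<in> weights" "\<forall>p\<in>S. wt w u \<le> wt w p"
  shows "u \<in> below S"
  unfolding below_def using assms by blast

lemma coeff2_completion:
  fixes f :: "'a::field fps2"
  shows "coeff2 (completion m f) i j =
     coeff2 f i j + (if (i, j) = (m, 0) then 1 else 0) + (if (i, j) = (0, m) then 1 else 0)"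
proof -
  have one: "coeff2 (1 :: 'a fps2) i j = (if i = 0 \<and> j = 0 then 1 else 0)" for i j
    by (simp add: coeff2_def)
  have "coeff2 (varx ^ m :: 'a fps2) i j = (if (i, j) = (m, 0) then 1 else 0)"
    using coeff2_varx_power_mult[of m "1 :: 'a fps2" i j] unfolding one by auto
  moreover have "coeff2 (vary ^ m :: 'a fps2) i j = (if (i, j) = (0, m) then 1 else 0)"
    using coeff2_vary_power_mult[of m "1 :: 'a fps2" i j] unfolding one by auto
  ultimately show ?thesis unfolding completion_def by (simp add: coeff2_def)
qed

text \<open>Monotonicity bounds the value at every admissible m. The bound is reached because only
  finitely many points are counted, and one large m preserves a witnessing weight for each of
  them.\<close>

lemma delta_N_eq:
  fixes f :: "'a::field fps2"
  assumes "thin (supp f)"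
  shows "delta_N f = ereal (card (below (supp f)))"
proof (cases "convenient f")
  case True
  then show ?thesis using delta_N_convenient_eq[of f] convenient_iff[of f] by (simp add: delta_N_def)
next
  case False
  let ?S = "supp f"
  let ?g = "\<lambda>m. completion m f"
  let ?M = "{m. newton_polyhedron f \<subseteq> newton_polyhedron (?g m) \<and> convenient (?g m)}"
  have fin: "finite (below ?S)" by (rule finite_below[OF assms])
  have le: "delta_N_convenient (?g m) \<le> card (below ?S)" if "m \<in> ?M" for m
    using that delta_N_convenient_eq[of "?g m"] below_antimono[of ?S "supp (?g m)"]
      card_mono[OF fin, of "below (supp (?g m))"]
    by (simp add: convenient_iff newton_polyhedron_eq)
  have "\<forall>u\<in>below ?S. \<exists>w. w \<in> weights \<and> (\<forall>p\<in>?S. wt w u \<le> wt w p)"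
    unfolding below_def by blast
  then obtain w where w: "\<And>u. u \<in> below ?S \<Longrightarrow> w u \<in> weights \<and> (\<forall>p\<in>?S. wt (w u) u \<le> wt (w u) p)"
    by metis
  \<comment> \<open>m exceeds the weight of every counted point, so the new exponents (m, 0) and (0,
    m) respect all witnesses. Being larger than the axis ends protects these from cancellation, and
    m > 0 keeps the two monomials distinct. For an axis without exponents the end is an unspecified
    number and harmless here.\<close>
  define m where "m = (\<Sum>u\<in>below ?S. wt (w u) u) + x_end ?S + y_end ?S + 1"
  have m: "wt (w u) u \<le> m" if "u \<in> below ?S" for u
    using member_le_sum[OF that, of "\<lambda>u. wt (w u) u"] fin by (simp add: m_def)
  have mx: "m > x_end ?S" "m > y_end ?S" "m > 0" by (auto simp: m_def)
  have supp_g: "p \<in> supp (?g m) \<longleftrightarrow> p \<in> ?S" if "p \<noteq> (m, 0)" "p \<noteq> (0, m)" for p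
    using that by (cases p) (auto simp: supp_def coeff2_completion)
  have xe: "(x_end ?S, 0) \<in> supp (?g m)" if "(m, 0) \<in> ?S"
  proof -
    have "(x_end ?S, 0) \<in> ?S" unfolding x_end_def using that by (rule LeastI)
    then show ?thesis using supp_g[of "(x_end ?S, 0)"] mx by simp
  qed
  have ye: "(0, y_end ?S) \<in> supp (?g m)" if "(0, m) \<in> ?S"
  proof -
    have "(0, y_end ?S) \<in> ?S" unfolding y_end_def using that by (rule LeastI)
    then show ?thesis using supp_g[of "(0, y_end ?S)"] mx by simp
  qed
  have "(m, 0) \<in> ?S \<or> (m, 0) \<in> supp (?g m)" "(0, m) \<in> ?S \<or> (0, m) \<in> supp (?g m)"
    using mx(3) by (simp_all add: supp_def coeff2_completion)
  then have conv: "meets_axes (supp (?g m))" using xe ye unfolding meets_axes_def by blast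
  have "real_pt p \<in> polyhedron_of (supp (?g m))" if p: "p \<in> ?S" for p
  proof -
    consider "p = (m, 0)" | "p = (0, m)" | "p \<in> supp (?g m)" using supp_g p by blast
    then show ?thesis
    proof cases
      case 1
      then have "real_pt p = real_pt (x_end ?S, 0) + (real (m - x_end ?S), 0)"
        using mx by (simp add: real_pt_def of_nat_diff)
      moreover have "(m, 0) \<in> ?S" using p 1 by (simp only:)
      then have "real_pt (x_end ?S, 0) + (real (m - x_end ?S), 0) \<in> polyhedron_of (supp (?g m))"
        by (intro polyhedron_of_add real_pt_in_polyhedron xe) simp_all
      ultimately show ?thesis by (simp only:)
    next
      case 2
      then have "real_pt p = real_pt (0, y_end ?S) + (0, real (m - y_end ?S))"
        using mx by (simp add: real_pt_def of_nat_diff)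
      moreover have "(0, m) \<in> ?S" using p 2 by (simp only:)
      then have "real_pt (0, y_end ?S) + (0, real (m - y_end ?S)) \<in> polyhedron_of (supp (?g m))"
        by (intro polyhedron_of_add real_pt_in_polyhedron ye) simp_all
      ultimately show ?thesis by (simp only:)
    qed (rule real_pt_in_polyhedron)
  qed
  then have "polyhedron_of ?S \<subseteq> polyhedron_of (supp (?g m))"
    by (intro polyhedron_of_subset convex_polyhedron_of polyhedron_of_add)
  then have mM: "m \<in> ?M" using conv by (simp add: convenient_iff newton_polyhedron_eq)
  have "below ?S \<subseteq> below (supp (?g m))"
  proof
    fix u assume u: "u \<in> below ?S"
    then have u0: "fst u > 0" "snd u > 0" by (simp_all add: below_def)
    have ww: "fst (w u) > 0" "snd (w u) > 0" using w[OF u] by (auto simp: weights_def)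
    have "wt (w u) u \<le> wt (w u) p" if pg: "p \<in> supp (?g m)" for p
    proof -
      have mm: "m \<le> fst (w u) * m" "m \<le> snd (w u) * m" using ww by auto
      consider "p = (m, 0)" | "p = (0, m)" | "p \<in> ?S" using supp_g pg by blast
      then show ?thesis
      proof cases
        case 1
        then show ?thesis using le_trans[OF m[OF u] mm(1)] by (cases "w u") simp
      next
        case 2
        then show ?thesis using le_trans[OF m[OF u] mm(2)] by (cases "w u") simp
      next
        case 3
        then show ?thesis using w[OF u] by blast
      qed
    qed
    then have "\<forall>p\<in>supp (?g m). wt (w u) u \<le> wt (w u) p" by (rule ballI)
    then show "u \<in> below (supp (?g m))" using belowI[OF u0] w[OF u] by blast
  qed
  then have "card (below ?S) \<le> card (below (supp (?g m)))"
    using finite_below[OF meets_axes_thin[OF conv]] card_mono by blast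
  then have ge: "real (card (below ?S)) \<le> delta_N_convenient (?g m)"
    using delta_N_convenient_eq[OF conv] by simp
  have "(SUP m\<in>?M. ereal (delta_N_convenient (?g m))) = ereal (card (below ?S))"
  proof (rule antisym)
    show "(SUP m\<in>?M. ereal (delta_N_convenient (?g m))) \<le> ereal (card (below ?S))"
      using le by (intro SUP_least) simp
    show "ereal (card (below ?S)) \<le> (SUP m\<in>?M. ereal (delta_N_convenient (?g m)))"
      using mM ge by (intro SUP_upper2[of m]) auto
  qed
  then show ?thesis using False by (simp add: delta_N_def)
qed

section \<open>Non-degeneracy along a weight\<close>

text \<open>With \<open>g p = z powi k p\<close> this is the value at z of the dehomogenized part of
  degree l; an additional factor \<open>k p\<close> turns it into the value of the Euler derivative
  z d/dz.\<close>

definition line_sum :: "'a::field fps2 \<Rightarrow> nat \<times> nat \<Rightarrow> nat \<Rightarrow> (nat \<times> nat \<Rightarrow> 'a) \<Rightarrow> 'a" where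
  "line_sum f w l g = (\<Sum>p\<in>{p. wt w p = l}. coeff2 f (fst p) (snd p) * g p)"

text \<open>If \<open>k\<close> enumerates the points of each line \<open>wt w p = l\<close> consecutively, then \<open>\<Sum>c\<^sub>p T\<^bsup>k p\<^esup>\<close> is the
  dehomogenization of a weighted homogeneous part. Degeneracy at \<open>z\<close> says that \<open>z\<close> is a multiple
  root of the lowest part and a root of the next one.\<close>

definition degenerate :: "'a::field fps2 \<Rightarrow> nat \<times> nat \<Rightarrow> 'a \<Rightarrow> (nat \<times> nat \<Rightarrow> int) \<Rightarrow> bool" where
  "degenerate f w z k \<longleftrightarrow>
     line_sum f w (worder w (supp f)) (\<lambda>p. z powi k p) = 0 \<and>
     line_sum f w (worder w (supp f)) (\<lambda>p. of_int (k p) * z powi k p) = 0 \<and>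
     line_sum f w (worder w (supp f) + 1) (\<lambda>p. z powi k p) = 0"

text \<open>The condition on \<open>\<alpha>\<close> and \<open>\<beta>\<close> makes the index increase by one in the primitive direction
  \<open>(- snd w, fst w)\<close> of the lines; all such indices are treated alike, which makes the definition
  symmetric in the coordinates.\<close>

definition nondegenerate :: "'a::field fps2 \<Rightarrow> nat \<times> nat \<Rightarrow> bool" where
  "nondegenerate f w \<longleftrightarrow> (\<forall>z \<alpha> \<beta>. z \<noteq> 0 \<longrightarrow> \<beta> * int (fst w) - \<alpha> * int (snd w) = 1 \<longrightarrow>
     \<not> degenerate f w z (\<lambda>p. \<alpha> * int (fst p) + \<beta> * int (snd p)))"

lemma line_sum_cong:
  assumes "\<And>p. wt w p = l \<Longrightarrow> g p = h p"
  shows "line_sum f w l g = line_sum f w l h"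
  unfolding line_sum_def using assms by (intro sum.cong) auto

lemma line_sum_mult: "line_sum f w l (\<lambda>p. c * g p) = c * line_sum f w l g"
  unfolding line_sum_def sum_distrib_left by (intro sum.cong) (auto simp: mult.left_commute)

lemma line_sum_add: "line_sum f w l (\<lambda>p. g p + h p) = line_sum f w l g + line_sum f w l h"
  unfolding line_sum_def by (simp add: distrib_left sum.distrib)

text \<open>A shift of the index multiplies a sum by the unit \<open>z powi c\<close>. The
  derivative also picks up c times the value, which vanishes by the first condition. The two lines
  may be shifted by different amounts.\<close>

lemma degenerate_shift:
  assumes "z \<noteq> 0"
    and "\<And>p. wt w p = worder w (supp f) \<Longrightarrow> k p = k' p + c"
    and "\<And>p. wt w p = worder w (supp f) + 1 \<Longrightarrow> k p = k' p + c'"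
  shows "degenerate f w z k \<longleftrightarrow> degenerate f w z k'"
proof -
  let ?d = "worder w (supp f)"
  have 1: "line_sum f w ?d (\<lambda>p. z powi k p) = z powi c * line_sum f w ?d (\<lambda>p. z powi k' p)"
    unfolding line_sum_mult[symmetric] using assms(1,2)
    by (intro line_sum_cong) (simp add: power_int_add mult.commute)
  have 3: "line_sum f w (?d + 1) (\<lambda>p. z powi k p) = z powi c' * line_sum f w (?d + 1) (\<lambda>p. z powi k' p)"
    unfolding line_sum_mult[symmetric] using assms(1,3)
    by (intro line_sum_cong) (simp add: power_int_add mult.commute)
  have 2: "line_sum f w ?d (\<lambda>p. of_int (k p) * z powi k p)
    = z powi c * (line_sum f w ?d (\<lambda>p. of_int (k' p) * z powi k' p)
        + of_int c * line_sum f w ?d (\<lambda>p. z powi k' p))"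
    unfolding line_sum_mult[symmetric] line_sum_add[symmetric] using assms(1,2)
    by (intro line_sum_cong) (simp add: power_int_add algebra_simps)
  show ?thesis unfolding degenerate_def 1 2 3 using assms(1) by auto
qed

text \<open>If a k = \<alpha> l + j, then k - j div a is (j mod a + \<alpha> l) / a, and j mod a
  depends on l alone. So all admissible indices agree up to a constant on each line.\<close>

lemma bezout_index:
  assumes "w \<in> weights" "\<beta> * int (fst w) - \<alpha> * int (snd w) = 1" "wt w p = l"
  shows "\<alpha> * int (fst p) + \<beta> * int (snd p)
    = int (snd p div fst w) + (((- \<alpha> * int l) mod int (fst w)) + \<alpha> * int l) div int (fst w)"
proof -
  let ?a = "int (fst w)" and ?b = "int (snd w)" and ?i = "int (fst p)" and ?j = "int (snd p)"
  let ?k = "\<alpha> * ?i + \<beta> * ?j"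
  have a: "?a > 0" using assms(1) by (simp add: weights_def)
  have l: "int l = ?a * ?i + ?b * ?j" using assms(3) by (auto simp: wt_def)
  have "?a * ?k = \<alpha> * int l + ?j * (\<beta> * ?a - \<alpha> * ?b)" unfolding l by (simp add: algebra_simps)
  then have ak: "?a * ?k = \<alpha> * int l + ?j" using assms(2) by simp
  have "?j = - \<alpha> * int l + ?a * ?k" using ak by simp
  then have "?j mod ?a = (- \<alpha> * int l) mod ?a" by (metis mod_mult_self2)
  moreover have "?a * (?k - ?j div ?a) = \<alpha> * int l + ?j mod ?a"
    using ak mult_div_mod_eq[of ?a ?j] by (simp add: algebra_simps)
  then have "?k - ?j div ?a = (?j mod ?a + \<alpha> * int l) div ?a"
    using a by (metis add.commute less_irrefl nonzero_mult_div_cancel_left)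
  ultimately show ?thesis by (simp add: zdiv_int)
qed

text \<open>The index \<open>snd p div fst w\<close> is a natural number, which makes honest
  polynomials available; the form quantified over \<alpha> and \<beta> is the one that follows
  coordinate changes.\<close>

lemma nondegenerate_iff:
  assumes "w \<in> weights"
  shows "nondegenerate f w \<longleftrightarrow> (\<forall>z. z \<noteq> 0 \<longrightarrow> \<not> degenerate f w z (\<lambda>p. int (snd p div fst w)))"
proof -
  have eq: "degenerate f w z (\<lambda>p. \<alpha> * int (fst p) + \<beta> * int (snd p))
      \<longleftrightarrow> degenerate f w z (\<lambda>p. int (snd p div fst w))"
    if "z \<noteq> 0" "\<beta> * int (fst w) - \<alpha> * int (snd w) = 1" for z \<alpha> \<beta>
    using that(1) by (rule degenerate_shift) (rule bezout_index[OF assms that(2)], assumption)+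
  have "coprime (int (fst w)) (int (snd w))" using assms by (simp add: weights_def)
  then obtain u v where "u * int (fst w) + v * int (snd w) = 1"
    by (metis bezout_int coprime_imp_gcd_eq_1)
  then have "u * int (fst w) - (- v) * int (snd w) = 1" by simp
  then show ?thesis unfolding nondegenerate_def using eq by blast
qed

subsection \<open>Behaviour under blowing up\<close>

lemma line_sum_supp:
  assumes "w \<in> weights"
  shows "line_sum f w l g = (\<Sum>p\<in>{p \<in> supp f. wt w p = l}. coeff2 f (fst p) (snd p) * g p)"
  unfolding line_sum_def
  by (rule sum.mono_neutral_right) (use finite_wt_eq[OF assms] in \<open>auto simp: supp_def\<close>)

lemma Collect_mem_image:
  "(\<And>x. x \<in> A \<Longrightarrow> P (F x) \<longleftrightarrow> R x) \<Longrightarrow> {y \<in> F ` A. P y} = F ` {x \<in> A. R x}"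
  by auto

lemma line_sum_blow:
  assumes "(a, b) \<in> weights" "supp g = blow (supp f)"
    and "\<And>p. p \<in> supp f \<Longrightarrow>
      coeff2 g (fst (blow_pt (mult (supp f)) p)) (snd (blow_pt (mult (supp f)) p)) = coeff2 f (fst p) (snd p)"
  shows "line_sum f (a, a + b) (l + a * mult (supp f)) (\<lambda>p. h (blow_pt (mult (supp f)) p))
    = line_sum g (a, b) l h"
proof -
  let ?m = "mult (supp f)" and ?S = "supp f"
  have w: "(a, a + b) \<in> weights" using assms(1) weights_add_iff[of b a] by (simp add: weights_def)
  have wtb: "wt (a, b) (blow_pt ?m p) = l \<longleftrightarrow> wt (a, a + b) p = l + a * ?m" if "p \<in> ?S" for p
    using wt_blow_pt[OF mult_le[OF that], of a b] by simp
  have "{q \<in> supp g. wt (a, b) q = l} = blow_pt ?m ` {p \<in> ?S. wt (a, a + b) p = l + a * ?m}"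
    unfolding assms(2) blow_def using wtb by (rule Collect_mem_image)
  moreover have "inj_on (blow_pt ?m) {p \<in> ?S. wt (a, a + b) p = l + a * ?m}"
    by (rule inj_on_subset[OF inj_blow_pt]) (use mult_le in auto)
  ultimately have "line_sum g (a, b) l h = (\<Sum>p\<in>{p \<in> ?S. wt (a, a + b) p = l + a * ?m}.
      coeff2 g (fst (blow_pt ?m p)) (snd (blow_pt ?m p)) * h (blow_pt ?m p))"
    unfolding line_sum_supp[OF assms(1)] by (simp add: sum.reindex)
  also have "\<dots> = line_sum f (a, a + b) (l + a * ?m) (\<lambda>p. h (blow_pt ?m p))"
    unfolding line_sum_supp[OF w] by (rule sum.cong) (simp_all only: assms(3) mem_Collect_eq)
  finally show ?thesis ..
qed

text \<open>The index pulls back by \<alpha> i + (\<alpha> + \<beta>) j = \<alpha> (i + j - m) +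
  \<beta> j + \<alpha> m, a shift by a constant, and (\<alpha> + \<beta>) a - \<alpha> (a + b) =
  \<beta> a - \<alpha> b preserves the Bezout condition.\<close>

lemma nondegenerate_blow:
  assumes "(a, b) \<in> weights" "supp g = blow (supp f)" "supp f \<noteq> {}"
    and "\<And>p. p \<in> supp f \<Longrightarrow>
      coeff2 g (fst (blow_pt (mult (supp f)) p)) (snd (blow_pt (mult (supp f)) p)) = coeff2 f (fst p) (snd p)"
  shows "nondegenerate f (a, a + b) \<longleftrightarrow> nondegenerate g (a, b)"
proof -
  let ?m = "mult (supp f)" and ?S = "supp f"
  have w: "(a, a + b) \<in> weights" using assms(1) weights_add_iff[of b a] by (simp add: weights_def)
  have wo: "worder (a, a + b) ?S = worder (a, b) (supp g) + a * ?m"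
    using worder_blow[OF assms(3)] by (simp add: assms(2))
  have deg: "degenerate g (a, b) z h \<longleftrightarrow> degenerate f (a, a + b) z (\<lambda>p. h (blow_pt ?m p))" for z h
  proof -
    have wo1: "worder (a, a + b) ?S + 1 = (worder (a, b) (supp g) + 1) + a * ?m" using wo by simp
    show ?thesis unfolding degenerate_def wo1 unfolding wo
      by (simp only: line_sum_blow[OF assms(1,2,4), symmetric])
  qed
  have key: "degenerate f (a, a + b) z (\<lambda>p. \<alpha> * int (fst p) + (\<alpha> + \<beta>) * int (snd p))
      \<longleftrightarrow> degenerate g (a, b) z (\<lambda>p. \<alpha> * int (fst p) + \<beta> * int (snd p))" if "z \<noteq> 0" for z \<alpha> \<beta>
  proof -
    let ?k = "\<lambda>p. \<alpha> * int (fst p) + (\<alpha> + \<beta>) * int (snd p)"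
    let ?k' = "\<lambda>p. \<alpha> * int (fst (blow_pt ?m p)) + \<beta> * int (snd (blow_pt ?m p))"
    have eq: "?k p = ?k' p + \<alpha> * int ?m" if "p \<in> ?S" for p
      using mult_le[OF that] by (simp add: blow_pt_def of_nat_diff algebra_simps)
    have sums: "line_sum f (a, a + b) l (\<lambda>p. G (?k p)) = line_sum f (a, a + b) l (\<lambda>p. G (?k' p + \<alpha> * int ?m))" for l G
      unfolding line_sum_supp[OF w] by (rule sum.cong) (simp_all only: eq mem_Collect_eq)
    have "degenerate f (a, a + b) z ?k \<longleftrightarrow> degenerate f (a, a + b) z (\<lambda>p. ?k' p + \<alpha> * int ?m)"
      unfolding degenerate_def
      by (simp only: sums[of _ "\<lambda>k. z powi k"] sums[of _ "\<lambda>k. of_int k * z powi k"])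
    also have "\<dots> \<longleftrightarrow> degenerate f (a, a + b) z ?k'"
      using that by (rule degenerate_shift) simp_all
    also have "\<dots> \<longleftrightarrow> degenerate g (a, b) z (\<lambda>p. \<alpha> * int (fst p) + \<beta> * int (snd p))"
      unfolding deg ..
    finally show ?thesis .
  qed
  show ?thesis
  proof
    assume f: "nondegenerate f (a, a + b)"
    show "nondegenerate g (a, b)"
      unfolding nondegenerate_def
    proof (intro allI impI)
      fix z :: 'a and \<alpha> \<beta> :: int
      assume z: "z \<noteq> 0" and "\<beta> * int (fst (a, b)) - \<alpha> * int (snd (a, b)) = 1"
      then have "(\<alpha> + \<beta>) * int (fst (a, a + b)) - \<alpha> * int (snd (a, a + b)) = 1"
        by (simp add: algebra_simps)
      then show "\<not> degenerate g (a, b) z (\<lambda>p. \<alpha> * int (fst p) + \<beta> * int (snd p))"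
        using f z unfolding nondegenerate_def key[OF z, symmetric] by blast
    qed
  next
    assume g: "nondegenerate g (a, b)"
    show "nondegenerate f (a, a + b)"
      unfolding nondegenerate_def
    proof (intro allI impI)
      fix z :: 'a and \<alpha> \<beta> :: int
      assume z: "z \<noteq> 0" and "\<beta> * int (fst (a, a + b)) - \<alpha> * int (snd (a, a + b)) = 1"
      then have "(\<beta> - \<alpha>) * int (fst (a, b)) - \<alpha> * int (snd (a, b)) = 1"
        by (simp add: algebra_simps)
      then have "\<not> degenerate g (a, b) z (\<lambda>p. \<alpha> * int (fst p) + (\<beta> - \<alpha>) * int (snd p))"
        using g z unfolding nondegenerate_def by blast
      then show "\<not> degenerate f (a, a + b) z (\<lambda>p. \<alpha> * int (fst p) + \<beta> * int (snd p))"
        using key[OF z, of \<alpha> "\<beta> - \<alpha>"] by simp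
    qed
  qed
qed

section \<open>Exchanging the two variables\<close>

definition transpose2 :: "'a::field fps2 \<Rightarrow> 'a fps2" where
  "transpose2 f = Abs_fps2 (\<lambda>i j. coeff2 f j i)"

lemma coeff2_transpose2 [simp]: "coeff2 (transpose2 f) i j = coeff2 f j i"
  by (simp add: transpose2_def)

lemma transpose2_transpose2 [simp]: "transpose2 (transpose2 f) = f"
  by (rule fps2_eqI) simp

lemma supp_transpose2: "supp (transpose2 f) = prod.swap ` supp f"
  by (force simp: supp_def)

lemma line_sum_transpose2:
  "line_sum (transpose2 f) (prod.swap w) l g = line_sum f w l (\<lambda>p. g (prod.swap p))"
proof -
  have "{p. wt (prod.swap w) p = l} = prod.swap ` {p. wt w p = l}"
  proof (intro set_eqI)
    fix p :: "nat \<times> nat"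
    have "wt (prod.swap w) p = wt w (prod.swap p)" by (metis wt_swap swap_swap)
    then show "p \<in> {p. wt (prod.swap w) p = l} \<longleftrightarrow> p \<in> prod.swap ` {p. wt w p = l}"
      by (auto intro: image_eqI[of _ _ "prod.swap p"])
  qed
  then show ?thesis unfolding line_sum_def by (simp add: sum.reindex)
qed

text \<open>The exchange reverses the direction of the lines, so the index changes sign and z
  becomes \<open>inverse z\<close>. Integer indices are what allow this.\<close>

lemma nondegenerate_transpose2_imp:
  assumes "nondegenerate f w"
  shows "nondegenerate (transpose2 f) (prod.swap w)"
  unfolding nondegenerate_def
proof (intro allI impI notI)
  fix z :: 'a and \<alpha> \<beta> :: int
  assume z: "z \<noteq> 0" and ab: "\<beta> * int (fst (prod.swap w)) - \<alpha> * int (snd (prod.swap w)) = 1"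
    and deg: "degenerate (transpose2 f) (prod.swap w) z (\<lambda>p. \<alpha> * int (fst p) + \<beta> * int (snd p))"
  let ?d = "worder w (supp f)"
  let ?k = "\<lambda>p::nat \<times> nat. \<alpha> * int (snd p) + \<beta> * int (fst p)"
  let ?k' = "\<lambda>p::nat \<times> nat. (- \<beta>) * int (fst p) + (- \<alpha>) * int (snd p)"
  have k': "?k' p = - ?k p" for p by simp
  have pw: "inverse z powi ?k' p = z powi ?k p" for p
    unfolding k' by (simp only: power_int_minus power_int_inverse inverse_inverse_eq)
  have d: "line_sum f w ?d (\<lambda>p. z powi ?k p) = 0" "line_sum f w ?d (\<lambda>p. of_int (?k p) * z powi ?k p) = 0"
    "line_sum f w (?d + 1) (\<lambda>p. z powi ?k p) = 0"
    using deg unfolding degenerate_def line_sum_transpose2 supp_transpose2 worder_swap by simp_all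
  have "line_sum f w ?d (\<lambda>p. of_int (?k' p) * z powi ?k p)
      = (- 1) * line_sum f w ?d (\<lambda>p. of_int (?k p) * z powi ?k p)"
    unfolding line_sum_mult[symmetric] by (rule line_sum_cong) (simp add: algebra_simps)
  then have "degenerate f w (inverse z) ?k'"
    unfolding degenerate_def pw using d by simp
  moreover have "(- \<alpha>) * int (fst w) - (- \<beta>) * int (snd w) = 1" using ab by simp
  ultimately show False using assms z unfolding nondegenerate_def by (metis inverse_nonzero_iff_nonzero)
qed

lemma nondegenerate_transpose2:
  "nondegenerate (transpose2 f) (prod.swap w) \<longleftrightarrow> nondegenerate f w"
  using nondegenerate_transpose2_imp[of f w] nondegenerate_transpose2_imp[of "transpose2 f" "prod.swap w"]
  by auto

subsection \<open>Weighted homogeneous polynomials in two variables\<close>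

lemma coeff2_sum: "coeff2 (\<Sum>k\<in>A. g k) i j = (\<Sum>k\<in>A. coeff2 (g k) i j)"
  by (simp add: coeff2_def fps_sum_nth)

lemma coeff2_diff: "coeff2 (f - g) i j = coeff2 f i j - coeff2 g i j"
  by (simp add: coeff2_def)

lemma coeff2_zero [simp]: "coeff2 0 i j = 0"
  by (simp add: coeff2_def)

lemma coeff2_const2_mult: "coeff2 (const2 c * f) i j = c * coeff2 f i j"
  by (simp add: coeff2_def const2_def)

lemma const2_simps [simp]: "const2 0 = 0" "const2 1 = 1" "const2 (a * b) = const2 a * const2 b"
  "const2 (a + b) = const2 a + const2 b" "const2 (- a) = - const2 a"
  by (simp_all add: const2_def flip: fps_const_neg)

lemma coeff2_monomial:
  "coeff2 (const2 c * varx ^ a * vary ^ b) i j = (if i = a \<and> j = b then c else 0)"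
proof -
  have eq: "const2 c * varx ^ a * vary ^ b = varx ^ a * (vary ^ b * const2 c)" by (simp add: mult_ac)
  have "coeff2 (const2 c) i j = (if i = 0 \<and> j = 0 then c else 0)" for i j
    by (simp add: coeff2_def const2_def)
  then show ?thesis unfolding eq coeff2_varx_power_mult coeff2_vary_power_mult by auto
qed

text \<open>N is a formal degree: its surplus over the degree of Q appears as a power of
  \<open>varx ^ snd w\<close>.\<close>

definition homogenize :: "nat \<times> nat \<Rightarrow> nat \<Rightarrow> 'a::field poly \<Rightarrow> 'a fps2" where
  "homogenize w N Q =
     (\<Sum>k\<le>N. const2 (coeff Q k) * (varx ^ snd w) ^ (N - k) * (vary ^ fst w) ^ k)"

lemma homogenize_linear_mult:
  assumes "degree R \<le> M"
  shows "homogenize w (Suc M) ([:u, v:] * R)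
    = (const2 u * varx ^ snd w + const2 v * vary ^ fst w) * homogenize w M R"
proof -
  let ?X = "varx ^ snd w :: 'a fps2" and ?Y = "vary ^ fst w :: 'a fps2"
  have c0: "coeff R (Suc M) = 0" using assms by (intro coeff_eq_0) simp
  have X: "?X * ?X ^ (M - k) = ?X ^ (Suc M - k)" if "k \<le> M" for k
    using that by (simp add: Suc_diff_le)
  have "homogenize w (Suc M) ([:u, v:] * R)
    = (\<Sum>k\<le>Suc M. const2 u * (const2 (coeff R k) * ?X ^ (Suc M - k) * ?Y ^ k))
      + (\<Sum>k\<le>Suc M. const2 v * (const2 (coeff (pCons 0 R) k) * ?X ^ (Suc M - k) * ?Y ^ k))"
    unfolding homogenize_def sum.distrib[symmetric]
    by (rule sum.cong) (auto simp: algebra_simps coeff_pCons split: nat.split)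
  also have "(\<Sum>k\<le>Suc M. const2 u * (const2 (coeff R k) * ?X ^ (Suc M - k) * ?Y ^ k))
      = const2 u * ?X * homogenize w M R"
    unfolding homogenize_def sum_distrib_left sum.atMost_Suc
    by (simp only: c0 const2_simps mult_zero_left mult_zero_right add_0_right)
      (rule sum.cong, auto simp: X[symmetric] mult_ac)
  also have "(\<Sum>k\<le>Suc M. const2 v * (const2 (coeff (pCons 0 R) k) * ?X ^ (Suc M - k) * ?Y ^ k))
      = const2 v * ?Y * homogenize w M R"
    unfolding homogenize_def sum_distrib_left sum.atMost_Suc_shift by (simp add: mult_ac)
  finally show ?thesis by (simp add: algebra_simps)
qed

lemma homogenize_Suc: "degree R \<le> M \<Longrightarrow> homogenize w (Suc M) R = varx ^ snd w * homogenize w M R"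
  using homogenize_linear_mult[of R M w 1 0] by simp

lemma homogenize_add: "degree R \<le> M \<Longrightarrow> homogenize w (e + M) R = (varx ^ snd w) ^ e * homogenize w M R"
  by (induction e) (simp_all add: homogenize_Suc mult_ac)

lemma homogenize_power_mult:
  assumes "degree R \<le> M"
  shows "homogenize w (e + M) ([:u, v:] ^ e * R)
    = (const2 u * varx ^ snd w + const2 v * vary ^ fst w) ^ e * homogenize w M R"
proof (induction e)
  case (Suc e)
  have "degree ([:u, v:] ^ e * R) \<le> degree ([:u, v:] ^ e) + degree R" by (rule degree_mult_le)
  also have "\<dots> \<le> e + M" using assms degree_power_le[of "[:u, v:]" e]
    by (intro add_mono) (auto intro: le_trans simp: degree_pCons_le)
  finally have "degree ([:u, v:] ^ e * R) \<le> e + M" .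
  then show ?case using homogenize_linear_mult[of "[:u, v:] ^ e * R" "e + M" w u v] Suc
    by (simp only: power_Suc mult.assoc add_Suc)
qed simp

text \<open>A binomial with coefficients a and b corresponds to the linear polynomial a - b T, whose
  root is a / b.\<close>

lemma homogenize_prod:
  assumes "finite I"
  shows "degree (\<Prod>i\<in>I. [:a i, - b i:] ^ r i) \<le> sum r I"
    and "homogenize w (sum r I) (\<Prod>i\<in>I. [:a i, - b i:] ^ r i)
      = (\<Prod>i\<in>I. binomial_factor (snd w) (fst w) (a i) (b i) ^ r i)"
  using assms
proof (induction I)
  case empty
  { case 1 show ?case by simp }
  { case 2 show ?case by (simp add: homogenize_def) }
next
  case (insert i I)
  {
    case 1
    have "degree (\<Prod>i\<in>insert i I. [:a i, - b i:] ^ r i)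
      \<le> degree ([:a i, - b i:] ^ r i) + degree (\<Prod>i\<in>I. [:a i, - b i:] ^ r i)"
      using insert.hyps by (simp add: degree_mult_le)
    also have "\<dots> \<le> r i + sum r I"
      using insert.IH(1) insert.hyps degree_power_le[of "[:a i, - b i:]" "r i"]
      by (intro add_mono) (auto intro: le_trans simp: degree_pCons_le)
    finally show ?case using insert.hyps by simp
  }
  {
    case 2
    show ?case using insert homogenize_power_mult[OF insert.IH(1), of w "r i" "a i" "- b i"]
      by (simp add: binomial_factor_def)
  }
qed

lemma homogenize_monomials:
  "varx ^ p * vary ^ q * homogenize w N Q
    = (\<Sum>k\<le>N. const2 (coeff Q k) * varx ^ (p + (N - k) * snd w) * vary ^ (q + k * fst w))"
  unfolding homogenize_def sum_distrib_left
  by (rule sum.cong) (simp_all add: power_add power_mult[symmetric] mult_ac)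

lemma coeff2_homogenize:
  "coeff2 (varx ^ p * vary ^ q * homogenize w N Q) i j
    = (\<Sum>k\<le>N. if i = p + (N - k) * snd w \<and> j = q + k * fst w then coeff Q k else 0)"
  unfolding homogenize_monomials coeff2_sum coeff2_monomial ..

lemma coeff2_homogenize_point:
  assumes "w \<in> weights" "k \<le> N"
  shows "coeff2 (varx ^ p * vary ^ q * homogenize w N Q) (p + (N - k) * snd w) (q + k * fst w) = coeff Q k"
proof -
  have w0: "fst w > 0" using assms(1) by (simp add: weights_def)
  have "(\<Sum>k'\<le>N. if p + (N - k) * snd w = p + (N - k') * snd w \<and> q + k * fst w = q + k' * fst w
      then coeff Q k' else 0) = (\<Sum>k'\<le>N. if k' = k then coeff Q k' else 0)"
    using w0 by (intro sum.cong) auto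
  then show ?thesis unfolding coeff2_homogenize using assms(2) by simp
qed

text \<open>Reducing i0 modulo \<open>snd w\<close> and j0 modulo \<open>fst w\<close> leaves the
  largest common monomial of the line; the quotients count the primitive steps available beyond
  it.\<close>

lemma line_points:
  assumes "w \<in> weights"
  shows "wt w (i, j) = wt w (i0, j0) \<longleftrightarrow>
    (\<exists>k\<le>i0 div snd w + j0 div fst w. (i, j) =
      (i0 mod snd w + (i0 div snd w + j0 div fst w - k) * snd w, j0 mod fst w + k * fst w))"
proof -
  obtain a b where w: "w = (a, b)" by (cases w)
  have ab: "a > 0" "b > 0" "coprime a b" using assms by (auto simp: w weights_def)
  let ?N = "i0 div b + j0 div a"
  have n0: "i0 = i0 mod b + i0 div b * b" "j0 = j0 mod a + j0 div a * a" by simp_all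
  have eq0: "a * i0 + b * j0 = a * (i0 mod b) + b * (j0 mod a) + ?N * (a * b)"
  proof -
    have "a * i0 = a * (i0 mod b + i0 div b * b)" "b * j0 = b * (j0 mod a + j0 div a * a)"
      by (simp_all only: n0[symmetric])
    then show ?thesis by (simp only: algebra_simps)
  qed
  show ?thesis
  proof
    assume "\<exists>k\<le>i0 div snd w + j0 div fst w. (i, j) =
      (i0 mod snd w + (i0 div snd w + j0 div fst w - k) * snd w, j0 mod fst w + k * fst w)"
    then obtain k where k: "k \<le> ?N" "i = i0 mod b + (?N - k) * b" "j = j0 mod a + k * a" by (auto simp: w)
    obtain e where e: "?N = k + e" using k(1) le_Suc_ex by blast
    have "a * i + b * j = a * (i0 mod b) + b * (j0 mod a) + (k + e) * (a * b)"
      unfolding k(2,3) e by (simp add: algebra_simps)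
    then show "wt w (i, j) = wt w (i0, j0)" unfolding w wt_Pair eq0 e .
  next
    assume "wt w (i, j) = wt w (i0, j0)"
    then have eq: "a * i + b * j = a * i0 + b * j0" by (simp add: w)
    have "int a * (int i - int i0) = int b * (int j0 - int j)"
    proof -
      have "int (a * i + b * j) = int (a * i0 + b * j0)" using eq by simp
      then show ?thesis by (simp add: algebra_simps)
    qed
    then have "int a dvd int j0 - int j" "int b dvd int i - int i0"
      using ab by (metis coprime_dvd_mult_right_iff coprime_int_iff dvd_triv_left coprime_commute)+
    then have "int j0 mod int a = int j mod int a" "int i mod int b = int i0 mod int b"
      by (simp_all add: mod_eq_dvd_iff)
    then have "int (j mod a) = int (j0 mod a)" "int (i mod b) = int (i0 mod b)"
      by (simp_all add: of_nat_mod)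
    then have md: "j mod a = j0 mod a" "i mod b = i0 mod b" by simp_all
    have j: "j = j0 mod a + j div a * a" and i: "i = i0 mod b + i div b * b" unfolding md[symmetric] by simp_all
    have "a * i + b * j = a * (i0 mod b) + b * (j0 mod a) + (i div b + j div a) * (a * b)"
      by (subst i, subst j) (simp add: algebra_simps)
    then have "(i div b + j div a) * (a * b) = ?N * (a * b)" using eq eq0 by linarith
    then have "i div b + j div a = ?N" using ab by simp
    then have "j div a \<le> ?N" "i div b = ?N - j div a" by simp_all
    then show "\<exists>k\<le>i0 div snd w + j0 div fst w. (i, j) =
      (i0 mod snd w + (i0 div snd w + j0 div fst w - k) * snd w, j0 mod fst w + k * fst w)"
      using i j by (intro exI[of _ "j div a"]) (simp add: w)
  qed
qed

lemma coeff2_weighted_part [simp]: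
  "coeff2 (weighted_part a b l f) i j = (if wt (a, b) (i, j) = l then coeff2 f i j else 0)"
  by (simp add: weighted_part_def)

text \<open>The bounds on p and q say that k = 0, ..., N runs through all lattice points of the
  line, including those with zero coefficient; the divisibility test below depends on this.\<close>

lemma weighted_part_homogenize:
  assumes "w \<in> weights" "wt w (i0, j0) = l"
  obtains p q N Q where "p < snd w" "q < fst w" "degree Q \<le> N"
    "weighted_part (fst w) (snd w) l f = varx ^ p * vary ^ q * homogenize w N Q"
proof -
  define p where "p = i0 mod snd w"
  define q where "q = j0 mod fst w"
  define N where "N = i0 div snd w + j0 div fst w"
  define Q where "Q = (\<Sum>k\<le>N. monom (coeff2 f (p + (N - k) * snd w) (q + k * fst w)) k)"
  have w0: "fst w > 0" "snd w > 0" using assms by (auto simp: weights_def)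
  have cQ: "coeff Q k = (if k \<le> N then coeff2 f (p + (N - k) * snd w) (q + k * fst w) else 0)" for k
    unfolding Q_def coeff_sum by (auto simp: sum.delta)
  have "degree Q \<le> N" by (rule degree_le) (auto simp: cQ)
  have pts: "wt w (i, j) = l \<longleftrightarrow> (\<exists>k\<le>N. (i, j) = (p + (N - k) * snd w, q + k * fst w))" for i j
    using line_points[OF assms(1), of i j i0 j0] assms(2) by (simp add: p_def q_def N_def)
  have "weighted_part (fst w) (snd w) l f = varx ^ p * vary ^ q * homogenize w N Q"
  proof (rule fps2_eqI)
    fix i j
    show "coeff2 (weighted_part (fst w) (snd w) l f) i j = coeff2 (varx ^ p * vary ^ q * homogenize w N Q) i j"
    proof (cases "wt w (i, j) = l")
      case True
      then obtain k where k: "k \<le> N" "i = p + (N - k) * snd w" "j = q + k * fst w" using pts by auto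
      have "coeff2 (varx ^ p * vary ^ q * homogenize w N Q) i j = coeff Q k"
        unfolding k(2,3) using coeff2_homogenize_point[OF assms(1) k(1)] .
      then show ?thesis using True k by (simp add: cQ)
    next
      case False
      then have "\<not> (i = p + (N - k) * snd w \<and> j = q + k * fst w)" if "k \<le> N" for k
        using pts that by blast
      then have "coeff2 (varx ^ p * vary ^ q * homogenize w N Q) i j = 0"
        unfolding coeff2_homogenize by (intro sum.neutral) auto
      then show ?thesis using False by simp
    qed
  qed
  then show thesis using that[of p q Q N] w0 \<open>degree Q \<le> N\<close> by (simp add: p_def q_def)
qed

lemma line_sum_homogenize:
  assumes "w \<in> weights"
    and "weighted_part (fst w) (snd w) l f = varx ^ p * vary ^ q * homogenize w N Q"
  shows "line_sum f w l g = (\<Sum>k\<le>N. coeff Q k * g (p + (N - k) * snd w, q + k * fst w))"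
proof -
  let ?L = "{p. wt w p = l}"
  let ?pt = "\<lambda>k. (p + (N - k) * snd w, q + k * fst w)"
  have fin: "finite ?L" by (rule finite_wt_eq[OF assms(1)])
  have c: "coeff2 f (fst x) (snd x) = (\<Sum>k\<le>N. if x = ?pt k then coeff Q k else 0)" if "x \<in> ?L" for x
  proof -
    have "coeff2 f (fst x) (snd x) = coeff2 (weighted_part (fst w) (snd w) l f) (fst x) (snd x)"
      using that by simp
    then show ?thesis unfolding assms(2) coeff2_homogenize by (simp add: prod_eq_iff)
  qed
  have on: "?pt k \<in> ?L" if "k \<le> N" "coeff Q k \<noteq> 0" for k
  proof -
    have "coeff2 (weighted_part (fst w) (snd w) l f) (fst (?pt k)) (snd (?pt k)) \<noteq> 0"
      unfolding assms(2) using coeff2_homogenize_point[OF assms(1) that(1), of p q Q] that(2) by simp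
    then show ?thesis by (auto split: if_splits)
  qed
  have "line_sum f w l g = (\<Sum>x\<in>?L. \<Sum>k\<le>N. (if x = ?pt k then coeff Q k else 0) * g x)"
    unfolding line_sum_def by (rule sum.cong) (simp_all add: c sum_distrib_right)
  also have "\<dots> = (\<Sum>k\<le>N. \<Sum>x\<in>?L. (if x = ?pt k then coeff Q k * g x else 0))"
    by (subst sum.swap) (intro sum.cong, auto)
  also have "\<dots> = (\<Sum>k\<le>N. coeff Q k * g (?pt k))"
    using fin on by (intro sum.cong refl) (auto simp: sum.delta)
  finally show ?thesis .
qed

lemma poly_eq_sum_le:
  fixes Q :: "'a::field poly"
  assumes "degree Q \<le> N" shows "poly Q z = (\<Sum>k\<le>N. coeff Q k * z ^ k)"
  unfolding poly_altdef by (rule sum.mono_neutral_left) (use assms in \<open>auto simp: coeff_eq_0\<close>)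

lemma poly_pderiv_eq_sum_le:
  fixes z :: "'a::field"
  assumes "degree Q \<le> N" shows "z * poly (pderiv Q) z = (\<Sum>k\<le>N. coeff Q k * (of_nat k * z ^ k))"
proof -
  have "degree (pderiv Q) \<le> N"
    by (rule degree_le) (use assms in \<open>auto simp: coeff_pderiv coeff_eq_0\<close>)
  then have "z * poly (pderiv Q) z = (\<Sum>k\<le>N. z * (coeff (pderiv Q) k * z ^ k))"
    by (simp add: poly_eq_sum_le sum_distrib_left)
  also have "\<dots> = (\<Sum>k\<le>N. coeff Q (Suc k) * (of_nat (Suc k) * z ^ Suc k))"
    by (rule sum.cong) (auto simp: coeff_pderiv mult_ac)
  also have "\<dots> = (\<Sum>k\<le>Suc N. coeff Q k * (of_nat k * z ^ k))"
    by (subst sum.atMost_Suc_shift) simp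
  also have "\<dots> = (\<Sum>k\<le>N. coeff Q k * (of_nat k * z ^ k))"
    using assms by (simp add: coeff_eq_0)
  finally show ?thesis .
qed

lemma line_sum_root_iff:
  assumes "w \<in> weights" "z \<noteq> 0" "degree Q \<le> N"
    and "weighted_part (fst w) (snd w) l f = varx ^ p * vary ^ q * homogenize w N Q"
  shows "line_sum f w l (\<lambda>p. z powi int (snd p div fst w)) = 0 \<longleftrightarrow> poly Q z = 0"
    and "poly Q z = 0 \<Longrightarrow>
      line_sum f w l (\<lambda>p. of_int (int (snd p div fst w)) * z powi int (snd p div fst w)) = 0
        \<longleftrightarrow> poly (pderiv Q) z = 0"
proof -
  let ?c = "q div fst w"
  have idx: "(q + k * fst w) div fst w = ?c + k" for k using assms(1) by (simp add: weights_def)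
  have 1: "line_sum f w l (\<lambda>p. z powi int (snd p div fst w)) = z ^ ?c * poly Q z"
    unfolding line_sum_homogenize[OF assms(1,4)] poly_eq_sum_le[OF assms(3)] sum_distrib_left
    by (simp only: snd_conv idx power_int_of_nat power_add) (simp only: mult_ac)
  then show "line_sum f w l (\<lambda>p. z powi int (snd p div fst w)) = 0 \<longleftrightarrow> poly Q z = 0"
    using assms(2) by simp
  have "line_sum f w l (\<lambda>p. of_int (int (snd p div fst w)) * z powi int (snd p div fst w))
    = z ^ ?c * (z * poly (pderiv Q) z + of_nat ?c * poly Q z)"
    unfolding line_sum_homogenize[OF assms(1,4)] poly_pderiv_eq_sum_le[OF assms(3)]
      poly_eq_sum_le[OF assms(3)] sum_distrib_left sum.distrib[symmetric]
    by (rule sum.cong) (simp_all only: snd_conv idx power_int_of_nat power_add of_int_of_nat_eq,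
      simp add: algebra_simps)
  then show "line_sum f w l (\<lambda>p. of_int (int (snd p div fst w)) * z powi int (snd p div fst w)) = 0
        \<longleftrightarrow> poly (pderiv Q) z = 0" if "poly Q z = 0"
    using assms(2) that by simp
qed

text \<open>One direction splits off a linear factor of Q. In the other the cofactor h is an
  arbitrary series, but only its coefficients H on one line matter: Q = (a - b T) H coefficientwise,
  and the value at a / b telescopes to 0.\<close>

lemma binomial_factor_dvd_homogenize:
  assumes "w \<in> weights" "a \<noteq> 0" "b \<noteq> 0" "p < snd w" "q < fst w" "degree Q \<le> N"
  shows "binomial_factor (snd w) (fst w) a b dvd varx ^ p * vary ^ q * homogenize w N Q
    \<longleftrightarrow> poly Q (a / b) = 0"
proof
  let ?B = "binomial_factor (snd w) (fst w) a b"
  assume "poly Q (a / b) = 0"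
  show "?B dvd varx ^ p * vary ^ q * homogenize w N Q"
  proof (cases "Q = 0")
    case True then show ?thesis by (simp add: homogenize_def)
  next
    case False
    obtain R where R: "Q = [:- (a / b), 1:] * R" using \<open>poly Q (a / b) = 0\<close> by (metis dvdE poly_eq_0_iff_dvd)
    then have "R \<noteq> 0" using False by auto
    then have "degree Q = Suc (degree R)" unfolding R by (subst degree_mult_eq) auto
    then obtain M where M: "N = Suc M" "degree R \<le> M" using assms(6) by (cases N) auto
    define R' where "R' = smult (- 1 / b) R"
    have "[:a, - b:] = smult (- b) [:- (a / b), 1:]" using assms(3) by simp
    then have "Q = [:a, - b:] * R'"
      unfolding R R'_def using assms(3) by (simp only: mult_smult_left mult_smult_right smult_smult) simp
    then have "homogenize w N Q = ?B * homogenize w M R'"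
      using homogenize_linear_mult[of R' M w a "- b"] M by (simp add: R'_def binomial_factor_def)
    then show ?thesis by simp
  qed
next
  let ?B = "binomial_factor (snd w) (fst w) a b"
  assume "?B dvd varx ^ p * vary ^ q * homogenize w N Q"
  then obtain h where h: "varx ^ p * vary ^ q * homogenize w N Q = ?B * h" by blast
  \<comment> \<open>One step fewer than in Q. At the ends k = 0 and k = N the missing neighbour
    contributes 0, because q < \<open>fst w\<close> and p < \<open>snd w\<close>.\<close>
  define H where "H k = coeff2 h (p + (N - 1 - k) * snd w) (q + k * fst w)" for k
  have cB: "coeff2 (?B * h) i j = a * (if i < snd w then 0 else coeff2 h (i - snd w) j)
      - b * (if j < fst w then 0 else coeff2 h i (j - fst w))" for i j
    unfolding binomial_factor_def left_diff_distrib coeff2_diff mult.assoc coeff2_const2_mult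
      coeff2_varx_power_mult coeff2_vary_power_mult ..
  have "coeff Q k = (if k < N then a * H k else 0) - (if 0 < k then b * H (k - 1) else 0)" if k: "k \<le> N" for k
  proof -
    have "coeff Q k = coeff2 (?B * h) (p + (N - k) * snd w) (q + k * fst w)"
      unfolding h[symmetric] by (rule coeff2_homogenize_point[OF assms(1) k, symmetric])
    also have "\<dots> = (if k < N then a * H k else 0) - (if 0 < k then b * H (k - 1) else 0)"
    proof -
      have "(if p + (N - k) * snd w < snd w then 0 else coeff2 h (p + (N - k) * snd w - snd w) (q + k * fst w))
        = (if k < N then H k else 0)"
      proof (cases "k < N")
        case True
        then obtain e where "N = Suc (k + e)" using less_imp_Suc_add by blast
        then show ?thesis by (simp add: H_def)
      next
        case False then show ?thesis using k assms(4) by simp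
      qed
      moreover have "(if q + k * fst w < fst w then 0 else coeff2 h (p + (N - k) * snd w) (q + k * fst w - fst w))
        = (if 0 < k then H (k - 1) else 0)"
      proof (cases k)
        case 0 then show ?thesis using assms(5) by simp
      next
        case (Suc e)
        then have "N - 1 - e = N - k" by simp
        then show ?thesis using Suc by (simp add: H_def)
      qed
      ultimately show ?thesis unfolding cB by (simp only: if_distrib[of "(*) _"] mult_zero_right)
    qed
    finally show ?thesis .
  qed
  then have "poly Q (a / b) = (\<Sum>k\<le>N. ((if k < N then a * H k else 0)
      - (if 0 < k then b * H (k - 1) else 0)) * (a / b) ^ k)"
    unfolding poly_eq_sum_le[OF assms(6)] by (intro sum.cong) simp_all
  also have "\<dots> = (\<Sum>k\<le>N. if k < N then a * H k * (a / b) ^ k else 0)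
      - (\<Sum>k\<le>N. if 0 < k then b * H (k - 1) * (a / b) ^ k else 0)"
    unfolding sum_subtractf[symmetric] by (intro sum.cong) (auto simp: left_diff_distrib)
  also have "(\<Sum>k\<le>N. if k < N then a * H k * (a / b) ^ k else 0) = (\<Sum>k<N. a * H k * (a / b) ^ k)"
    by (rule sum.mono_neutral_cong_right) auto
  also have "(\<Sum>k\<le>N. if 0 < k then b * H (k - 1) * (a / b) ^ k else 0)
      = (\<Sum>k<N. b * H k * (a / b) ^ Suc k)"
  proof (cases N)
    case (Suc M)
    show ?thesis unfolding Suc sum.atMost_Suc_shift lessThan_Suc_atMost by simp
  qed simp
  also have "(\<Sum>k<N. b * H k * (a / b) ^ Suc k) = (\<Sum>k<N. a * H k * (a / b) ^ k)"
    using assms(3) by (intro sum.cong) simp_all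
  finally show "poly Q (a / b) = 0" by simp
qed

lemma binomial_factor_dvd_weighted_part:
  assumes "w \<in> weights" "a \<noteq> 0" "b \<noteq> 0"
  shows "binomial_factor (snd w) (fst w) a b dvd weighted_part (fst w) (snd w) l f
    \<longleftrightarrow> line_sum f w l (\<lambda>p. (a / b) powi int (snd p div fst w)) = 0"
proof (cases "\<exists>i j. wt w (i, j) = l")
  case True
  then obtain i j where "wt w (i, j) = l" by blast
  then obtain p q N Q where "p < snd w" "q < fst w" "degree Q \<le> N"
    "weighted_part (fst w) (snd w) l f = varx ^ p * vary ^ q * homogenize w N Q"
    by (rule weighted_part_homogenize[OF assms(1)])
  then show ?thesis using binomial_factor_dvd_homogenize[OF assms, of p q Q N]
      line_sum_root_iff(1)[OF assms(1), of "a / b" Q N l f p q] assms by simp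
next
  case False
  then have "weighted_part (fst w) (snd w) l f = 0" by (intro fps2_eqI) simp
  moreover have empty: "{p. wt w p = l} = {}" using False by auto
  ultimately show ?thesis unfolding line_sum_def empty by simp
qed

subsection \<open>Non-degeneracy along an edge\<close>

lemma weights_eqI:
  assumes "w \<in> weights" "w' \<in> weights" "wt w p = wt w q" "wt w' p = wt w' q" "p \<noteq> q"
  shows "w = w'"
proof -
  have "w = w'" if le: "snd p \<le> snd q" and e: "wt w p = wt w q" "wt w' p = wt w' q" and ne: "p \<noteq> q" for p q
  proof -
    obtain k where k: "snd q = snd p + k * fst w" "fst p = fst q + k * snd w"
      by (rule wt_eq_step[OF assms(1) e(1) le])
    obtain k' where k': "snd q = snd p + k' * fst w'" "fst p = fst q + k' * snd w'"
      by (rule wt_eq_step[OF assms(2) e(2) le])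
    have eq: "k * fst w = k' * fst w'" "k * snd w = k' * snd w'" using k k' by simp_all
    have "k \<noteq> 0" using k ne by (auto simp: prod_eq_iff)
    have "k * (fst w * snd w') = (k * fst w) * snd w'" by simp
    also have "\<dots> = (k * snd w) * fst w'" unfolding eq by simp
    finally have "fst w * snd w' = fst w' * snd w" using \<open>k \<noteq> 0\<close> by simp
    then have "fst w = fst w' \<and> snd w' = snd w"
      using coprime_crossproduct_nat[of "fst w" "snd w" "fst w'" "snd w'"] assms(1,2)
      by (auto simp: weights_def)
    then show ?thesis by (simp add: prod_eq_iff)
  qed
  then show ?thesis using assms(3-5) by (metis nat_le_linear)
qed

lemma mem_supp: "p \<in> supp f \<longleftrightarrow> coeff2 f (fst p) (snd p) \<noteq> 0"
  by (cases p) (simp add: supp_def)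

lemma edge_part_face_at:
  assumes "w \<in> weights"
  shows "edge_part (face_at w (supp f)) f = weighted_part (fst w) (snd w) (worder w (supp f)) f"
proof (rule fps2_eqI)
  fix i j
  have "(real i, real j) \<in> face_at w (supp f) \<longleftrightarrow> wt w (i, j) = worder w (supp f)"
    if "coeff2 f i j \<noteq> 0"
  proof -
    have "real_pt (i, j) \<in> polyhedron_of (supp f)"
      using that by (intro real_pt_in_polyhedron) (simp add: mem_supp)
    moreover have "real_pt w \<bullet> real_pt (i, j) = real (wt w (i, j))" by simp
    moreover have "real_pt (i, j) = (real i, real j)" by (simp add: real_pt_def)
    ultimately show ?thesis by (simp add: face_at_def del: real_pt_inner_real_pt wt_Pair)
  qed
  then show "coeff2 (edge_part (face_at w (supp f)) f) i j
      = coeff2 (weighted_part (fst w) (snd w) (worder w (supp f)) f) i j"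
    by (auto simp: edge_part_def)
qed

lemma weighted_order_eq:
  assumes "supp f \<noteq> {}" shows "weighted_order (fst w) (snd w) f = worder w (supp f)"
  unfolding weighted_order_def
proof (rule Least_equality)
  obtain p where p: "p \<in> supp f" "wt w p = worder w (supp f)" using worder_attained[OF assms] by blast
  then have "coeff2 (weighted_part (fst w) (snd w) (worder w (supp f)) f) (fst p) (snd p) \<noteq> 0"
    by (simp add: mem_supp del: wt_Pair)
  then show "weighted_part (fst w) (snd w) (worder w (supp f)) f \<noteq> 0" by (metis coeff2_zero)
next
  fix l assume "weighted_part (fst w) (snd w) l f \<noteq> 0"
  then have "\<not> (\<forall>i j. coeff2 (weighted_part (fst w) (snd w) l f) i j = coeff2 0 i j)"
    using fps2_eqI by blast
  then obtain i j where "coeff2 (weighted_part (fst w) (snd w) l f) i j \<noteq> 0" by auto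
  then have "wt w (i, j) = l" "(i, j) \<in> supp f" by (auto simp: mem_supp split: if_splits)
  then show "worder w (supp f) \<le> l" using worder_le by blast
qed

text \<open>The definition of a factorization does not tie its exponents to the edge. The edge part
  has two distinct monomials on a common line of both weights, which forces equality.\<close>

lemma edge_factorization_weight:
  assumes "w \<in> active (supp f)" "supp f \<noteq> {}" "w' \<in> weights"
    and "edge_part (face_at w (supp f)) f = varx ^ p * vary ^ q * homogenize w' N Q"
  shows "w' = w"
proof -
  have w: "w \<in> weights" "len w (supp f) > 0" using assms(1) by (auto simp: active_def)
  then obtain x y where xy: "x \<in> mface w (supp f)" "y \<in> mface w (supp f)" "x \<noteq> y"
    using len_pos_iff[OF w(1) assms(2)] by blast
  have "wt w' z = wt w' (p + N * snd w', q)" if zM: "z \<in> mface w (supp f)" for z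
  proof -
    have "coeff2 (varx ^ p * vary ^ q * homogenize w' N Q) (fst z) (snd z) \<noteq> 0"
      using zM unfolding assms(4)[symmetric] edge_part_face_at[OF w(1)]
      by (simp add: mface_def mem_supp del: wt_Pair)
    then have "\<exists>k\<le>N. fst z = p + (N - k) * snd w' \<and> snd z = q + k * fst w'"
      unfolding coeff2_homogenize by (rule contrapos_np) (intro sum.neutral, auto)
    then obtain k where k: "k \<le> N" "fst z = p + (N - k) * snd w'" "snd z = q + k * fst w'" by blast
    obtain e where "N = k + e" using k(1) le_Suc_ex by blast
    then show ?thesis using k by (simp add: wt_def algebra_simps)
  qed
  then have "wt w' x = wt w' y" using xy by simp
  moreover have "wt w x = wt w y" using xy by (simp add: mface_def)
  ultimately show ?thesis using weights_eqI[OF assms(3) w(1)] xy(3) by blast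
qed

lemma nondegenerate_not_active:
  assumes "w \<in> weights" "w \<notin> active (supp f)" "supp f \<noteq> {}"
  shows "nondegenerate f w"
proof -
  have "len w (supp f) = 0" using assms by (simp add: active_def)
  then have single: "p = q" if "p \<in> mface w (supp f)" "q \<in> mface w (supp f)" for p q
    using len_pos_iff[OF assms(1,3)] that by (metis less_irrefl)
  obtain p where p: "p \<in> mface w (supp f)" using mface_nonempty[OF assms(3)] by blast
  have "mface w (supp f) = {p}" using single p by blast
  then have "{q \<in> supp f. wt w q = worder w (supp f)} = {p}" by (simp add: mface_def)
  then have "line_sum f w (worder w (supp f)) g = coeff2 f (fst p) (snd p) * g p" for g
    unfolding line_sum_supp[OF assms(1)] by simp
  moreover have "coeff2 f (fst p) (snd p) \<noteq> 0" using p by (simp add: mface_def mem_supp)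
  ultimately show ?thesis unfolding nondegenerate_iff[OF assms(1)] degenerate_def by simp
qed

text \<open>The roots of the dehomogenized edge part give the binomials, with root multiplicities as
  exponents; a multiple root also annihilates the derivative, so it cannot be a root of the next
  part.\<close>

lemma nondegenerate_imp_WHND:
  fixes f :: "'a::alg_closed_field fps2"
  assumes w: "w \<in> active (supp f)" and ne: "supp f \<noteq> {}" and nd: "nondegenerate f w"
  shows "WHND_along f (face_at w (supp f))"
proof -
  have ww: "w \<in> weights" using w by (simp add: active_def)
  have w0: "fst w > 0" "snd w > 0" "coprime (fst w) (snd w)" using ww by (auto simp: weights_def)
  let ?d = "worder w (supp f)"
  obtain x where x: "x \<in> supp f" "wt w x = ?d" using worder_attained[OF ne] by blast
  obtain p q N Q where pq: "p < snd w" "q < fst w" "degree Q \<le> N"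
    and wp: "weighted_part (fst w) (snd w) ?d f = varx ^ p * vary ^ q * homogenize w N Q"
    by (rule weighted_part_homogenize[OF ww, of "fst x" "snd x" ?d f]) (use x in simp)
  have Q0: "Q \<noteq> 0"
  proof
    assume "Q = 0"
    then have "coeff2 (weighted_part (fst w) (snd w) ?d f) (fst x) (snd x) = 0"
      unfolding wp by (simp add: homogenize_def)
    then show False using x by (simp add: mem_supp)
  qed
  \<comment> \<open>The root 0 becomes a power of y and the surplus formal degree a power of x, so
    that R has only nonzero roots.\<close>
  define c where "c = order 0 Q"
  obtain R where R: "Q = [:0, 1:] ^ c * R" "\<not> [:0, 1:] dvd R"
    using order_decomp[OF Q0, of 0] by (auto simp: c_def)
  have R0: "R \<noteq> 0" "poly R 0 \<noteq> 0" using R(2) by (auto simp: poly_eq_0_iff_dvd)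
  define M where "M = degree R"
  have "degree Q = c + M" unfolding R(1) M_def using R0
    by (simp add: degree_mult_eq degree_power_eq)
  then obtain e where e: "N = e + (c + M)" using pq(3) by (metis add.commute le_Suc_ex)
  have "homogenize w N Q = (varx ^ snd w) ^ e * ((vary ^ fst w) ^ c * homogenize w M R)"
    using homogenize_add[of Q "c + M" w e] homogenize_power_mult[of R M w c 0 1] \<open>degree Q = c + M\<close>
    by (simp add: e M_def R(1)[symmetric])
  then have wpR: "weighted_part (fst w) (snd w) ?d f
      = varx ^ (p + snd w * e) * vary ^ (q + fst w * c) * homogenize w M R"
    unfolding wp by (simp add: power_add power_mult[symmetric] mult_ac)
  have root: "poly R z = 0 \<Longrightarrow> poly (pderiv R) z = 0 \<Longrightarrow> z \<noteq> 0 \<Longrightarrow>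
      line_sum f w (?d + 1) (\<lambda>p. z powi int (snd p div fst w)) \<noteq> 0" for z
    using nd line_sum_root_iff[OF ww _ _ wpR, of z] unfolding nondegenerate_iff[OF ww] degenerate_def M_def
    by auto
  obtain A where A: "R = smult (lead_coeff R) (\<Prod>x\<in>#A. [:- x, 1:])"
    using alg_closed_imp_factorization[OF R0(1)] by blast
  let ?Z = "set_mset A"
  have fin: "finite ?Z" by simp
  have fact: "R = smult (lead_coeff R) (\<Prod>z\<in>?Z. [:- z, 1:] ^ count A z)"
    using A unfolding image_prod_mset_multiplicity .
  have dvdR: "[:- z, 1:] ^ count A z dvd R" if "z \<in> ?Z" for z
    by (subst fact, rule dvd_smult, rule dvd_prodI[OF fin that])
  have Z0: "z \<noteq> 0" if "z \<in> ?Z" for z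
  proof -
    have "[:- z, 1:] dvd [:- z, 1:] ^ count A z" using that by (intro dvd_power) auto
    then have "poly R z = 0" using dvdR[OF that] unfolding poly_eq_0_iff_dvd by (rule dvd_trans)
    then show ?thesis using R0 by auto
  qed
  \<comment> \<open>A constant R would leave a single monomial on the edge. At least one factor is
    needed to absorb the leading coefficient.\<close>
  have Zne: "?Z \<noteq> {}"
  proof
    assume empty: "?Z = {}"
    have "smult (lead_coeff R) (\<Prod>z\<in>?Z. [:- z, 1:] ^ count A z) = smult (lead_coeff R) 1"
      by (simp only: empty prod.empty)
    with fact have "R = smult (lead_coeff R) 1" by (rule trans)
    then have "degree R = degree (smult (lead_coeff R) 1)" by (rule arg_cong)
    then have "M = 0" by (simp add: M_def)
    have wt1: "z = (p + snd w * e, q + fst w * c)" if "z \<in> mface w (supp f)" for z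
    proof -
      have "coeff2 (weighted_part (fst w) (snd w) ?d f) (fst z) (snd z) \<noteq> 0"
        using that by (simp add: mface_def mem_supp del: wt_Pair)
      then show ?thesis unfolding wpR coeff2_homogenize \<open>M = 0\<close> atMost_0
        by (simp add: prod_eq_iff split: if_splits)
    qed
    then have "len w (supp f) = 0" using len_pos_iff[OF ww ne] by (metis gr0I)
    then show False using w by (simp add: active_def)
  qed
  define s where "s = card ?Z"
  obtain h where h: "bij_betw h {1..s} ?Z" using ex_bij_betw_nat_finite_1[OF fin] unfolding s_def by blast
  have s0: "1 \<in> {1..s}" using Zne fin by (simp add: s_def Suc_le_eq card_gt_0_iff)
  have hz: "h i \<in> ?Z" if "i \<in> {1..s}" for i using h that by (auto simp: bij_betw_def)
  define r where "r i = count A (h i)" for i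
  have r0: "r i > 0" if "i \<in> {1..s}" for i
    using hz[OF that] by (simp add: r_def)
  \<comment> \<open>\<open>edge_factorization\<close> has no constant factor, so the leading
    coefficient enters the first binomial through a root of order \<open>r 1\<close>.\<close>
  obtain g where g: "g ^ r 1 = lead_coeff R" using nth_root_exists[OF r0[OF s0]] by blast
  have g0: "g \<noteq> 0" using g R0 r0[OF s0] by (auto simp: power_0_left)
  define b where "b i = (if i = 1 then - g else - 1)" for i :: nat
  define a where "a i = h i * b i" for i
  have b0: "b i \<noteq> 0" for i using g0 by (simp add: b_def)
  have ab: "a i \<noteq> 0" "a i / b i = h i" if "i \<in> {1..s}" for i using b0 Z0[OF hz[OF that]] by (auto simp: a_def)
  have lin: "[:a i, - b i:] = smult (- b i) [:- h i, 1:]" for i by (simp add: a_def mult.commute)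
  have Rprod: "R = (\<Prod>i\<in>{1..s}. [:a i, - b i:] ^ r i)"
  proof -
    have P1: "R = smult (lead_coeff R) (\<Prod>i\<in>{1..s}. [:- h i, 1:] ^ r i)"
      unfolding r_def prod.reindex_bij_betw[OF h, of "\<lambda>z. [:- z, 1:] ^ count A z"] by (rule fact)
    have P2: "(\<Prod>i\<in>{1..s}. [:a i, - b i:] ^ r i)
        = smult (\<Prod>i\<in>{1..s}. (- b i) ^ r i) (\<Prod>i\<in>{1..s}. [:- h i, 1:] ^ r i)"
      unfolding lin smult_power prod_smult ..
    have P3: "(\<Prod>i\<in>{1..s}. (- b i) ^ r i) = lead_coeff R"
    proof -
      have "(\<Prod>i\<in>{1..s}. (- b i) ^ r i) = (- b 1) ^ r 1 * (\<Prod>i\<in>{1..s} - {1}. (- b i) ^ r i)"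
        using s0 by (intro prod.remove) auto
      also have "(\<Prod>i\<in>{1..s} - {1}. (- b i) ^ r i) = 1" by (rule prod.neutral) (simp add: b_def)
      finally show ?thesis using g by (simp add: b_def)
    qed
    show ?thesis unfolding P2 P3 by (rule P1)
  qed
  have "M = sum r {1..s}"
  proof -
    have "degree (\<Prod>i\<in>{1..s}. [:a i, - b i:] ^ r i) = sum r {1..s}"
      using b0 by (subst degree_prod_eq_sum_degree) (auto simp: degree_power_eq)
    then show ?thesis unfolding M_def by (subst Rprod)
  qed
  then have hom: "homogenize w M R = (\<Prod>i\<in>{1..s}. binomial_factor (snd w) (fst w) (a i) (b i) ^ r i)"
    using homogenize_prod(2)[of "{1..s}" w r a b] unfolding Rprod[symmetric] by simp
  have "edge_factorization (face_at w (supp f)) f (snd w) (fst w) s a b r"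
    unfolding edge_factorization_def
  proof (intro conjI ballI impI)
    show "snd w > 0" "fst w > 0" "coprime (snd w) (fst w)" using w0 by (simp_all add: coprime_commute)
    show "a i \<noteq> 0" "b i \<noteq> 0" "r i > 0" if "i \<in> {1..s}" for i
      by (rule ab(1)[OF that] b0 r0[OF that])+
    show "a i * b j \<noteq> a j * b i" if "i \<in> {1..s}" "j \<in> {1..s}" "i \<noteq> j" for i j
    proof
      assume "a i * b j = a j * b i"
      then have "h i = h j" using b0[of i] b0[of j] by (simp add: a_def)
      then show False using h that unfolding bij_betw_def inj_on_def by blast
    qed
    show "\<exists>p q. edge_part (face_at w (supp f)) f = varx ^ p * vary ^ q *
        (\<Prod>i=1..s. binomial_factor (snd w) (fst w) (a i) (b i) ^ r i)"
      unfolding edge_part_face_at[OF ww] wpR hom by (intro exI) (rule refl)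
  qed
  moreover have "\<not> binomial_factor (snd w) (fst w) (a i) (b i) dvd
      weighted_part (fst w) (snd w) (weighted_order (fst w) (snd w) f + 1) f"
    if i: "i \<in> {1..s}" and ri: "r i > 1" for i
  proof -
    have "[:- h i, 1:] ^ 2 dvd [:- h i, 1:] ^ r i" using ri by (intro le_imp_power_dvd) simp
    then have "[:- h i, 1:] ^ 2 dvd R" using dvdR[OF hz[OF i]] unfolding r_def by (rule dvd_trans)
    then obtain T where T: "R = [:- h i, 1:] ^ 2 * T" by blast
    have "poly R (h i) = 0" "poly (pderiv R) (h i) = 0"
      unfolding T power2_eq_square pderiv_mult poly_add poly_mult by simp_all
    then have "line_sum f w (?d + 1) (\<lambda>p. h i powi int (snd p div fst w)) \<noteq> 0"
      using Z0[OF hz[OF i]] by (rule root)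
    then show ?thesis
      unfolding weighted_order_eq[OF ne] binomial_factor_dvd_weighted_part[OF ww ab(1)[OF i] b0] ab(2)[OF i] .
  qed
  ultimately show ?thesis unfolding WHND_along_def by blast
qed

text \<open>A degenerate z is a root a i / b i with r i > 1. This contradicts the first alternative
  of \<open>WHND_along\<close> directly and the second through the next weighted part.\<close>

lemma WHND_imp_nondegenerate:
  fixes f :: "'a::field fps2"
  assumes w: "w \<in> active (supp f)" and ne: "supp f \<noteq> {}" and whnd: "WHND_along f (face_at w (supp f))"
  shows "nondegenerate f w"
proof -
  have ww: "w \<in> weights" using w by (simp add: active_def)
  let ?d = "worder w (supp f)"
  obtain m0 n0 s a b r where ef: "edge_factorization (face_at w (supp f)) f m0 n0 s a b r"
    and cond: "(\<forall>i\<in>{1..s}. r i = 1) \<or> (\<forall>i\<in>{1..s}. r i > 1 \<longrightarrow>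
      \<not> binomial_factor m0 n0 (a i) (b i) dvd weighted_part n0 m0 (weighted_order n0 m0 f + 1) f)"
    using whnd unfolding WHND_along_def by blast
  have mn: "(n0, m0) \<in> weights" using ef by (auto simp: edge_factorization_def weights_def coprime_commute)
  have nz: "a i \<noteq> 0" "b i \<noteq> 0" "r i > 0" if "i \<in> {1..s}" for i
    using ef that unfolding edge_factorization_def by blast+
  have dist: "a i * b j \<noteq> a j * b i" if "i \<in> {1..s}" "j \<in> {1..s}" "i \<noteq> j" for i j
    using ef that unfolding edge_factorization_def by blast
  define R where "R = (\<Prod>i\<in>{1..s}. [:a i, - b i:] ^ r i)"
  define M where "M = sum r {1..s}"
  have degR: "degree R \<le> M" unfolding R_def M_def by (rule homogenize_prod(1)) simp
  obtain p q where "edge_part (face_at w (supp f)) f = varx ^ p * vary ^ q *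
      (\<Prod>i=1..s. binomial_factor m0 n0 (a i) (b i) ^ r i)"
    using ef unfolding edge_factorization_def by blast
  then have ep: "edge_part (face_at w (supp f)) f = varx ^ p * vary ^ q * homogenize (n0, m0) M R"
    unfolding R_def M_def by (subst homogenize_prod(2)) simp_all
  have weq: "w = (n0, m0)" using edge_factorization_weight[OF w ne mn ep] by simp
  have wp: "weighted_part (fst w) (snd w) ?d f = varx ^ p * vary ^ q * homogenize w M R"
    using ep unfolding edge_part_face_at[OF ww] by (simp only: weq)
  show ?thesis
    unfolding nondegenerate_iff[OF ww]
  proof (intro allI impI notI)
    fix z :: 'a assume z: "z \<noteq> 0" and deg: "degenerate f w z (\<lambda>p. int (snd p div fst w))"
    have Rz: "poly R z = 0" "poly (pderiv R) z = 0"
      using deg line_sum_root_iff[OF ww z degR wp] by (auto simp: degenerate_def)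
    then obtain i where i: "i \<in> {1..s}" "poly ([:a i, - b i:] ^ r i) z = 0"
      unfolding R_def poly_prod by (auto simp: prod_zero_iff)
    then have "a i = b i * z" by (simp add: mult.commute)
    then have zi: "a i / b i = z" using nz(2)[OF i(1)] by simp
    \<comment> \<open>For a simple factor the derivative at z is - b i times the product of the
      other factors, which is nonzero since the ratios are distinct.\<close>
    have ri: "r i > 1"
    proof (rule ccontr)
      assume "\<not> r i > 1"
      then have r1: "r i = 1" using nz(3)[OF i(1)] by simp
      define T where "T = (\<Prod>j\<in>{1..s} - {i}. [:a j, - b j:] ^ r j)"
      have RT: "R = [:a i, - b i:] * T" unfolding R_def T_def using i(1) r1
        by (subst prod.remove[of _ i]) simp_all
      have "poly T z \<noteq> 0"
      proof
        assume "poly T z = 0"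
        then have "\<exists>j\<in>{1..s} - {i}. poly ([:a j, - b j:] ^ r j) z = 0"
          unfolding T_def poly_prod by (simp only: prod_zero_iff finite_Diff finite_atLeastAtMost)
        then obtain j where j: "j \<in> {1..s}" "j \<noteq> i" "poly ([:a j, - b j:] ^ r j) z = 0" by blast
        then have "a j = b j * z" by (simp add: mult.commute)
        then have "a i * b j = a j * b i" using \<open>a i = b i * z\<close> by simp
        then show False using dist[OF i(1) j(1)] j(2) by simp
      qed
      moreover have "poly (pderiv R) z = - b i * poly T z"
        unfolding RT pderiv_mult poly_add poly_mult using \<open>a i = b i * z\<close> by (simp add: pderiv_pCons)
      ultimately show False using Rz(2) nz(2)[OF i(1)] by simp
    qed
    have "line_sum f w (?d + 1) (\<lambda>p. (a i / b i) powi int (snd p div fst w)) = 0"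
      unfolding zi using deg by (simp add: degenerate_def)
    then have "binomial_factor (snd w) (fst w) (a i) (b i) dvd weighted_part (fst w) (snd w) (?d + 1) f"
      using binomial_factor_dvd_weighted_part[OF ww nz(1,2)[OF i(1)]] by blast
    then have "binomial_factor m0 n0 (a i) (b i) dvd weighted_part n0 m0 (weighted_order n0 m0 f + 1) f"
      using weighted_order_eq[OF ne, of w] by (simp add: weq)
    moreover have "\<not> (\<forall>i\<in>{1..s}. r i = 1)" using i(1) ri by force
    ultimately show False using cond i(1) ri by blast
  qed
qed

text \<open>A face with a single exponent has no nonzero root, so the condition holds there for
  free. Quantifying over all weights lets it be compared between charts without following
  edges.\<close>

lemma WHNND_iff:
  fixes f :: "'a::alg_closed_field fps2"
  assumes "supp f \<noteq> {}"
  shows "WHNND f \<longleftrightarrow> (\<forall>w\<in>weights. nondegenerate f w)"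
proof -
  have "WHNND f \<longleftrightarrow> (\<forall>w\<in>active (supp f). WHND_along f (face_at w (supp f)))"
    unfolding WHNND_def newton_edges_eq[OF assms] by auto
  also have "\<dots> \<longleftrightarrow> (\<forall>w\<in>active (supp f). nondegenerate f w)"
    using nondegenerate_imp_WHND[OF _ assms] WHND_imp_nondegenerate[OF _ assms] by blast
  also have "\<dots> \<longleftrightarrow> (\<forall>w\<in>weights. nondegenerate f w)"
    using nondegenerate_not_active[OF _ _ assms] by (auto simp: active_def)
  finally show ?thesis .
qed

section \<open>Infinite sums of nonnegative extended reals\<close>

text \<open>In \<open>ennreal\<close> every family is summable, so the usual rules for sums apply
  there without side conditions and are carried back.\<close>

lemma infsum_ereal_ennreal:
  assumes "\<And>x. x \<in> A \<Longrightarrow> f x \<ge> (0::ereal)"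
  shows "infsum f A = enn2ereal (infsum (\<lambda>x. e2ennreal (f x)) A)"
proof -
  have "infsum f A = infsum (enn2ereal \<circ> (\<lambda>x. e2ennreal (f x))) A"
    using assms by (intro infsum_cong) (simp add: enn2ereal_e2ennreal)
  also have "\<dots> = enn2ereal (infsum (\<lambda>x. e2ennreal (f x)) A)"
    by (simp add: infsum_comm_additive_general continuous_at_enn2ereal nonneg_summable_on_complete)
  finally show ?thesis .
qed

lemma infsum_ereal_nonneg: "(\<And>x. x \<in> A \<Longrightarrow> f x \<ge> (0::ereal)) \<Longrightarrow> infsum f A \<ge> 0"
  by (simp add: infsum_ereal_ennreal)

lemma infsum_ereal_Un:
  assumes "\<And>x. x \<in> A \<union> B \<Longrightarrow> f x \<ge> (0::ereal)" "A \<inter> B = {}"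
  shows "infsum f (A \<union> B) = infsum f A + infsum f B"
proof -
  have "infsum (\<lambda>x. e2ennreal (f x)) (A \<union> B)
      = infsum (\<lambda>x. e2ennreal (f x)) A + infsum (\<lambda>x. e2ennreal (f x)) B"
    using assms(2) by (intro infsum_Un_disjoint nonneg_summable_on_complete) auto
  moreover have "infsum f (A \<union> B) = enn2ereal (infsum (\<lambda>x. e2ennreal (f x)) (A \<union> B))"
    "infsum f A = enn2ereal (infsum (\<lambda>x. e2ennreal (f x)) A)"
    "infsum f B = enn2ereal (infsum (\<lambda>x. e2ennreal (f x)) B)"
    using assms(1) by (intro infsum_ereal_ennreal; simp)+
  ultimately show ?thesis by (simp add: plus_ennreal.rep_eq)
qed

lemma infsum_ereal_ge:
  assumes "\<And>x. x \<in> A \<Longrightarrow> f x \<ge> (0::ereal)" "a \<in> A"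
  shows "f a \<le> infsum f A"
proof -
  have A: "A = {a} \<union> (A - {a})" using assms(2) by blast
  have "infsum f ({a} \<union> (A - {a})) = infsum f {a} + infsum f (A - {a})"
    using assms by (intro infsum_ereal_Un) auto
  moreover have "infsum f {a} = f a" by simp
  moreover have "infsum f (A - {a}) \<ge> 0" using assms by (intro infsum_ereal_nonneg) auto
  ultimately show ?thesis unfolding A[symmetric] by (simp add: ereal_le_add_self)
qed

lemma infsum_ereal_eq_0_iff:
  assumes "\<And>x. x \<in> A \<Longrightarrow> f x \<ge> (0::ereal)"
  shows "infsum f A = 0 \<longleftrightarrow> (\<forall>x\<in>A. f x = 0)"
proof
  assume "infsum f A = 0"
  then show "\<forall>x\<in>A. f x = 0" using infsum_ereal_ge[of A f] assms by (metis antisym)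
next
  assume "\<forall>x\<in>A. f x = 0"
  then show "infsum f A = 0" by (intro infsum_0) auto
qed

section \<open>The delta invariant\<close>

lemma maximal_ideal_iff: "f \<in> maximal_ideal \<longleftrightarrow> coeff2 f 0 0 = 0"
proof
  assume "f \<in> maximal_ideal"
  then obtain g h where f: "f = varx * g + vary * h" by (auto simp: maximal_ideal_def)
  then have "coeff2 f 0 0 = coeff2 (varx ^ 1 * g) 0 0 + coeff2 (vary ^ 1 * h) 0 0"
    by (simp add: coeff2_def)
  then show "coeff2 f 0 0 = 0" unfolding coeff2_varx_power_mult coeff2_vary_power_mult by simp
next
  assume c: "coeff2 f 0 0 = 0"
  define g where "g = Abs_fps2 (\<lambda>i j. coeff2 f (Suc i) j)"
  define h where "h = Abs_fps2 (\<lambda>i j. if i = 0 then coeff2 f 0 (Suc j) else 0)"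
  have "f = varx * g + vary * h"
  proof (rule fps2_eqI)
    fix i j
    have "coeff2 (varx * g + vary * h) i j = coeff2 (varx ^ 1 * g) i j + coeff2 (vary ^ 1 * h) i j"
      by (simp add: coeff2_def)
    also have "\<dots> = coeff2 f i j"
      unfolding coeff2_varx_power_mult coeff2_vary_power_mult using c
      by (cases i; cases j) (auto simp: g_def h_def)
    finally show "coeff2 f i j = coeff2 (varx * g + vary * h) i j" ..
  qed
  then show "f \<in> maximal_ideal" unfolding maximal_ideal_def by blast
qed

lemma point_mult_eq:
  assumes "supp f \<noteq> {}" shows "point_mult f = mult (supp f)"
  unfolding point_mult_def
proof (rule Least_equality)
  obtain p where "p \<in> supp f" "wt (1, 1) p = mult (supp f)" using worder_attained[OF assms] by blast
  then show "\<exists>(i, j)\<in>supp f. i + j = mult (supp f)" by (cases p) auto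
next
  fix n assume "\<exists>(i, j)\<in>supp f. i + j = n"
  then obtain i j where ij: "(i, j) \<in> supp f" "i + j = n" by blast
  show "mult (supp f) \<le> n" using mult_le[OF ij(1)] ij(2) by simp
qed

subsection \<open>Strict transforms\<close>

lemma coeff2_strict_transform_Slope:
  "coeff2 (strict_transform (Slope a) f) n k =
     (\<Sum>j\<le>n + point_mult f. coeff2 f (n + point_mult f - j) j * of_nat (j choose k) * a ^ (j - k))"
  by simp

lemma coeff2_strict_transform_Slope_0:
  "coeff2 (strict_transform (Slope 0) f) n k =
     (if k \<le> n + point_mult f then coeff2 f (n + point_mult f - k) k else 0)"
proof -
  \<comment> \<open>For j < k truncated subtraction makes the power of 0 equal to 1, but then the
    binomial coefficient vanishes.\<close>
  have "coeff2 f (n + point_mult f - j) j * of_nat (j choose k) * 0 ^ (j - k)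
      = (if j = k then coeff2 f (n + point_mult f - k) k else 0)" for j
    by (cases j k rule: linorder_cases) (auto simp: binomial_eq_0)
  then show ?thesis unfolding coeff2_strict_transform_Slope by simp
qed

lemma coeff2_strict_transform_Vertical:
  "coeff2 (strict_transform Vertical f) i n =
     (if i \<le> n + point_mult f then coeff2 f i (n + point_mult f - i) else 0)"
  by simp

declare strict_transform.simps [simp del]

lemma point_mult_transpose2: "point_mult (transpose2 f) = point_mult f"
proof -
  have "(\<exists>(i, j)\<in>supp (transpose2 f). i + j = n) \<longleftrightarrow> (\<exists>(i, j)\<in>supp f. i + j = n)" for n
    by (auto simp: supp_transpose2 add.commute)
  then show ?thesis by (simp add: point_mult_def)
qed

lemma strict_transform_Vertical:
  "strict_transform Vertical f = transpose2 (strict_transform (Slope 0) (transpose2 f))"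
  by (rule fps2_eqI)
    (simp add: coeff2_strict_transform_Vertical coeff2_strict_transform_Slope_0 point_mult_transpose2)

lemma coeff2_blow_pt:
  assumes "p \<in> supp f"
  shows "coeff2 (strict_transform (Slope 0) f) (fst (blow_pt (mult (supp f)) p))
    (snd (blow_pt (mult (supp f)) p)) = coeff2 f (fst p) (snd p)"
proof -
  have "supp f \<noteq> {}" using assms by blast
  then have m: "point_mult f = mult (supp f)" by (rule point_mult_eq)
  have "fst p + snd p - mult (supp f) + mult (supp f) = fst p + snd p" using mult_le[OF assms] by simp
  then show ?thesis unfolding coeff2_strict_transform_Slope_0 m blow_pt_def fst_conv snd_conv by simp
qed

lemma supp_strict_transform_Slope_0:
  assumes "supp f \<noteq> {}" shows "supp (strict_transform (Slope 0) f) = blow (supp f)"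
proof (intro equalityI subsetI)
  fix q assume q: "q \<in> supp (strict_transform (Slope 0) f)"
  obtain n k where nk: "q = (n, k)" by (cases q)
  then have "k \<le> n + mult (supp f)" "coeff2 f (n + mult (supp f) - k) k \<noteq> 0"
    using q by (auto simp: mem_supp coeff2_strict_transform_Slope_0 point_mult_eq[OF assms] split: if_splits)
  then have "(n + mult (supp f) - k, k) \<in> supp f" "q = blow_pt (mult (supp f)) (n + mult (supp f) - k, k)"
    by (auto simp: mem_supp nk blow_pt_def)
  then show "q \<in> blow (supp f)" unfolding blow_def by blast
next
  fix q assume "q \<in> blow (supp f)"
  then obtain p where p: "p \<in> supp f" "q = blow_pt (mult (supp f)) p" by (auto simp: blow_def)
  have "coeff2 (strict_transform (Slope 0) f) (fst q) (snd q) \<noteq> 0"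
    unfolding p(2) coeff2_blow_pt[OF p(1)] using p(1) unfolding mem_supp .
  then show "q \<in> supp (strict_transform (Slope 0) f)" unfolding mem_supp .
qed

lemma supp_strict_transform_Vertical:
  assumes "supp f \<noteq> {}"
  shows "supp (strict_transform Vertical f) = prod.swap ` blow (prod.swap ` supp f)"
  unfolding strict_transform_Vertical supp_transpose2
  using assms by (subst supp_strict_transform_Slope_0) (simp_all add: supp_transpose2)

lemma nondegenerate_strict_transform:
  assumes "supp f \<noteq> {}"
  shows "(\<forall>w\<in>weights. nondegenerate f w) \<longleftrightarrow> nondegenerate f (1, 1)
    \<and> (\<forall>w\<in>weights. nondegenerate (strict_transform (Slope 0) f) w)
    \<and> (\<forall>w\<in>weights. nondegenerate (strict_transform Vertical f) w)"
proof -
  have S: "nondegenerate (strict_transform (Slope 0) g) (a, b) \<longleftrightarrow> nondegenerate g (a, a + b)"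
    if ab: "(a, b) \<in> weights" and g: "supp g \<noteq> {}" for g :: "'a fps2" and a b
    using nondegenerate_blow[OF ab supp_strict_transform_Slope_0[OF g] g] coeff2_blow_pt by blast
  have V: "nondegenerate (strict_transform Vertical f) (b, a) \<longleftrightarrow> nondegenerate f (a + b, a)"
    if ab: "(a, b) \<in> weights" for a b
  proof -
    have "nondegenerate (strict_transform Vertical f) (b, a)
        \<longleftrightarrow> nondegenerate (strict_transform (Slope 0) (transpose2 f)) (a, b)"
      unfolding strict_transform_Vertical
      using nondegenerate_transpose2[of "strict_transform (Slope 0) (transpose2 f)" "(a, b)"] by simp
    also have "\<dots> \<longleftrightarrow> nondegenerate (transpose2 f) (a, a + b)"
      using ab assms by (intro S) (simp_all add: supp_transpose2)
    also have "\<dots> \<longleftrightarrow> nondegenerate f (a + b, a)"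
      using nondegenerate_transpose2[of f "(a + b, a)"] by simp
    finally show ?thesis .
  qed
  have sym: "(b, a) \<in> weights \<longleftrightarrow> (a, b) \<in> weights" for a b using swap_weights[of "(a, b)"] by simp
  have pos: "b > 0" if "(a, b) \<in> weights" for a b :: nat using that by (simp add: weights_def)
  show ?thesis
  proof (intro iffI conjI ballI)
    assume all: "\<forall>w\<in>weights. nondegenerate f w"
    show "nondegenerate f (1, 1)" using all one_one_weights(1) by (rule bspec)
    fix w assume w: "w \<in> weights"
    obtain a b where ab: "w = (a, b)" by (cases w)
    have "(a, a + b) \<in> weights" using w ab weights_add_iff[OF pos] by simp
    then show "nondegenerate (strict_transform (Slope 0) f) w"
      using all S[OF _ assms] w unfolding ab by blast
    have ba: "(b, a) \<in> weights" using w ab sym by simp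
    then have "(b, b + a) \<in> weights" using weights_add_iff[OF pos] by simp
    then have "(b + a, b) \<in> weights" unfolding sym[of "b + a" b] .
    then show "nondegenerate (strict_transform Vertical f) w"
      using all V[OF ba] unfolding ab by blast
  next
    fix w assume h: "nondegenerate f (1, 1) \<and> (\<forall>w\<in>weights. nondegenerate (strict_transform (Slope 0) f) w)
      \<and> (\<forall>w\<in>weights. nondegenerate (strict_transform Vertical f) w)" and w: "w \<in> weights"
    show "nondegenerate f w"
    proof (cases rule: weights_cases[OF w])
      case 1 then show ?thesis using h by simp
    next
      case (2 a b) then show ?thesis using h S[OF 2(2) assms] by simp
    next
      case (3 a b)
      then have ba: "(b, a) \<in> weights" by (simp add: sym)
      then show ?thesis using h 3 V[OF ba] by (simp add: add.commute)
    qed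
  qed
qed

section \<open>Oblique directions and multiplicity at most one\<close>

lemma line_sum_one_one: "line_sum f (1, 1) l g = (\<Sum>j\<le>l. coeff2 f (l - j) j * g (l - j, j))"
proof -
  have "{p. wt (1, 1) p = l} = (\<lambda>j. (l - j, j)) ` {..l}"
    by (auto simp: wt_def image_iff prod_eq_iff)
  moreover have "inj_on (\<lambda>j. (l - j, j)) {..l}" by (auto intro: inj_onI)
  ultimately show ?thesis unfolding line_sum_def by (simp add: sum.reindex)
qed

text \<open>Units are included: multiplicities 0 and 1 are the two for which m (m - 1)
  vanishes.\<close>

definition smooth :: "'a::field fps2 \<Rightarrow> bool" where
  "smooth f \<longleftrightarrow> (\<exists>p\<in>supp f. fst p + snd p \<le> 1)"

lemma smooth_iff: "smooth f \<longleftrightarrow> coeff2 f 0 0 \<noteq> 0 \<or> coeff2 f 1 0 \<noteq> 0 \<or> coeff2 f 0 1 \<noteq> 0"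
proof -
  have "i + j \<le> 1 \<longleftrightarrow> (i = 0 \<and> j = 0) \<or> (i = 1 \<and> j = 0) \<or> (i = 0 \<and> j = 1)" for i j :: nat by auto
  then show ?thesis by (auto simp: smooth_def supp_def)
qed

lemma smooth_iff_mult: "supp f \<noteq> {} \<Longrightarrow> smooth f \<longleftrightarrow> mult (supp f) \<le> 1"
  unfolding smooth_def
  using mult_le[of _ "supp f"] worder_attained[of "supp f" "(1, 1)"]
  by (metis le_trans mult_1 snd_conv fst_conv wt_def)

text \<open>The coefficients of order at most one of the strict transform at a point of the exceptional
  divisor away from the axes are the values there of the tangent cone, of its derivative and of the
  next homogeneous part.\<close>

lemma degenerate_one_one_iff:
  assumes "supp f \<noteq> {}" "a \<noteq> 0"
  shows "degenerate f (1, 1) a (\<lambda>p. int (snd p div fst (1::nat, 1::nat)))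
    \<longleftrightarrow> \<not> smooth (strict_transform (Slope a) f)"
proof -
  let ?m = "mult (supp f)"
  have m: "point_mult f = ?m" by (rule point_mult_eq[OF assms(1)])
  have c00: "coeff2 (strict_transform (Slope a) f) 0 0 = (\<Sum>j\<le>?m. coeff2 f (?m - j) j * a ^ j)"
    and c10: "coeff2 (strict_transform (Slope a) f) 1 0 = (\<Sum>j\<le>?m + 1. coeff2 f (?m + 1 - j) j * a ^ j)"
    unfolding coeff2_strict_transform_Slope m by simp_all
  have c01: "a * coeff2 (strict_transform (Slope a) f) 0 1 = (\<Sum>j\<le>?m. coeff2 f (?m - j) j * (of_nat j * a ^ j))"
    unfolding coeff2_strict_transform_Slope m sum_distrib_left
  proof (rule sum.cong)
    fix j
    show "a * (coeff2 f (0 + ?m - j) j * of_nat (j choose 1) * a ^ (j - 1)) = coeff2 f (?m - j) j * (of_nat j * a ^ j)"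
      by (cases j) (simp_all add: algebra_simps)
  qed simp
  have "degenerate f (1, 1) a (\<lambda>p. int (snd p div fst (1::nat, 1::nat)))
    \<longleftrightarrow> coeff2 (strict_transform (Slope a) f) 0 0 = 0 \<and> a * coeff2 (strict_transform (Slope a) f) 0 1 = 0
      \<and> coeff2 (strict_transform (Slope a) f) 1 0 = 0"
    unfolding degenerate_def line_sum_one_one c00 c01 c10 by simp
  then show ?thesis using assms(2) by (auto simp: smooth_iff)
qed

text \<open>On the exceptional divisor the strict transform restricts to the dehomogenized tangent
  cone, whose degree is at most the multiplicity. Hence strict transforms stay nonzero and their
  multiplicity does not grow.\<close>

lemma strict_transform_low_coeff:
  assumes "supp f \<noteq> {}"
  obtains q where "q \<in> supp (strict_transform p f)" "fst q + snd q \<le> mult (supp f)"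
proof (cases p)
  case (Slope a)
  let ?m = "mult (supp f)"
  let ?J = "{j. j \<le> ?m \<and> coeff2 f (?m - j) j \<noteq> 0}"
  obtain x where x: "x \<in> supp f" "wt (1, 1) x = ?m" using worder_attained[OF assms] by blast
  have "?m - snd x = fst x" "snd x \<le> ?m" unfolding x(2)[symmetric] by (simp_all add: wt_def)
  then have "snd x \<in> ?J" using x(1) by (simp add: mem_supp)
  then have k: "Max ?J \<in> ?J" by (intro Max_in) auto
  \<comment> \<open>Translation by a does not change the top coefficient: larger j have coefficient
    0, smaller ones binomial coefficient 0, and j = k has binomial coefficient 1 in every
    characteristic.\<close>
  define k where "k = Max ?J"
  have "coeff2 f (?m - j) j * of_nat (j choose k) * a ^ (j - k) = (if j = k then coeff2 f (?m - k) k else 0)"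
    if "j \<le> ?m" for j
  proof (cases j k rule: linorder_cases)
    case greater
    have "j \<notin> ?J"
    proof
      assume "j \<in> ?J" then have "j \<le> k" unfolding k_def by (intro Max_ge) auto
      then show False using greater by simp
    qed
    then show ?thesis using that greater by simp
  qed (auto simp: binomial_eq_0)
  then have "coeff2 (strict_transform (Slope a) f) 0 k = (\<Sum>j\<le>?m. if j = k then coeff2 f (?m - k) k else 0)"
    unfolding coeff2_strict_transform_Slope point_mult_eq[OF assms] by (intro sum.cong) auto
  also have "\<dots> = coeff2 f (?m - k) k" using k by (simp add: k_def)
  finally have "(0, k) \<in> supp (strict_transform p f)" using k by (simp add: Slope mem_supp k_def)
  then show thesis using that[of "(0, k)"] k by (simp add: k_def)
next
  case Vertical
  let ?m = "mult (supp f)"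
  obtain x where x: "x \<in> supp f" "wt (1, 1) x = ?m" using worder_attained[OF assms] by blast
  then have xm: "fst x \<le> ?m" "snd x = ?m - fst x" by (auto simp: wt_def)
  then have "coeff2 (strict_transform Vertical f) (fst x) 0 = coeff2 f (fst x) (snd x)"
    unfolding coeff2_strict_transform_Vertical point_mult_eq[OF assms] by simp
  then have "(fst x, 0) \<in> supp (strict_transform p f)" using x by (simp add: Vertical mem_supp)
  then show thesis using that[of "(fst x, 0)"] xm by simp
qed

lemma supp_strict_transform_nonempty: "supp f \<noteq> {} \<Longrightarrow> supp (strict_transform p f) \<noteq> {}"
  by (rule strict_transform_low_coeff[of f p]) auto

lemma smooth_strict_transform:
  assumes "smooth f" shows "smooth (strict_transform p f)"
proof -
  have ne: "supp f \<noteq> {}" using assms by (auto simp: smooth_def)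
  obtain q where "q \<in> supp (strict_transform p f)" "fst q + snd q \<le> mult (supp f)"
    by (rule strict_transform_low_coeff[OF ne])
  moreover have "mult (supp f) \<le> 1" using assms smooth_iff_mult[OF ne] by simp
  ultimately show ?thesis unfolding smooth_def by (meson le_trans)
qed

subsection \<open>Summation over the infinitely near points\<close>

definition point_term :: "'a::field fps2 \<Rightarrow> 'a direction list \<Rightarrow> ereal" where
  "point_term f Q = (let m = real (point_mult (strict_transform_at Q f)) in ereal (m * (m - 1) / 2))"

lemma delta_eq: "delta f = infsum (point_term f) (infinitely_near_points f)"
  unfolding delta_def by (rule infsum_cong) (simp add: point_term_def)

lemma point_term_nonneg: "point_term f Q \<ge> 0"
proof -
  have "real m * (real m - 1) \<ge> 0" for m by (cases m) auto
  then show ?thesis by (simp add: point_term_def Let_def)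
qed

lemma Cons_infinitely_near:
  assumes "coeff2 f 0 0 = 0"
  shows "p # Q \<in> infinitely_near_points f \<longleftrightarrow> Q \<in> infinitely_near_points (strict_transform p f)"
  using assms by (simp add: infinitely_near_points_def maximal_ideal_iff)

lemma infsum_point_term_Cons:
  "infsum (point_term f) ((#) p ` infinitely_near_points (strict_transform p f)) = delta (strict_transform p f)"
proof -
  have "point_term f \<circ> (#) p = point_term (strict_transform p f)" by (simp add: fun_eq_iff point_term_def)
  then show ?thesis unfolding delta_eq by (subst infsum_reindex) auto
qed

definition oblique_points :: "'a::field fps2 \<Rightarrow> 'a direction list set" where
  "oblique_points f = {Slope a # Q | a Q. a \<noteq> 0 \<and> Q \<in> infinitely_near_points (strict_transform (Slope a) f)}"

lemma delta_blow:
  assumes "coeff2 f 0 0 = 0"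
  shows "delta f = ereal (real (point_mult f) * (real (point_mult f) - 1) / 2)
    + delta (strict_transform (Slope 0) f) + delta (strict_transform Vertical f)
    + infsum (point_term f) (oblique_points f)"
proof -
  let ?A = "(#) (Slope 0) ` infinitely_near_points (strict_transform (Slope 0) f)"
  let ?B = "(#) Vertical ` infinitely_near_points (strict_transform Vertical f)"
  have "infinitely_near_points f = {[]} \<union> ?A \<union> ?B \<union> oblique_points f"
  proof (intro equalityI subsetI)
    fix Q assume Q: "Q \<in> infinitely_near_points f"
    show "Q \<in> {[]} \<union> ?A \<union> ?B \<union> oblique_points f"
    proof (cases Q)
      case (Cons p R)
      then have "R \<in> infinitely_near_points (strict_transform p f)" using Q Cons_infinitely_near[OF assms] by simp
      then show ?thesis by (cases p) (auto simp: Cons oblique_points_def)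
    qed simp
  next
    fix Q assume "Q \<in> {[]} \<union> ?A \<union> ?B \<union> oblique_points f"
    moreover have "[] \<in> infinitely_near_points f"
      using assms by (simp add: infinitely_near_points_def maximal_ideal_iff)
    ultimately show "Q \<in> infinitely_near_points f"
      by (auto simp: oblique_points_def Cons_infinitely_near[OF assms])
  qed
  moreover have "infsum (point_term f) ({[]} \<union> ?A \<union> ?B \<union> oblique_points f)
    = infsum (point_term f) {[]} + infsum (point_term f) ?A + infsum (point_term f) ?B
      + infsum (point_term f) (oblique_points f)"
    by (subst infsum_ereal_Un; (subst infsum_ereal_Un)?; (subst infsum_ereal_Un)?)
      (auto simp: point_term_nonneg oblique_points_def)
  moreover have "infsum (point_term f) {[]} = ereal (real (point_mult f) * (real (point_mult f) - 1) / 2)"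
    by (simp add: point_term_def Let_def)
  ultimately show ?thesis unfolding delta_eq[of f] infsum_point_term_Cons by simp
qed

lemma smooth_imp_point_mult:
  assumes "smooth f" shows "point_mult (strict_transform_at Q f) \<le> 1"
  using assms
proof (induction Q arbitrary: f)
  case Nil
  then have "supp f \<noteq> {}" by (auto simp: smooth_def)
  then show ?case using Nil smooth_iff_mult[of f] point_mult_eq[of f] by simp
next
  case (Cons p Q)
  then show ?case using Cons.IH[OF smooth_strict_transform[OF Cons.prems]] by simp
qed

text \<open>A vanishing sum of nonnegative terms makes the term of the origin vanish, which bounds
  the multiplicity of a non-unit by 1. Conversely, multiplicity at most 1 persists at all infinitely
  near points.\<close>

lemma delta_eq_0_iff:
  assumes "supp f \<noteq> {}" shows "delta f = 0 \<longleftrightarrow> smooth f"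
proof
  assume "smooth f"
  have "point_term f Q = 0" for Q
  proof -
    have "point_mult (strict_transform_at Q f) = 0 \<or> point_mult (strict_transform_at Q f) = 1"
      using smooth_imp_point_mult[OF \<open>smooth f\<close>, of Q] by linarith
    then show ?thesis by (auto simp: point_term_def Let_def)
  qed
  then show "delta f = 0" unfolding delta_eq by (intro infsum_0) auto
next
  assume d: "delta f = 0"
  show "smooth f"
  proof (cases "coeff2 f 0 0 = 0")
    case True
    then have "[] \<in> infinitely_near_points f" by (simp add: infinitely_near_points_def maximal_ideal_iff)
    then have "point_term f [] = 0"
      using d infsum_ereal_eq_0_iff[of "infinitely_near_points f" "point_term f"] point_term_nonneg
      unfolding delta_eq by blast
    then have "point_mult f = 0 \<or> point_mult f = 1" by (auto simp: point_term_def Let_def zero_ereal_def)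
    then show ?thesis using smooth_iff_mult[OF assms] point_mult_eq[OF assms] by auto
  qed (simp add: smooth_iff)
qed

lemma oblique_sum_eq_0_iff:
  assumes "supp f \<noteq> {}"
  shows "infsum (point_term f) (oblique_points f) = 0 \<longleftrightarrow> nondegenerate f (1, 1)"
proof -
  have term_Cons: "point_term f (p # Q) = point_term (strict_transform p f) Q" for p Q
    by (simp add: point_term_def)
  have "infsum (point_term f) (oblique_points f) = 0 \<longleftrightarrow> (\<forall>x\<in>oblique_points f. point_term f x = 0)"
    by (rule infsum_ereal_eq_0_iff) (rule point_term_nonneg)
  also have "\<dots> \<longleftrightarrow> (\<forall>a. a \<noteq> 0 \<longrightarrow> (\<forall>Q\<in>infinitely_near_points (strict_transform (Slope a) f).
      point_term f (Slope a # Q) = 0))"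
    by (auto simp: oblique_points_def)
  also have "\<dots> \<longleftrightarrow> (\<forall>a. a \<noteq> 0 \<longrightarrow> (\<forall>Q\<in>infinitely_near_points (strict_transform (Slope a) f).
      point_term (strict_transform (Slope a) f) Q = 0))"
    by (simp only: term_Cons)
  also have "\<dots> \<longleftrightarrow> (\<forall>a. a \<noteq> 0 \<longrightarrow> delta (strict_transform (Slope a) f) = 0)"
    by (simp add: delta_eq infsum_ereal_eq_0_iff[OF point_term_nonneg])
  also have "\<dots> \<longleftrightarrow> (\<forall>a. a \<noteq> 0 \<longrightarrow> smooth (strict_transform (Slope a) f))"
    using delta_eq_0_iff[OF supp_strict_transform_nonempty[OF assms]] by simp
  also have "\<dots> \<longleftrightarrow> nondegenerate f (1, 1)"
    using degenerate_one_one_iff[OF assms] unfolding nondegenerate_iff[OF one_one_weights(1)] by blast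
  finally show ?thesis .
qed

subsection \<open>Comparison with the Newton delta invariant\<close>

text \<open>With at most two monomials the dehomogenized part is linear up to a power of T and has
  no multiple nonzero root.\<close>

lemma nondegenerate_len_le_1:
  assumes "w \<in> weights" "supp f \<noteq> {}" "len w (supp f) \<le> 1"
  shows "nondegenerate f w"
proof (cases "w \<in> active (supp f)")
  case False then show ?thesis using nondegenerate_not_active[OF assms(1) _ assms(2)] by blast
next
  case True
  then have L: "len w (supp f) = 1" using assms(3) by (simp add: active_def)
  have w0: "fst w > 0" "snd w > 0" using assms(1) by (auto simp: weights_def)
  obtain i j where ij: "(i + snd w, j) \<in> mface w (supp f)" "(i, j + fst w) \<in> mface w (supp f)"
    and all: "\<And>p. p \<in> mface w (supp f) \<Longrightarrow> \<exists>k\<le>1. p = (i + (1 - k) * snd w, j + k * fst w)"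
    using mface_ends[OF assms(1,2)] unfolding L by (metis mult_1)
  have "p = (i + snd w, j) \<or> p = (i, j + fst w)" if pM: "p \<in> mface w (supp f)" for p
  proof -
    obtain k :: nat where k: "k \<le> 1" "p = (i + (1 - k) * snd w, j + k * fst w)" using all[OF pM] by blast
    have "k = 0 \<or> k = 1" using k(1) by linarith
    then show ?thesis using k(2) by auto
  qed
  then have "mface w (supp f) = {(i + snd w, j), (i, j + fst w)}" using ij by blast
  then have M: "{p \<in> supp f. wt w p = worder w (supp f)} = {(i + snd w, j), (i, j + fst w)}"
    by (simp add: mface_def)
  have ls: "line_sum f w (worder w (supp f)) g
      = coeff2 f (i + snd w) j * g (i + snd w, j) + coeff2 f i (j + fst w) * g (i, j + fst w)" for g
    unfolding line_sum_supp[OF assms(1)] M using w0 by simp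
  have c: "coeff2 f i (j + fst w) \<noteq> 0" using ij(2) by (simp add: mface_def mem_supp)
  have dv: "(j + fst w) div fst w = j div fst w + 1" using w0 by simp
  show ?thesis
    unfolding nondegenerate_iff[OF assms(1)]
  proof (intro allI impI notI)
    fix z :: 'a assume z: "z \<noteq> 0" and "degenerate f w z (\<lambda>p. int (snd p div fst w))"
    then have e: "coeff2 f (i + snd w) j * z ^ (j div fst w) + coeff2 f i (j + fst w) * z ^ (j div fst w + 1) = 0"
      "coeff2 f (i + snd w) j * (of_nat (j div fst w) * z ^ (j div fst w))
        + coeff2 f i (j + fst w) * (of_nat (j div fst w + 1) * z ^ (j div fst w + 1)) = 0"
      unfolding degenerate_def ls snd_conv dv power_int_of_nat of_int_of_nat_eq by blast+
    \<comment> \<open>Subtracting a multiple of the value from the Euler derivative isolates the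
      upper monomial with coefficient 1; no integer is divided by, so the characteristic does not
      matter.\<close>
    have "coeff2 f i (j + fst w) * z ^ (j div fst w + 1)
      = (coeff2 f (i + snd w) j * (of_nat (j div fst w) * z ^ (j div fst w))
        + coeff2 f i (j + fst w) * (of_nat (j div fst w + 1) * z ^ (j div fst w + 1)))
        - of_nat (j div fst w) * (coeff2 f (i + snd w) j * z ^ (j div fst w)
          + coeff2 f i (j + fst w) * z ^ (j div fst w + 1))"
      by (simp add: algebra_simps)
    then have "coeff2 f i (j + fst w) * z ^ (j div fst w + 1) = 0" unfolding e by simp
    then show False using c z by simp
  qed
qed

text \<open>For w = (a, b) a face of lattice length L has an end point of weight at least L a b,
  whereas an exponent with i + j \<le> 1 weighs at most max a b \<le> a b. Hence L \<le> 1.\<close>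

lemma smooth_nondegenerate:
  assumes "smooth f" "w \<in> weights" shows "nondegenerate f w"
proof -
  have w0: "fst w > 0" "snd w > 0" using assms(2) by (auto simp: weights_def)
  obtain x where x: "x \<in> supp f" "fst x + snd x \<le> 1" using assms(1) by (auto simp: smooth_def)
  have ne: "supp f \<noteq> {}" using x by blast
  obtain i j where p: "(i, j + len w (supp f) * fst w) \<in> mface w (supp f)"
    by (rule mface_ends[OF assms(2) ne])
  have "wt w (i, j + len w (supp f) * fst w) \<le> wt w x"
    using p worder_le[OF x(1), of w] by (simp add: mface_def del: wt_Pair)
  then have le: "snd w * (len w (supp f) * fst w) \<le> fst w * fst x + snd w * snd x"
    by (simp add: wt_def distrib_left)
  have "fst w * fst x + snd w * snd x \<le> fst w * snd w"
  proof -
    have "(fst x = 0 \<and> snd x \<le> 1) \<or> (fst x = 1 \<and> snd x = 0)" using x(2) by auto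
    then show ?thesis
    proof
      assume "fst x = 0 \<and> snd x \<le> 1"
      then have "snd w * snd x \<le> snd w * fst w" using w0 by (intro mult_le_mono2) linarith
      then show ?thesis using \<open>fst x = 0 \<and> snd x \<le> 1\<close> by (simp add: mult.commute)
    qed (use w0 in simp)
  qed
  then have "snd w * (len w (supp f) * fst w) \<le> fst w * snd w" using le by (rule order_trans[rotated])
  then have "len w (supp f) * (fst w * snd w) \<le> 1 * (fst w * snd w)" by (simp only: mult_ac mult_1)
  then have "len w (supp f) \<le> 1" using w0 by simp
  then show ?thesis by (rule nondegenerate_len_le_1[OF assms(2) ne])
qed

text \<open>A point with positive coordinates weighs at least a + b, more than any exponent with i +
  j \<le> 1.\<close>

lemma smooth_below:
  assumes "smooth f" shows "below (supp f) = {}"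
proof (rule ccontr)
  assume "below (supp f) \<noteq> {}"
  then obtain u where "u \<in> below (supp f)" by blast
  then obtain w where u: "fst u > 0" "snd u > 0" "w \<in> weights" "\<forall>p\<in>supp f. wt w u \<le> wt w p"
    unfolding below_def by blast
  obtain x where x: "x \<in> supp f" "fst x + snd x \<le> 1" using assms by (auto simp: smooth_def)
  have w0: "fst w > 0" "snd w > 0" using u by (auto simp: weights_def)
  have "fst w * 1 \<le> fst w * fst u" "snd w * 1 \<le> snd w * snd u" using u by (intro mult_le_mono2; linarith)+
  then have "fst w + snd w \<le> wt w u" unfolding wt_def by linarith
  also have "\<dots> \<le> wt w x" using u x by blast
  also have "\<dots> < fst w + snd w"
  proof -
    have "(fst x = 0 \<and> snd x \<le> 1) \<or> (fst x = 1 \<and> snd x = 0)" using x(2) by auto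
    then show ?thesis
    proof
      assume "fst x = 0 \<and> snd x \<le> 1"
      then have "fst x = 0" "snd x = 0 \<or> snd x = 1" by auto
      then show ?thesis using w0 by (auto simp: wt_def)
    qed (use w0 in \<open>simp add: wt_def\<close>)
  qed
  finally show False by simp
qed

text \<open>The lower bounds are finite, so an excess of one summand cannot be made up by another,
  and an infinite summand rules out equality.\<close>

lemma ereal_sum_compare:
  fixes D0 D1 R :: ereal
  assumes "ereal b \<le> D0" "ereal c \<le> D1" "0 \<le> R"
  shows "ereal (a + b + c) \<le> ereal a + D0 + D1 + R"
    and "ereal a + D0 + D1 + R = ereal (a + b + c) \<longleftrightarrow> D0 = ereal b \<and> D1 = ereal c \<and> R = 0"
  using assms by (cases D0; cases D1; cases R; auto)+

text \<open>The inequality is carried along with the equivalence: only with lower bounds for both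
  transforms does equality of the totals force equality of the summands. Multiplicity at least two
  makes both counts drop.\<close>

lemma delta_compare:
  assumes "thin (supp f)"
  shows "ereal (card (below (supp f))) \<le> delta f
    \<and> (delta f = ereal (card (below (supp f))) \<longleftrightarrow> (\<forall>w\<in>weights. nondegenerate f w))"
  using assms
proof (induction "card (below (supp f))" arbitrary: f rule: less_induct)
  case (less f)
  have ne: "supp f \<noteq> {}" using less.prems by (rule thin_nonempty)
  show ?case
  proof (cases "smooth f")
    case True
    then show ?thesis using smooth_below[OF True] smooth_nondegenerate[OF True] delta_eq_0_iff[OF ne]
      by (simp add: zero_ereal_def[symmetric])
  next
    case False
    let ?f0 = "strict_transform (Slope 0) f" and ?f1 = "strict_transform Vertical f"
    let ?m = "mult (supp f)"
    have m2: "?m \<ge> 2" using False smooth_iff_mult[OF ne] by simp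
    have s0: "supp ?f0 = blow (supp f)" by (rule supp_strict_transform_Slope_0[OF ne])
    have s1: "supp ?f1 = prod.swap ` blow (prod.swap ` supp f)" by (rule supp_strict_transform_Vertical[OF ne])
    have thin: "thin (supp ?f0)" "thin (supp ?f1)"
      unfolding s0 s1 using less.prems thin_blow[of "supp f"] thin_blow[of "prod.swap ` supp f"] by simp_all
    have b1: "card (below (supp ?f1)) = card (below (blow (prod.swap ` supp f)))"
      unfolding s1 below_swap by (rule card_image) (auto intro: inj_onI)
    have card: "2 * card (below (supp f)) = ?m * (?m - 1) + 2 * card (below (supp ?f0)) + 2 * card (below (supp ?f1))"
      unfolding b1 s0 by (rule card_below[OF less.prems])
    have "?m * (?m - 1) > 0" using m2 by simp
    then have lt: "card (below (supp ?f0)) < card (below (supp f))" "card (below (supp ?f1)) < card (below (supp f))"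
      using card by linarith+
    note IH0 = less.hyps[OF lt(1) thin(1)] and IH1 = less.hyps[OF lt(2) thin(2)]
    have "real (2 * card (below (supp f))) = real (?m * (?m - 1) + 2 * card (below (supp ?f0)) + 2 * card (below (supp ?f1)))"
      unfolding card ..
    then have C: "real (card (below (supp f)))
        = real ?m * (real ?m - 1) / 2 + real (card (below (supp ?f0))) + real (card (below (supp ?f1)))"
      using m2 by (simp add: of_nat_diff)
    have "coeff2 f 0 0 = 0" using False by (simp add: smooth_iff)
    then have D: "delta f = ereal (real ?m * (real ?m - 1) / 2) + delta ?f0 + delta ?f1
        + infsum (point_term f) (oblique_points f)"
      using delta_blow[of f] unfolding point_mult_eq[OF ne] by blast
    have R: "0 \<le> infsum (point_term f) (oblique_points f)"
      by (rule infsum_ereal_nonneg) (rule point_term_nonneg)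
    note cmp = ereal_sum_compare[OF IH0[THEN conjunct1] IH1[THEN conjunct1] R, of "real ?m * (real ?m - 1) / 2"]
    show ?thesis
      unfolding D C nondegenerate_strict_transform[OF ne]
      using cmp IH0 IH1 oblique_sum_eq_0_iff[OF ne] by blast
  qed
qed

text \<open>Carries reducedness over to exponents: if all first coordinates were at least 2, the
  square of the non-unit x would divide f.\<close>

lemma squarefree_thin:
  assumes "squarefree f" shows "thin (supp f)"
proof -
  have not_unit: "\<not> (varx :: 'a fps2) dvd 1" "\<not> (vary :: 'a fps2) dvd 1"
  proof -
    have one: "coeff2 (1 :: 'a fps2) 0 0 = 1" by (simp add: coeff2_def)
    show "\<not> (varx :: 'a fps2) dvd 1"
    proof
      assume "(varx :: 'a fps2) dvd 1"
      then obtain g :: "'a fps2" where "1 = varx ^ 1 * g" by auto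
      then have "coeff2 (varx ^ 1 * g) 0 0 = 1" using one by simp
      then show False unfolding coeff2_varx_power_mult by simp
    qed
    show "\<not> (vary :: 'a fps2) dvd 1"
    proof
      assume "(vary :: 'a fps2) dvd 1"
      then obtain g :: "'a fps2" where "1 = vary ^ 1 * g" by auto
      then have "coeff2 (vary ^ 1 * g) 0 0 = 1" using one by simp
      then show False unfolding coeff2_vary_power_mult by simp
    qed
  qed
  have "\<exists>p\<in>supp f. fst p \<le> 1"
  proof (rule ccontr)
    assume neg: "\<not> ?thesis"
    have z: "coeff2 f i j = 0" if "i < 2" for i j
    proof (rule ccontr)
      assume "coeff2 f i j \<noteq> 0"
      then have "(i, j) \<in> supp f" by (simp add: supp_def)
      then show False using neg that by fastforce
    qed
    have "f = varx ^ 2 * Abs_fps2 (\<lambda>i j. coeff2 f (i + 2) j)"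
      by (rule fps2_eqI) (simp add: coeff2_varx_power_mult z not_less del: add_2_eq_Suc')
    then have "varx ^ 2 dvd f" by (rule dvdI)
    then show False using assms not_unit(1) unfolding squarefree_def by blast
  qed
  moreover have "\<exists>p\<in>supp f. snd p \<le> 1"
  proof (rule ccontr)
    assume neg: "\<not> ?thesis"
    have z: "coeff2 f i j = 0" if "j < 2" for i j
    proof (rule ccontr)
      assume "coeff2 f i j \<noteq> 0"
      then have "(i, j) \<in> supp f" by (simp add: supp_def)
      then show False using neg that by fastforce
    qed
    have "f = vary ^ 2 * Abs_fps2 (\<lambda>i j. coeff2 f i (j + 2))"
      by (rule fps2_eqI) (simp add: coeff2_vary_power_mult z not_less del: add_2_eq_Suc')
    then have "vary ^ 2 dvd f" by (rule dvdI)
    then show False using assms not_unit(2) unfolding squarefree_def by blast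
  qed
  ultimately show ?thesis by (simp add: thin_def)
qed

theorem theorem3p12:
  fixes f :: "'a::alg_closed_field fps2"
  assumes "f \<in> maximal_ideal"
    and "squarefree f"
  shows "delta f = delta_N f \<longleftrightarrow> WHNND f"
proof -
  have thin: "thin (supp f)" using assms(2) by (rule squarefree_thin)
  show ?thesis
    unfolding delta_N_eq[OF thin] WHNND_iff[OF thin_nonempty[OF thin]]
    using delta_compare[OF thin] by blast
qed

end
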